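(* Let $X$ be a separable rearrangement invariant space on $[0,1]$ with non-trivial (i.e. finite) upper Boyd index. Then every block sequence of the Haar basis in $X$ is RUD. In particular, every weakly null sequence $(x_n)_n$ in $X$ has a subsequence which is basic RUD.
   Context: For vectors $y_1,\dots,y_n$ put $\mathbb E_\varepsilon\|\sum_{i=1}^n\varepsilon_iy_i\|=2^{-n}\sum_{\varepsilon\in\{-1,1\}^n}\|\sum_{i=1}^n\varepsilon_iy_i\|$. A basic sequence $(x_n)_n$ is RUD if there is a constant $C$ such that $\|\sum_{i=1}^na_ix_i\|\le C\,\mathbb E_\varepsilon\|\sum_{i=1}^n\varepsilon_ia_ix_i\|$ for all $n$ and all scalars $(a_i)_{i=1}^n$; "basic RUD" means being a basic sequence which is RUD. The Haar basis is $h_1=\chi_{[0,1]}$ and, for $j=2^k+l$ with $k\ge0$, $1\le l\le2^k$, $h_j=\chi_{[\frac{2l-2}{2^{k+1}},\frac{2l-1}{2^{k+1}})}-\chi_{[\frac{2l-1}{2^{k+1}},\frac{2l}{2^{k+1}})}$. A block sequence of it is a sequence of non-zero vectors $y_k=\sum_{j=p_k}^{q_k}b_jh_j$ with $p_k\le q_k<p_{k+1}$. Rearrangement invariant spaces and Boyd indices are as in Lindenstrauss–Tzafriri, Classical Banach Spaces II: with $D_sf(t)=f(t/s)$ for $t\le\min(1,s)$ and $D_sf(t)=0$ otherwise, the upper Boyd index is $q_X=\lim_{s\to0^+}\frac{\log s}{\log\|D_s\|}$ (equal to $\infty$ if $\|D_s\|=1$ for some $s<1$), and "non-trivial" means $q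_X<\infty$.
   Formalization: In the "in particular" part the weakly null sequence is also assumed not to converge to 0 in norm; without this the claim fails, since for example the zero sequence is weakly null and has no basic subsequence. *)

theory Defs
  imports "HOL-Analysis.Analysis" "HOL-Library.Discrete_Functions"
begin

section \<open>Banach space notions\<close>

text \<open>A Schauder basis of its closed linear span; in particular all \<open>x n\<close> are nonzero.\<close>

definition basic_sequence :: "(nat \<Rightarrow> 'a::banach) \<Rightarrow> bool" where
  "basic_sequence x \<longleftrightarrow>
     (\<forall>v \<in> closure (span (range x)). \<exists>!a::nat \<Rightarrow> real. (\<lambda>n. a n *\<^sub>R x n) sums v)"

definition sign_average :: "nat \<Rightarrow> (nat \<Rightarrow> 'a::real_normed_vector) \<Rightarrow> real" where
  "sign_average n y =
     (\<Sum>\<epsilon> \<in> {..<n} \<rightarrow>\<^sub>E {-1, 1::real}. norm (\<Sum>i<n. \<epsilon> i *\<^sub>R y i)) / 2 ^ n"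

definition RUD :: "(nat \<Rightarrow> 'a::banach) \<Rightarrow> bool" where
  "RUD x \<longleftrightarrow> basic_sequence x \<and>
     (\<exists>C. \<forall>n. \<forall>a::nat \<Rightarrow> real.
        norm (\<Sum>i<n. a i *\<^sub>R x i) \<le> C * sign_average n (\<lambda>i. a i *\<^sub>R x i))"

definition weakly_null :: "(nat \<Rightarrow> 'a::real_normed_vector) \<Rightarrow> bool" where
  "weakly_null x \<longleftrightarrow> (\<forall>\<phi>::'a \<Rightarrow> real. bounded_linear \<phi> \<longrightarrow> (\<lambda>n. \<phi> (x n)) \<longlonglongrightarrow> 0)"


section \<open>Koethe function spaces on the unit interval\<close>

text \<open>
  A Banach space of classes of functions modulo equality almost everywhere is given by a Banach
  space \<open>'a\<close> and a map \<open>rep\<close> that chooses a representative function of each element.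
  Only the values of \<open>rep x\<close> on the unit interval, up to null sets, matter.
\<close>

abbreviation I01 :: "real measure" where
  "I01 \<equiv> lebesgue_on {0..1}"

definition represents :: "('a \<Rightarrow> real \<Rightarrow> real) \<Rightarrow> 'a \<Rightarrow> (real \<Rightarrow> real) \<Rightarrow> bool" where
  "represents rep x f \<longleftrightarrow> (AE t in I01. rep x t = f t)"

definition in_space :: "('a \<Rightarrow> real \<Rightarrow> real) \<Rightarrow> (real \<Rightarrow> real) \<Rightarrow> bool" where
  "in_space rep f \<longleftrightarrow> (\<exists>x. represents rep x f)"

definition class_of :: "('a \<Rightarrow> real \<Rightarrow> real) \<Rightarrow> (real \<Rightarrow> real) \<Rightarrow> 'a" where
  "class_of rep f = (THE x. represents rep x f)"

locale koethe_space =
  fixes rep :: "'a::banach \<Rightarrow> real \<Rightarrow> real"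
  assumes rep_integrable: "integrable I01 (rep x)"
    and rep_add: "represents rep (x + y) (\<lambda>t. rep x t + rep y t)"
    and rep_scaleR: "represents rep (c *\<^sub>R x) (\<lambda>t. c * rep x t)"
    and rep_inject: "represents rep x (rep y) \<Longrightarrow> x = y"
    and solid: "f \<in> borel_measurable I01 \<Longrightarrow> AE t in I01. \<bar>f t\<bar> \<le> \<bar>rep x t\<bar> \<Longrightarrow>
                  \<exists>y. represents rep y f \<and> norm y \<le> norm x"
    and indicator_in_space: "A \<in> sets I01 \<Longrightarrow> in_space rep (indicat_real A)"

text \<open>
  The Koethe dual of a set of functions \<open>F\<close>, and the norm of \<open>g\<close> as an integral functional
  when \<open>B\<close> is the unit ball of \<open>F\<close>. The suprema below are over bounded sets, since integral
  functionals on a Koethe function space are continuous.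
\<close>

definition koethe_dual :: "(real \<Rightarrow> real) set \<Rightarrow> (real \<Rightarrow> real) set" where
  "koethe_dual F =
     {g \<in> borel_measurable I01. \<forall>f \<in> F. integrable I01 (\<lambda>t. f t * g t)}"

definition dual_norm :: "(real \<Rightarrow> real) set \<Rightarrow> (real \<Rightarrow> real) \<Rightarrow> real" where
  "dual_norm B g = (SUP f \<in> B. \<bar>\<integral>t. f t * g t \<partial>I01\<bar>)"

definition dual1 :: "('a::banach \<Rightarrow> real \<Rightarrow> real) \<Rightarrow> (real \<Rightarrow> real) set" where
  "dual1 rep = koethe_dual (range rep)"

definition dual1_norm :: "('a::banach \<Rightarrow> real \<Rightarrow> real) \<Rightarrow> (real \<Rightarrow> real) \<Rightarrow> real" where
  "dual1_norm rep = dual_norm (rep ` cball 0 1)"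

definition dual2 :: "('a::banach \<Rightarrow> real \<Rightarrow> real) \<Rightarrow> (real \<Rightarrow> real) set" where
  "dual2 rep = koethe_dual (dual1 rep)"

definition dual2_norm :: "('a::banach \<Rightarrow> real \<Rightarrow> real) \<Rightarrow> (real \<Rightarrow> real) \<Rightarrow> real" where
  "dual2_norm rep = dual_norm {g \<in> dual1 rep. dual1_norm rep g \<le> 1}"

definition maximal_space :: "('a::banach \<Rightarrow> real \<Rightarrow> real) \<Rightarrow> bool" where
  "maximal_space rep \<longleftrightarrow> (\<forall>f \<in> dual2 rep. in_space rep f)"

text \<open>Simple functions form a linear space, so their closed linear span is their closure.\<close>

definition minimal_space :: "('a::banach \<Rightarrow> real \<Rightarrow> real) \<Rightarrow> bool" where
  "minimal_space rep \<longleftrightarrow>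
     (\<forall>f \<in> dual2 rep. in_space rep f \<longleftrightarrow>
        (\<forall>e>0. \<exists>s::real \<Rightarrow> real. simple_function I01 s \<and> dual2_norm rep (\<lambda>t. f t - s t) < e))"


section \<open>Rearrangement invariant spaces and the upper Boyd index\<close>

definition automorphism_pair :: "(real \<Rightarrow> real) \<Rightarrow> (real \<Rightarrow> real) \<Rightarrow> bool" where
  "automorphism_pair \<tau> \<sigma> \<longleftrightarrow>
     \<tau> \<in> measurable I01 I01 \<and> \<sigma> \<in> measurable I01 I01 \<and>
     (\<forall>t \<in> {0..1}. \<sigma> (\<tau> t) = t \<and> \<tau> (\<sigma> t) = t) \<and> distr I01 I01 \<tau> = I01"

text \<open>The assumption \<open>norming\<close> says that the Koethe dual is a norming subspace of the dual.\<close>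

locale ri_space = koethe_space rep for rep :: "'a::banach \<Rightarrow> real \<Rightarrow> real" +
  assumes rearrangement_in_space:
      "automorphism_pair \<tau> \<sigma> \<Longrightarrow> f \<in> borel_measurable I01 \<Longrightarrow>
         in_space rep f \<longleftrightarrow> in_space rep (\<lambda>t. f (\<sigma> t))"
    and rearrangement_norm:
      "automorphism_pair \<tau> \<sigma> \<Longrightarrow> represents rep x f \<Longrightarrow>
         represents rep y (\<lambda>t. f (\<sigma> t)) \<Longrightarrow> norm y = norm x"
    and norming: "norm x = dual2_norm rep (rep x)"
    and maximal_or_minimal: "maximal_space rep \<or> minimal_space rep"
    and Linfinity_norm_le: "f \<in> borel_measurable I01 \<Longrightarrow> AE t in I01. \<bar>f t\<bar> \<le> M \<Longrightarrow>
      \<exists>x. represents rep x f \<and> norm x \<le> M"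
    and L1_norm_le: "(\<integral>t. \<bar>rep x t\<bar> \<partial>I01) \<le> norm x"

definition dilate :: "real \<Rightarrow> (real \<Rightarrow> real) \<Rightarrow> real \<Rightarrow> real" where
  "dilate s f t = (if t \<le> min 1 s then f (t / s) else 0)"

definition dilation :: "('a::banach \<Rightarrow> real \<Rightarrow> real) \<Rightarrow> real \<Rightarrow> 'a \<Rightarrow> 'a" where
  "dilation rep s x = class_of rep (dilate s (rep x))"

definition upper_boyd_index :: "('a::banach \<Rightarrow> real \<Rightarrow> real) \<Rightarrow> ereal" where
  "upper_boyd_index rep =
     (if \<exists>s \<in> {0<..<1}. onorm (dilation rep s) = 1 then \<infinity>
      else Lim (at_right 0) (\<lambda>s. ereal (ln s / ln (onorm (dilation rep s)))))"


section \<open>The Haar basis\<close>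

text \<open>The index \<open>0\<close> is not used. For \<open>j \<ge> 2\<close>, \<open>floor_log (j - 1)\<close> is the \<open>k\<close> with
  \<open>j = 2 ^ k + l\<close>, \<open>1 \<le> l \<le> 2 ^ k\<close>; see the lemma \<open>haar_dyadic\<close>.\<close>

definition haar :: "nat \<Rightarrow> real \<Rightarrow> real" where
  "haar j t =
     (if j \<le> 1 then indicat_real {0..1} t
      else let k = floor_log (j - 1); l = real (j - 2 ^ k) in
        indicat_real {(2 * l - 2) / 2 ^ (k + 1)..<(2 * l - 1) / 2 ^ (k + 1)} t
        - indicat_real {(2 * l - 1) / 2 ^ (k + 1)..<2 * l / 2 ^ (k + 1)} t)"

lemma haar_one: "haar 1 = indicat_real {0..1}"
  by (simp add: haar_def fun_eq_iff)

lemma haar_dyadic: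
  assumes "1 \<le> l" "l \<le> 2 ^ k"
  shows "haar (2 ^ k + l) t =
    indicat_real {(2 * real l - 2) / 2 ^ (k + 1)..<(2 * real l - 1) / 2 ^ (k + 1)} t
    - indicat_real {(2 * real l - 1) / 2 ^ (k + 1)..<2 * real l / 2 ^ (k + 1)} t"
proof -
  have "floor_log (2 ^ k + l - 1) = k"
    using assms by (intro floor_log_eqI) auto
  moreover have "\<not> 2 ^ k + l \<le> 1"
    using assms one_le_power[of "2::nat" k] by simp
  ultimately show ?thesis
    by (simp add: haar_def Let_def)
qed

definition haar_block_sequence :: "('a::banach \<Rightarrow> real \<Rightarrow> real) \<Rightarrow> (nat \<Rightarrow> 'a) \<Rightarrow> bool" where
  "haar_block_sequence rep y \<longleftrightarrow>
     (\<exists>(p::nat \<Rightarrow> nat) (q::nat \<Rightarrow> nat) (b::nat \<Rightarrow> real). 1 \<le> p 0 \<and>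
        (\<forall>k. p k \<le> q k \<and> q k < p (Suc k) \<and> y k \<noteq> 0 \<and>
             represents rep (y k) (\<lambda>t. \<Sum>j = p k..q k. b j * haar j t)))"

end

theory Submission
  imports Defs "HOL-Combinatorics.List_Permutation"
begin

text \<open>
  Let \<open>X\<close> be the space and let \<open>d k = a k *\<^sub>R y k\<close> be the terms of a finite combination of Haar
  blocks. On a sufficiently fine dyadic level all of them are step functions, that is, vectors indexed by
  the \<open>2 ^ N\<close> dyadic cells, and the norm of \<open>X\<close> restricted to such vectors is monotone and invariant
  under permutations of the cells. Write \<open>u\<close> for the maximal function of the partial sums of the
  \<open>d k\<close> and \<open>S\<close> for their square function. The RUD inequality is the chain
  \<open>norm (\<Sum>k. d k) \<le> norm u \<le> C * norm S \<le> 2 * C * sign_average d\<close>. The last step is Khintchine's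
  inequality, applied at each point (\<open>khintchine\<close>). The middle step has three ingredients.

  \<^item> Exchanging the two halves of the support of a Haar function changes the sign of that function and
    preserves the earlier ones (\<open>haar_cell_flip\<close>). So the blocks are martingale differences, and the
    inequality of Davis bounds the mean of \<open>u\<close> by a multiple of the mean of \<open>S\<close>. Applied to the
    martingale restarted when its partial sums first exceed \<open>\<theta>\<close>, it bounds the mean of \<open>max 0 (u - \<theta>)\<close>
    by a multiple of the integral of \<open>S\<close> over \<open>{u > \<theta>}\<close> (\<open>davis_inequality_above_level\<close>).

  \<^item> For a fraction \<open>t\<close> of the cells take for \<open>\<theta>\<close> the value of the decreasing rearrangement \<open>u\<^sup>*\<close>
    at \<open>2 * t\<close>. Then at most \<open>2 * t\<close> of the cells lie in \<open>{u > \<theta>}\<close>, and the level estimate says that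
    the integral of \<open>u\<^sup>*\<close> over \<open>[0, t]\<close> is at most that of \<open>s \<mapsto> u\<^sup>* (2 * s) + 36 * S\<^sup>* s\<close>
    (\<open>garsia_submajorization\<close>). Rearrangement invariant norms with a norming Koethe dual respect
    such inequalities. The first summand is the dilation of \<open>u\<^sup>*\<close> by \<open>1/2\<close>, so
    \<open>norm u \<le> r * norm u + 36 * norm S\<close>, where \<open>r\<close> is the norm of that dilation
    (\<open>norm_le_of_garsia\<close>).

  \<^item> The dilation by \<open>1/2\<close> is a contraction, and its norm is not \<open>1\<close> since the upper Boyd index is
    finite. So \<open>r < 1\<close> and the term \<open>r * norm u\<close> can be absorbed (\<open>dilation_contraction\<close>).

  To work with step functions one needs that they are dense. Separability forces the norm to be order
  continuous: otherwise some element has infinitely many disjoint restrictions with norms bounded below,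
  and their unions form an uncountable separated family (\<open>restr_vanishing\<close>). Hence the Haar functions
  span a dense subspace, and the sign change above shows that the partial sum projections have norm at
  most \<open>1\<close>, so they form a Schauder basis. By the selection principle of Bessaga and Pelczynski a weakly
  null sequence that does not tend to \<open>0\<close> in norm has a subsequence that is a small perturbation of a
  block sequence, and the RUD property survives small perturbations (\<open>weakly_null_RUD_subsequence\<close>).
\<close>

section \<open>Davis's inequality for finite martingales\<close>

definition max_partial_sum :: "nat \<Rightarrow> (nat \<Rightarrow> real) \<Rightarrow> real" where
  "max_partial_sum n d = Max ((\<lambda>k. \<bar>\<Sum>i<k. d i\<bar>) ` {..n})"

lemma max_partial_sum_0 [simp]: "max_partial_sum 0 d = 0"
  by (simp add: max_partial_sum_def)

lemma max_partial_sum_Suc [simp]: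
  "max_partial_sum (Suc n) d = max (max_partial_sum n d) \<bar>\<Sum>i<Suc n. d i\<bar>"
  by (simp add: max_partial_sum_def atMost_Suc max.commute)

lemma max_partial_sum_ge: "\<bar>\<Sum>i<n. d i\<bar> \<le> max_partial_sum n d"
  by (simp add: max_partial_sum_def)

lemma max_partial_sum_nonneg: "0 \<le> max_partial_sum n d"
  by (induction n) auto

lemma max_partial_sum_cong:
  "(\<And>i. i < n \<Longrightarrow> d i = d' i) \<Longrightarrow> max_partial_sum n d = max_partial_sum n d'"
  by (induction n) auto

definition square_function :: "nat \<Rightarrow> (nat \<Rightarrow> real) \<Rightarrow> real" where
  "square_function n d = sqrt (\<Sum>i<n. (d i)\<^sup>2)"

lemma square_function_nonneg: "0 \<le> square_function n d"
  by (simp add: square_function_def sum_nonneg)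

lemma square_function_mono: "m \<le> n \<Longrightarrow> square_function m d \<le> square_function n d"
  by (auto simp: square_function_def intro!: sum_mono2)

lemma square_function_Suc: "(square_function (Suc n) d)\<^sup>2 = (square_function n d)\<^sup>2 + (d n)\<^sup>2"
  by (simp add: square_function_def sum_nonneg)

lemma abs_le_square_function: 
  assumes "i < n" shows "\<bar>d i\<bar> \<le> square_function n d"
proof -
  have "(d i)\<^sup>2 \<le> (\<Sum>i<n. (d i)\<^sup>2)"
    using assms by (intro member_le_sum) auto
  then show ?thesis
    unfolding square_function_def by (metis real_sqrt_abs real_sqrt_le_iff)
qed

text \<open>
  The inequality of Davis is proved path by path, following Beiglboeck and Siorpaes. For a path with
  current value \<open>x\<close>, maximal function \<open>m\<close>, square function \<open>s\<close> and \<open>a = sqrt (m\<^sup>2 + s\<^sup>2)\<close> consider the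
  potential \<open>(x\<^sup>2 + s\<^sup>2) / a + a - 17 * s\<close>. A step \<open>\<delta>\<close> increases it by at most \<open>2 * (x / a) * \<delta>\<close>, and
  this bound has mean zero when \<open>\<delta>\<close> is a martingale difference. For small \<open>\<delta>\<close> with \<open>\<bar>x\<bar> = m\<close> the first-order
  terms cancel: this dictates the shape \<open>(x\<^sup>2 + s\<^sup>2) / a + a\<close>. The error terms of order
  \<open>\<delta>\<^sup>2 / a\<close>, and steps larger than \<open>a\<close>, are paid for by the growth of \<open>s\<close>.
\<close>
lemma davis_step:
  fixes x \<delta> m m' s s' a a' :: real
  assumes x: "\<bar>x\<bar> \<le> m" and s: "0 \<le> s" and s': "0 \<le> s'" "s'\<^sup>2 = s\<^sup>2 + \<delta>\<^sup>2"
    and a: "0 \<le> a" "a\<^sup>2 = m\<^sup>2 + s\<^sup>2" and m': "m' = max m \<bar>x + \<delta>\<bar>"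
    and a': "0 \<le> a'" "a'\<^sup>2 = m'\<^sup>2 + s'\<^sup>2"
  shows "((x + \<delta>)\<^sup>2 + s'\<^sup>2) / a' + a' - 17 * s' \<le> (x\<^sup>2 + s\<^sup>2) / a + a - 17 * s + 2 * (x / a) * \<delta>"
proof -
  have m0: "0 \<le> m" using x by linarith
  have ss': "s \<le> s'" by (rule power2_le_imp_le) (use s s' in auto)
  have sa: "s \<le> a" by (rule power2_le_imp_le) (use a in auto)
  have ma: "m \<le> a" by (rule power2_le_imp_le) (use a in auto)
  have mm': "m \<le> m'" and xm': "\<bar>x + \<delta>\<bar> \<le> m'" using m' by auto
  have ra': "(x + \<delta>)\<^sup>2 + s'\<^sup>2 \<le> a'\<^sup>2"
    using a' xm' abs_le_square_iff[of "x+\<delta>" m'] by auto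
  have aa': "a \<le> a'"
  proof (rule power2_le_imp_le)
    show "a\<^sup>2 \<le> a'\<^sup>2" using a a' mm' m0 s'(2) power_mono[OF mm' m0, of 2] zero_le_power2[of \<delta>]
      by linarith
  qed (fact a')
  have gap: "(s' - s) * (s' + s) = \<delta>\<^sup>2" using s' by (simp add: power2_eq_square algebra_simps)
  show ?thesis
  proof (cases "\<bar>\<delta>\<bar> \<le> a \<and> a > 0")
    case True
    then have apos: "a > 0" and a'pos: "a' > 0" and da: "\<bar>\<delta>\<bar> \<le> a" using aa' by auto
    have "s' \<le> s + \<bar>\<delta>\<bar>"
    proof (rule power2_le_imp_le)
      show "s'\<^sup>2 \<le> (s + \<bar>\<delta>\<bar>)\<^sup>2" using s s' by (simp add: power2_sum)
    qed (use s in auto)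
    then have "s' + s \<le> 3 * a" using sa da by linarith
    then have "\<delta>\<^sup>2 \<le> (s' - s) * (3 * a)"
      using gap ss' by (metis diff_ge_0_iff_ge mult_left_mono)
    then have q: "\<delta>\<^sup>2 / a \<le> 3 * (s' - s)" using apos by (simp add: field_simps)
    have eq: "((x + \<delta>)\<^sup>2 + s'\<^sup>2) / a' + a' - ((x\<^sup>2 + s\<^sup>2) / a + a + 2 * (x / a) * \<delta>)
       = 2 * (\<delta>\<^sup>2 / a) + (a' - a) * (1 - ((x + \<delta>)\<^sup>2 + s'\<^sup>2) / (a * a'))"
      using apos a'pos s'(2) by (simp add: field_simps power2_eq_square)
    have "(a' - a) * (1 - ((x + \<delta>)\<^sup>2 + s'\<^sup>2) / (a * a')) \<le> \<delta>\<^sup>2 / a"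
    proof (cases "\<bar>x + \<delta>\<bar> \<le> m")
      case True
      then have "(a' - a) * (a' + a) = \<delta>\<^sup>2" using a a' m' s'
        by (simp add: power2_eq_square algebra_simps)
      then have "(a' - a) * a \<le> \<delta>\<^sup>2" using aa' a'(1)
        by (metis diff_ge_0_iff_ge le_add_same_cancel2 mult_left_mono)
      then have "a' - a \<le> \<delta>\<^sup>2 / a" using apos by (simp add: field_simps)
      moreover have "(a' - a) * (1 - ((x + \<delta>)\<^sup>2 + s'\<^sup>2) / (a * a')) \<le> (a' - a) * 1"
        using aa' apos a'pos by (intro mult_left_mono) auto
      ultimately show ?thesis unfolding mult_1_right by (rule order_trans[rotated])
    next
      case False
      then have "(x + \<delta>)\<^sup>2 + s'\<^sup>2 = a' * a'" using a' m' by (simp add: power2_eq_square)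
      then have "1 - ((x + \<delta>)\<^sup>2 + s'\<^sup>2) / (a * a') = 1 - a' / a" using a'pos by simp
      also have "\<dots> \<le> 0" using aa' apos by simp
      finally have "(a' - a) * (1 - ((x + \<delta>)\<^sup>2 + s'\<^sup>2) / (a * a')) \<le> 0"
        using aa' by (simp add: mult_nonneg_nonpos)
      also have "\<dots> \<le> \<delta>\<^sup>2 / a" using apos by simp
      finally show ?thesis .
    qed
    with eq q ss' show ?thesis by argo
  next
    case False
    then have da: "a \<le> \<bar>\<delta>\<bar>" using a by auto
    have sd: "s \<le> \<bar>\<delta>\<bar>" and md: "m \<le> \<bar>\<delta>\<bar>" using sa ma da by auto
    have "s' \<le> 3/2 * \<bar>\<delta>\<bar>"
    proof (rule power2_le_imp_le)
      have "s\<^sup>2 \<le> \<delta>\<^sup>2" using sd s power_mono[of s "\<bar>\<delta>\<bar>" 2] by simp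
      then show "s'\<^sup>2 \<le> (3/2 * \<bar>\<delta>\<bar>)\<^sup>2" using s'(2) zero_le_power2[of \<delta>]
        unfolding power_mult_distrib power2_abs power_divide power2_eq_square by linarith
    qed auto
    then have "\<delta>\<^sup>2 \<le> (s' - s) * (5/2 * \<bar>\<delta>\<bar>)"
      using sd ss' mult_left_mono[of "s' + s" "5/2 * \<bar>\<delta>\<bar>" "s' - s"] gap by linarith
    then have q: "2/5 * \<bar>\<delta>\<bar> \<le> s' - s"
    proof (cases "\<delta> = 0")
      case False
      then have "\<bar>\<delta>\<bar> * \<bar>\<delta>\<bar> \<le> (5/2 * (s' - s)) * \<bar>\<delta>\<bar>"
        using \<open>\<delta>\<^sup>2 \<le> (s' - s) * (5/2 * \<bar>\<delta>\<bar>)\<close> by (simp add: power2_eq_square mult_ac)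
      then have "\<bar>\<delta>\<bar> \<le> 5/2 * (s' - s)"
        by (rule mult_right_le_imp_le) (use False in simp)
      then show ?thesis by (simp add: field_simps)
    qed (use ss' in auto)
    have "a' \<le> 9/4 * \<bar>\<delta>\<bar>"
    proof (rule power2_le_imp_le)
      have "m' \<le> m + \<bar>\<delta>\<bar>" using m' x by linarith
      then have "m'\<^sup>2 \<le> (m + \<bar>\<delta>\<bar>)\<^sup>2" using mm' m0 by (intro power_mono) auto
      also have "\<dots> = m\<^sup>2 + 2 * (m * \<bar>\<delta>\<bar>) + \<delta>\<^sup>2" by (simp add: power2_sum)
      also have "m * \<bar>\<delta>\<bar> \<le> \<bar>\<delta>\<bar> * \<bar>\<delta>\<bar>" using md by (intro mult_right_mono) auto
      finally have "m'\<^sup>2 \<le> m\<^sup>2 + 3 * \<delta>\<^sup>2" by (simp add: power2_eq_square)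
      moreover have "a\<^sup>2 \<le> \<delta>\<^sup>2" using da a power_mono[of a "\<bar>\<delta>\<bar>" 2] by simp
      ultimately have "a'\<^sup>2 \<le> 5 * \<delta>\<^sup>2" using a(2) a'(2) s'(2) by linarith
      moreover have "(9/4 * \<bar>\<delta>\<bar>)\<^sup>2 = 81/16 * \<delta>\<^sup>2" by (simp add: power_mult_distrib power_divide)
      ultimately show "a'\<^sup>2 \<le> (9/4 * \<bar>\<delta>\<bar>)\<^sup>2" using zero_le_power2[of \<delta>] by linarith
    qed auto
    moreover have "((x + \<delta>)\<^sup>2 + s'\<^sup>2) / a' \<le> a'"
    proof (cases "a' = 0")
      case False then have "a' > 0" using a'(1) by simp
      then show ?thesis using ra' by (simp add: divide_le_eq power2_eq_square)
    qed simp
    moreover have "\<bar>x / a\<bar> \<le> 1" using x ma by (cases "a = 0") (auto simp: divide_le_eq)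
    then have "\<bar>2 * (x / a) * \<delta>\<bar> \<le> 2 * \<bar>\<delta>\<bar>" 
      using mult_right_mono[of "\<bar>x / a\<bar>" 1 "\<bar>\<delta>\<bar>"] by (simp add: abs_mult)
    moreover have "0 \<le> (x\<^sup>2 + s\<^sup>2) / a + a" using a by simp
    ultimately show ?thesis using q by linarith
  qed
qed

text \<open>The coefficient \<open>x / a\<close> of the step in \<open>davis_step\<close>; it depends on the past of the path only.\<close>
definition davis_weight :: "nat \<Rightarrow> (nat \<Rightarrow> real) \<Rightarrow> real" where
  "davis_weight n d =
     (\<Sum>i<n. d i) / sqrt ((max_partial_sum n d)\<^sup>2 + (square_function n d)\<^sup>2)"

text \<open>
  The potential of \<open>davis_step\<close> starts at \<open>0\<close> and is bounded below by
  \<open>max_partial_sum n d - 17 * square_function n d\<close>.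
\<close>
lemma davis_pathwise:
  "max_partial_sum n d \<le> 17 * square_function n d + 2 * (\<Sum>k<n. davis_weight k d * d k)"
proof -
  define a where "a n = sqrt ((max_partial_sum n d)\<^sup>2 + (square_function n d)\<^sup>2)" for n
  define \<Psi> where "\<Psi> n = ((\<Sum>i<n. d i)\<^sup>2 + (square_function n d)\<^sup>2) / a n + a n 
      - 17 * square_function n d" for n
  have a0: "0 \<le> a n" and a2: "(a n)\<^sup>2 = (max_partial_sum n d)\<^sup>2 + (square_function n d)\<^sup>2" for n
    by (auto simp: a_def)
  have "\<Psi> n \<le> 2 * (\<Sum>k<n. davis_weight k d * d k)"
  proof (induction n)
    case 0
    then show ?case by (simp add: \<Psi>_def a_def square_function_def)
  next
    case (Suc n)
    have "\<Psi> (Suc n) \<le> \<Psi> n + 2 * ((\<Sum>i<n. d i) / a n) * d n"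
      unfolding \<Psi>_def sum.lessThan_Suc
      using a2 by (intro davis_step[OF max_partial_sum_ge square_function_nonneg square_function_nonneg
            square_function_Suc a0 a2 _ a0]) auto
    then show ?case using Suc by (simp add: davis_weight_def a_def distrib_left)
  qed
  moreover have "max_partial_sum n d \<le> a n"
    unfolding a_def by (intro real_le_rsqrt) simp
  moreover have "0 \<le> ((\<Sum>i<n. d i)\<^sup>2 + (square_function n d)\<^sup>2) / a n" using a0 by simp
  ultimately show ?thesis unfolding \<Psi>_def by linarith
qed

text \<open>
  The index set carries the uniform distribution and the filtration is the one generated by the
  differences themselves. No condition is imposed on the initial term \<open>d 0\<close>, which need not have mean
  zero.
\<close>
definition martingale_differences :: "'i set \<Rightarrow> nat \<Rightarrow> (nat \<Rightarrow> 'i \<Rightarrow> real) \<Rightarrow> bool" where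
  "martingale_differences I n d \<longleftrightarrow>
     (\<forall>k \<phi>. 0 < k \<and> k < n \<and> (\<forall>i\<in>I. \<forall>i'\<in>I. (\<forall>l<k. d l i = d l i') \<longrightarrow> \<phi> i = \<phi> i') \<longrightarrow>
        (\<Sum>i\<in>I. \<phi> i * d k i) = 0)"

lemma martingale_differencesD:
  assumes "martingale_differences I n d" "0 < k" "k < n"
    and "\<And>i i'. i \<in> I \<Longrightarrow> i' \<in> I \<Longrightarrow> (\<forall>l<k. d l i = d l i') \<Longrightarrow> \<phi> i = \<phi> i'"
  shows "(\<Sum>i\<in>I. \<phi> i * d k i) = 0"
proof -
  have "\<forall>i\<in>I. \<forall>i'\<in>I. (\<forall>l<k. d l i = d l i') \<longrightarrow> \<phi> i = \<phi> i'" by (intro ballI impI assms(4))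
  then show ?thesis
    by (intro assms(1)[unfolded martingale_differences_def, THEN spec, THEN spec, THEN mp] conjI assms(2,3))
qed

text \<open>The weighted sum in \<open>davis_pathwise\<close> has mean zero. Its initial term vanishes because \<open>davis_weight 0 d = 0\<close>.\<close>
lemma davis_inequality:
  assumes "martingale_differences I n d"
  shows "(\<Sum>i\<in>I. max_partial_sum n (\<lambda>k. d k i)) \<le> 17 * (\<Sum>i\<in>I. square_function n (\<lambda>k. d k i))"
proof -
  have "(\<Sum>i\<in>I. davis_weight k (\<lambda>k. d k i) * d k i) = 0" if "k < n" for k
  proof (cases "k = 0")
    case True
    then show ?thesis by (simp add: davis_weight_def)
  next
    case False
    have "davis_weight k (\<lambda>k. d k i) = davis_weight k (\<lambda>k. d k i')" if "\<forall>l<k. d l i = d l i'" for i i'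
      using that max_partial_sum_cong[of k "\<lambda>k. d k i" "\<lambda>k. d k i'"]
      by (auto simp: davis_weight_def square_function_def)
    then show ?thesis
      by (intro martingale_differencesD[OF assms _ that]) (use False in auto)
  qed
  then have "(\<Sum>i\<in>I. \<Sum>k<n. davis_weight k (\<lambda>k. d k i) * d k i) = 0"
    by (subst sum.swap) simp
  moreover have "(\<Sum>i\<in>I. max_partial_sum n (\<lambda>k. d k i)) \<le> 
     (\<Sum>i\<in>I. 17 * square_function n (\<lambda>k. d k i) + 2 * (\<Sum>k<n. davis_weight k (\<lambda>k. d k i) * d k i))"
    by (intro sum_mono davis_pathwise)
  ultimately show ?thesis
    by (simp add: sum.distrib flip: sum_distrib_left)
qed

text \<open>
  The sequence \<open>d'\<close> is \<open>d\<close> after the first time that a partial sum exceeds \<open>\<theta>\<close>. At that time the partial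
  sum is at most \<open>\<theta>\<close> plus one jump, and a jump is bounded by the square function.
\<close>
lemma max_partial_sum_restart:
  fixes d :: "nat \<Rightarrow> real" and \<theta> :: real
  assumes "0 \<le> \<theta>"
  defines "d' \<equiv> \<lambda>k. if max_partial_sum k d > \<theta> then d k else 0"
  shows "max_partial_sum n d > \<theta> \<Longrightarrow> 
    max_partial_sum n d \<le> \<theta> + square_function n d + max_partial_sum n d'"
proof -
  have "(max_partial_sum n d \<le> \<theta> \<longrightarrow> (\<Sum>i<n. d' i) = 0) \<and> 
    (max_partial_sum n d > \<theta> \<longrightarrow> 
       \<bar>(\<Sum>i<n. d i) - (\<Sum>i<n. d' i)\<bar> \<le> \<theta> + square_function n d \<and>
       max_partial_sum n d \<le> \<theta> + square_function n d + max_partial_sum n d')"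
  proof (induction n)
    case 0
    then show ?case using assms by (auto simp: square_function_def)
  next
    case (Suc n)
    have S: "square_function n d \<le> square_function (Suc n) d" 
      "\<bar>d n\<bar> \<le> square_function (Suc n) d" 
      by (auto intro: square_function_mono abs_le_square_function)
    have f: "\<bar>\<Sum>i<n. d i\<bar> \<le> max_partial_sum n d" "0 \<le> max_partial_sum n d'"
      by (rule max_partial_sum_ge max_partial_sum_nonneg)+
    show ?case
    proof (cases "max_partial_sum n d > \<theta>")
      case True
      then have "d' n = d n" by (simp add: d'_def)
      with Suc True S f show ?thesis by (auto simp: max_def)
    next
      case False
      then have "d' n = 0" by (simp add: d'_def)
      with Suc False S f show ?thesis by (auto simp: max_def)
    qed
  qed
  then show "max_partial_sum n d > \<theta> \<Longrightarrow> 
    max_partial_sum n d \<le> \<theta> + square_function n d + max_partial_sum n d'" by simp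
qed

text \<open>
  The differences restarted above level \<open>\<theta>\<close> are again martingale differences, and their square function
  vanishes off \<open>{u > \<theta>}\<close>. So \<open>max_partial_sum_restart\<close> and Davis's inequality give \<open>18 = 1 + 17\<close>.
\<close>
lemma davis_inequality_above_level:
  assumes I: "finite I" and d: "martingale_differences I n d" and "0 \<le> \<theta>"
  defines "u \<equiv> \<lambda>i. max_partial_sum n (\<lambda>k. d k i)"
  shows "(\<Sum>i\<in>I. max 0 (u i - \<theta>)) \<le> 18 * (\<Sum>i\<in>{i\<in>I. u i > \<theta>}. square_function n (\<lambda>k. d k i))"
proof -
  define d' where "d' k i = (if max_partial_sum k (\<lambda>k. d k i) > \<theta> then d k i else 0)" for k i
  define S where "S i = square_function n (\<lambda>k. d k i)" for i
  have "martingale_differences I n d'"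
    unfolding martingale_differences_def
  proof (intro allI impI, elim conjE)
    fix k and \<phi> :: "'a \<Rightarrow> real" 
    assume k: "0 < k" "k < n" and \<phi>: "\<forall>i\<in>I. \<forall>i'\<in>I. (\<forall>l<k. d' l i = d' l i') \<longrightarrow> \<phi> i = \<phi> i'"
    define \<psi> where "\<psi> i = (if max_partial_sum k (\<lambda>k. d k i) > \<theta> then \<phi> i else 0)" for i
    have \<psi>: "\<psi> i = \<psi> i'" if "i \<in> I" "i' \<in> I" and eq: "\<forall>l<k. d l i = d l i'" for i i'
    proof -
      have *: "max_partial_sum l (\<lambda>k. d k i) = max_partial_sum l (\<lambda>k. d k i')" if "l \<le> k" for l
        using that eq by (intro max_partial_sum_cong) auto
      then have "d' l i = d' l i'" if "l < k" for l using that eq by (simp add: d'_def)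
      then have "\<phi> i = \<phi> i'" using \<phi> \<open>i \<in> I\<close> \<open>i' \<in> I\<close> by blast
      then show ?thesis using *[of k] by (simp add: \<psi>_def)
    qed
    have "(\<Sum>i\<in>I. \<psi> i * d k i) = 0"
      by (rule martingale_differencesD[OF d k \<psi>])
    moreover have "\<psi> i * d k i = \<phi> i * d' k i" for i by (simp add: \<psi>_def d'_def)
    ultimately show "(\<Sum>i\<in>I. \<phi> i * d' k i) = 0" by simp
  qed
  from davis_inequality[OF this]
  have D: "(\<Sum>i\<in>I. max_partial_sum n (\<lambda>k. d' k i)) \<le> 17 * (\<Sum>i\<in>I. square_function n (\<lambda>k. d' k i))" .
  have S': "square_function n (\<lambda>k. d' k i) \<le> (if u i > \<theta> then S i else 0)" for i
  proof (cases "u i > \<theta>")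
    case True
    then show ?thesis
      by (auto simp: S_def square_function_def d'_def intro!: sum_mono)
  next
    case False
    have "max_partial_sum k (\<lambda>k. d k i) \<le> u i" if "k \<le> n" for k
      unfolding u_def max_partial_sum_def using that by (intro Max_mono) auto
    then have "d' k i = 0" if "k < n" for k
      using that False unfolding d'_def by (smt (verit) less_imp_le)
    then show ?thesis using False by (simp add: square_function_def)
  qed
  have "max 0 (u i - \<theta>) \<le> (if u i > \<theta> then S i else 0) + max_partial_sum n (\<lambda>k. d' k i)" for i
    using max_partial_sum_restart[OF \<open>0 \<le> \<theta>\<close>, where n=n and d="\<lambda>k. d k i"] 
      max_partial_sum_nonneg[of n "\<lambda>k. d' k i"]
    by (auto simp: u_def S_def d'_def)
  then have "(\<Sum>i\<in>I. max 0 (u i - \<theta>)) \<le> 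
     (\<Sum>i\<in>I. (if u i > \<theta> then S i else 0) + max_partial_sum n (\<lambda>k. d' k i))"
    by (rule sum_mono)
  also have "\<dots> \<le> (\<Sum>i\<in>I. (if u i > \<theta> then S i else 0)) + 17 * (\<Sum>i\<in>I. if u i > \<theta> then S i else 0)"
    proof -
    have "(\<Sum>i\<in>I. square_function n (\<lambda>k. d' k i)) \<le> (\<Sum>i\<in>I. if u i > \<theta> then S i else 0)"
      by (rule sum_mono) (rule S')
    with D have "(\<Sum>i\<in>I. max_partial_sum n (\<lambda>k. d' k i)) \<le> 17 * (\<Sum>i\<in>I. if u i > \<theta> then S i else 0)"
      by linarith
    then show ?thesis by (simp only: sum.distrib add_left_mono)
  qed
  also have "\<dots> = 18 * (\<Sum>i\<in>{i\<in>I. u i > \<theta>}. S i)"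
    unfolding sum.inter_filter[OF I] by simp
  finally show ?thesis unfolding S_def .
qed

section \<open>Khintchine's inequality\<close>

lemma sum_sign_patterns_Suc:
  fixes F :: "real \<Rightarrow> real" and a :: "nat \<Rightarrow> real"
  shows "(\<Sum>\<epsilon> \<in> {..<Suc n} \<rightarrow>\<^sub>E {-1, 1::real}. F (\<Sum>i<Suc n. \<epsilon> i * a i)) =
     (\<Sum>\<epsilon> \<in> {..<n} \<rightarrow>\<^sub>E {-1, 1::real}. F ((\<Sum>i<n. \<epsilon> i * a i) - a n) + F ((\<Sum>i<n. \<epsilon> i * a i) + a n))"
proof -
  let ?E = "{..<n} \<rightarrow>\<^sub>E {-1, 1::real}"
  have inj: "inj_on (\<lambda>(y, \<epsilon>). \<epsilon>(n := y)) ({-1, 1} \<times> ?E)"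
    using inj_combinator[of n "{..<n}" "\<lambda>_. {-1, 1::real}"] by simp
  have E: "{..<Suc n} \<rightarrow>\<^sub>E {-1, 1::real} = (\<lambda>(y, \<epsilon>). \<epsilon>(n := y)) ` ({-1, 1} \<times> ?E)"
    unfolding lessThan_Suc PiE_insert_eq ..
  have "(\<Sum>\<epsilon> \<in> {..<Suc n} \<rightarrow>\<^sub>E {-1, 1::real}. F (\<Sum>i<Suc n. \<epsilon> i * a i)) = 
     (\<Sum>(y, \<epsilon>) \<in> {-1, 1} \<times> ?E. F ((\<Sum>i<n. \<epsilon> i * a i) + y * a n))"
    unfolding E sum.reindex[OF inj]
  proof (rule sum.cong)
    fix p assume "p \<in> {-1, 1::real} \<times> ?E"
    obtain y \<epsilon> where p: "p = (y, \<epsilon>)" by (cases p)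
    have "(\<Sum>i<n. (\<epsilon>(n := y)) i * a i) = (\<Sum>i<n. \<epsilon> i * a i)" by (intro sum.cong) auto
    then show "((\<lambda>\<epsilon>. F (\<Sum>i<Suc n. \<epsilon> i * a i)) \<circ> (\<lambda>(y, \<epsilon>). \<epsilon>(n := y))) p =
      (case p of (y, \<epsilon>) \<Rightarrow> F ((\<Sum>i<n. \<epsilon> i * a i) + y * a n))"
      by (simp add: p)
  qed simp
  also have "\<dots> = (\<Sum>y\<in>{-1, 1}. \<Sum>\<epsilon>\<in>?E. F ((\<Sum>i<n. \<epsilon> i * a i) + y * a n))"
    by (rule sum.cartesian_product[symmetric])
  also have "\<dots> = (\<Sum>\<epsilon> \<in> ?E. F ((\<Sum>i<n. \<epsilon> i * a i) - a n) + F ((\<Sum>i<n. \<epsilon> i * a i) + a n))"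
    by (simp add: sum.distrib)
  finally show ?thesis .
qed

lemma card_sign_patterns: "card ({..<n} \<rightarrow>\<^sub>E {-1, 1::real}) = 2 ^ n" for n :: nat
  by (simp add: card_PiE numeral_2_eq_2)

lemma sign_second_moment:
  "(\<Sum>\<epsilon> \<in> {..<n} \<rightarrow>\<^sub>E {-1, 1::real}. (\<Sum>i<n. \<epsilon> i * a i)\<^sup>2) = 2 ^ n * (\<Sum>i<n. (a i)\<^sup>2)"
proof (induction n)
  case (Suc n)
  have 2: "(x - a n)\<^sup>2 + (x + a n)\<^sup>2 = 2 * x\<^sup>2 + 2 * (a n)\<^sup>2" for x
    by (simp add: power2_sum power2_diff)
  then show ?case
    unfolding sum_sign_patterns_Suc[of "\<lambda>x. x\<^sup>2"] 2 using Suc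
    by (simp add: sum.distrib card_sign_patterns algebra_simps flip: sum_distrib_left)
qed simp

lemma sign_fourth_moment:
  "(\<Sum>\<epsilon> \<in> {..<n} \<rightarrow>\<^sub>E {-1, 1::real}. (\<Sum>i<n. \<epsilon> i * a i)^4) \<le> 3 * 2 ^ n * (\<Sum>i<n. (a i)\<^sup>2)\<^sup>2"
proof (induction n)
  case (Suc n)
  let ?E = "{..<n} \<rightarrow>\<^sub>E {-1, 1::real}"
  let ?s = "\<Sum>i<n. (a i)\<^sup>2"
  have 4: "(x - a n)^4 + (x + a n)^4 = 2 * x^4 + 12 * (a n)\<^sup>2 * x\<^sup>2 + 2 * (a n)^4" for x
    by (simp add: power2_eq_square power4_eq_xxxx algebra_simps)
  have "(\<Sum>\<epsilon> \<in> {..<Suc n} \<rightarrow>\<^sub>E {-1, 1::real}. (\<Sum>i<Suc n. \<epsilon> i * a i)^4) =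
      2 * (\<Sum>\<epsilon>\<in>?E. (\<Sum>i<n. \<epsilon> i * a i)^4) + 12 * (a n)\<^sup>2 * (2 ^ n * ?s) + 2 ^ Suc n * (a n)^4"
    unfolding sum_sign_patterns_Suc[of "\<lambda>x. x^4"] 4 sign_second_moment[symmetric]
    by (simp add: sum.distrib card_sign_patterns sum_distrib_left)
  also have "\<dots> \<le> 2 * (3 * 2 ^ n * ?s\<^sup>2) + 12 * (a n)\<^sup>2 * (2 ^ n * ?s) + 2 ^ Suc n * (a n)^4"
    using Suc by simp
  also have "\<dots> = 2 ^ Suc n * (3 * ?s\<^sup>2 + 6 * (a n)\<^sup>2 * ?s + (a n)^4)"
    by (simp add: algebra_simps)
  also have "\<dots> \<le> 2 ^ Suc n * (3 * (?s + (a n)\<^sup>2)\<^sup>2)"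
  proof (rule mult_left_mono)
    have "3 * (?s + (a n)\<^sup>2)\<^sup>2 = 3 * ?s\<^sup>2 + 6 * (a n)\<^sup>2 * ?s + (a n)^4 + 2 * (a n)^4"
      by (simp add: power2_eq_square power4_eq_xxxx algebra_simps)
    moreover have "0 \<le> (a n)^4" by (rule zero_le_even_power) simp
    ultimately show "3 * ?s\<^sup>2 + 6 * (a n)\<^sup>2 * ?s + (a n)^4 \<le> 3 * (?s + (a n)\<^sup>2)\<^sup>2" by linarith
  qed simp
  finally show ?case by (simp add: mult_ac)
qed simp

text \<open>
  With \<open>X = \<Sum>i. \<epsilon> i * a i\<close> and \<open>\<sigma>\<^sup>2\<close> its second moment, integrate the pointwise bound
  \<open>\<sigma>\<^sup>3 * \<bar>X\<bar> \<ge> \<sigma>\<^sup>2 * X\<^sup>2 - 4/27 * X ^ 4\<close>. As the fourth moment is at most \<open>3 * \<sigma> ^ 4\<close>, it follows that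
  \<open>\<sigma>\<close> is at most \<open>9/5\<close> times the mean of \<open>\<bar>X\<bar>\<close>.
\<close>
lemma khintchine:
  "square_function n a \<le> 2 * ((\<Sum>\<epsilon> \<in> {..<n} \<rightarrow>\<^sub>E {-1, 1::real}. \<bar>\<Sum>i<n. \<epsilon> i * a i\<bar>) / 2 ^ n)"
proof -
  let ?E = "{..<n} \<rightarrow>\<^sub>E {-1, 1::real}"
  define X where "X \<epsilon> = (\<Sum>i<n. \<epsilon> i * a i)" for \<epsilon> :: "nat \<Rightarrow> real"
  define \<sigma> where "\<sigma> = square_function n a"
  have \<sigma>0: "0 \<le> \<sigma>" and \<sigma>2: "\<sigma>\<^sup>2 = (\<Sum>i<n. (a i)\<^sup>2)" 
    by (auto simp: \<sigma>_def square_function_def sum_nonneg)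
  show ?thesis
  proof (cases "\<sigma> = 0")
    case True
    then show ?thesis by (simp add: \<sigma>_def sum_nonneg)
  next
    case False
    then have pos: "\<sigma> > 0" using \<sigma>0 by simp
    \<comment> \<open>The two sides touch at \<open>\<bar>x\<bar> = 3/2 * \<sigma>\<close>; this double root is where \<open>4/27\<close> comes from.\<close>
    have pt: "\<sigma>^3 * \<bar>x\<bar> \<ge> \<sigma>\<^sup>2 * x\<^sup>2 - 4/27 * x^4" for x
    proof -
      define y where "y = \<bar>x\<bar>"
      have y: "y \<ge> 0" "x\<^sup>2 = y\<^sup>2" "x^4 = y^4" by (auto simp: y_def power_even_abs)
      have "\<sigma>^3 * y - \<sigma>\<^sup>2 * y\<^sup>2 + 4/27 * y^4 = 4/27 * y * ((y - 3/2 * \<sigma>)\<^sup>2 * (y + 3 * \<sigma>))"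
        by (simp add: power2_eq_square power3_eq_cube power4_eq_xxxx algebra_simps)
      also have "\<dots> \<ge> 0" using y \<sigma>0 by (intro mult_nonneg_nonneg) auto
      finally have "\<sigma>\<^sup>2 * y\<^sup>2 - 4/27 * y^4 \<le> \<sigma>^3 * y" by linarith
      then show ?thesis unfolding y(2,3) y_def[symmetric] .
    qed
    have "\<sigma>\<^sup>2 * (2 ^ n * \<sigma>\<^sup>2) - 4/27 * (3 * 2 ^ n * (\<sigma>\<^sup>2)\<^sup>2) 
       \<le> \<sigma>\<^sup>2 * (\<Sum>\<epsilon>\<in>?E. (X \<epsilon>)\<^sup>2) - 4/27 * (\<Sum>\<epsilon>\<in>?E. (X \<epsilon>)^4)"
      using sign_second_moment[where n=n and a=a] sign_fourth_moment[where n=n and a=a] unfolding X_def \<sigma>2 by simp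
    also have "\<dots> = (\<Sum>\<epsilon>\<in>?E. \<sigma>\<^sup>2 * (X \<epsilon>)\<^sup>2 - 4/27 * (X \<epsilon>)^4)"
      by (simp only: sum_subtractf sum_distrib_left)
    also have "\<dots> \<le> (\<Sum>\<epsilon>\<in>?E. \<sigma>^3 * \<bar>X \<epsilon>\<bar>)" by (intro sum_mono pt)
    also have "\<dots> = \<sigma>^3 * (\<Sum>\<epsilon>\<in>?E. \<bar>X \<epsilon>\<bar>)" by (simp add: sum_distrib_left)
    finally have "\<sigma>^3 * (5/9 * 2 ^ n * \<sigma>) \<le> \<sigma>^3 * (\<Sum>\<epsilon>\<in>?E. \<bar>X \<epsilon>\<bar>)"
      by (simp add: power2_eq_square power3_eq_cube algebra_simps)
    then have "5/9 * 2 ^ n * \<sigma> \<le> (\<Sum>\<epsilon>\<in>?E. \<bar>X \<epsilon>\<bar>)" using pos by simp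
    moreover have "1/2 * 2 ^ n * \<sigma> \<le> 5/9 * 2 ^ n * \<sigma>" using pos by simp
    ultimately have "1/2 * 2 ^ n * \<sigma> \<le> (\<Sum>\<epsilon>\<in>?E. \<bar>X \<epsilon>\<bar>)" by linarith
    then show ?thesis unfolding X_def \<sigma>_def by (simp add: field_simps)
  qed
qed

section \<open>Rearrangements of finite sequences\<close>

lemma decreasing_rearrangement:
  fixes f :: "nat \<Rightarrow> real"
  obtains \<pi> where "\<pi> permutes {..<n}" "\<And>i j. i \<le> j \<Longrightarrow> j < n \<Longrightarrow> f (\<pi> j) \<le> f (\<pi> i)"
proof -
  let ?xs = "map f [0..<n]"
  let ?ys = "rev (sort ?xs)"
  have "mset ?ys = mset ?xs" by simp
  then obtain \<pi> where \<pi>: "\<pi> permutes {..<length ?xs}" "permute_list \<pi> ?xs = ?ys"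
    by (rule mset_eq_permutation)
  then have \<pi>': "\<pi> permutes {..<n}" by simp
  have y: "?ys ! i = f (\<pi> i)" if "i < n" for i
    using \<pi> that permutes_in_image[OF \<pi>', of i]
    by (simp add: permute_list_nth[OF \<pi>(1)] flip: \<pi>(2))
  have "f (\<pi> j) \<le> f (\<pi> i)" if "i \<le> j" "j < n" for i j
  proof -
    have "?ys ! j \<le> ?ys ! i" using that sorted_rev_nth_mono[of ?ys i j] by simp
    then show ?thesis using y that by simp
  qed
  then show ?thesis using that \<pi>' by blast
qed

lemma sum_le_sum_initial:
  fixes s :: "nat \<Rightarrow> real"
  assumes dec: "\<And>i j. i \<le> j \<Longrightarrow> j < n \<Longrightarrow> s j \<le> s i" and "B \<subseteq> {..<n}"
  shows "sum s B \<le> sum s {..<card B}"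
  using assms(2)
proof (induction "card B" arbitrary: B)
  case 0
  then have "B = {}" using finite_subset by fastforce
  then show ?case by simp
next
  case (Suc k)
  have fin: "finite B" using Suc.prems finite_subset by blast
  define b where "b = Max B"
  have bB: "b \<in> B" using Suc.hyps fin unfolding b_def by (metis Max_in card.empty nat.distinct(1))
  have "B \<subseteq> {..b}" using fin by (auto simp: b_def)
  then have "card B \<le> Suc b" using card_mono[of "{..b}" B] by simp
  then have kb: "k \<le> b" using Suc.hyps by simp
  have "sum s (B - {b}) \<le> sum s {..<k}"
  proof -
    have card: "k = card (B - {b})" using Suc.hyps(2) bB fin by simp
    have "sum s (B - {b}) \<le> sum s {..<card (B - {b})}"
      by (rule Suc.hyps(1)[OF card]) (use Suc.prems in auto)
    then show ?thesis by (simp only: card[symmetric])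
  qed
  moreover have "s b \<le> s k" using dec kb bB Suc.prems by auto
  moreover have "sum s B = s b + sum s (B - {b})" using fin bB by (rule sum.remove)
  ultimately show ?case unfolding Suc.hyps(2)[symmetric] by simp
qed

text \<open>Summation by parts: a nonnegative decreasing weight is a positive combination of initial segments.\<close>
lemma sum_mult_decreasing_mono:
  fixes a b g :: "nat \<Rightarrow> real"
  assumes dec: "\<And>i j. i \<le> j \<Longrightarrow> j < n \<Longrightarrow> g j \<le> g i" and g: "\<And>i. i < n \<Longrightarrow> 0 \<le> g i"
    and le: "\<And>k. k \<le> n \<Longrightarrow> sum a {..<k} \<le> sum b {..<k}"
  shows "(\<Sum>i<n. a i * g i) \<le> (\<Sum>i<n. b i * g i)"
proof (cases n)
  case (Suc n')
  have *: "g k * (sum b {..<Suc k} - sum a {..<Suc k}) \<le> (\<Sum>i<Suc k. (b i - a i) * g i)" if "k < n" for k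
    using that
  proof (induction k)
    case (Suc k)
    have "g (Suc k) * (sum b {..<Suc k} - sum a {..<Suc k}) 
        \<le> g k * (sum b {..<Suc k} - sum a {..<Suc k})"
      using dec[of k "Suc k"] le[of "Suc k"] Suc.prems by (intro mult_right_mono) auto
    also have "\<dots> \<le> (\<Sum>i<Suc k. (b i - a i) * g i)" using Suc by simp
    finally show ?case by (simp add: algebra_simps)
  qed (simp add: algebra_simps)
  have "0 \<le> g n' * (sum b {..<n} - sum a {..<n})" using g[of n'] le[of n] Suc
    by (intro mult_nonneg_nonneg) auto
  also have "\<dots> \<le> (\<Sum>i<n. (b i - a i) * g i)" using *[of n'] Suc by simp
  finally show ?thesis by (simp add: left_diff_distrib sum_subtractf)
qed simp

text \<open>
  Let \<open>\<pi>\<close> and \<open>\<rho>\<close> arrange \<open>u\<close> and \<open>S\<close> in decreasing order. For \<open>k\<close> indices with \<open>2 * k \<le> n\<close> use the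
  hypothesis at the level \<open>\<theta> = u (\<pi> (2 * k - 1))\<close>. Fewer than \<open>2 * k\<close> indices lie above it, so \<open>S\<close>
  contributes at most its \<open>2 * k\<close> largest values, hence at most twice the sum of its \<open>k\<close> largest values;
  and \<open>k * \<theta>\<close> is at most the sum of the \<open>k\<close> values \<open>u (\<pi> 1), u (\<pi> 3), ...\<close>. The sequence of
  these values is the dilation by \<open>1/2\<close> of the decreasing rearrangement. For larger \<open>k\<close> the level
  \<open>0\<close> suffices.
\<close>
lemma garsia_submajorization:
  fixes u S :: "nat \<Rightarrow> real"
  assumes n: "even n" and "0 \<le> K" and u: "\<And>i. 0 \<le> u i" and S: "\<And>i. 0 \<le> S i"
    and garsia: "\<And>\<theta>. 0 \<le> \<theta> \<Longrightarrow> (\<Sum>i<n. max 0 (u i - \<theta>)) \<le> K * sum S {i\<in>{..<n}. u i > \<theta>}"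
    and \<pi>: "\<pi> permutes {..<n}" "\<And>i j. i \<le> j \<Longrightarrow> j < n \<Longrightarrow> u (\<pi> j) \<le> u (\<pi> i)"
    and \<rho>: "\<rho> permutes {..<n}" "\<And>i j. i \<le> j \<Longrightarrow> j < n \<Longrightarrow> S (\<rho> j) \<le> S (\<rho> i)"
    and A: "A \<subseteq> {..<n}" "card A = k"
  shows "sum u A \<le> (\<Sum>i<k. (if 2 * i + 1 < n then u (\<pi> (2 * i + 1)) else 0) + 2 * K * S (\<rho> i))"
proof -
  have sumS: "sum S B \<le> (\<Sum>i<card B. S (\<rho> i))" if "B \<subseteq> {..<n}" for B
  proof -
    define B' where "B' = inv \<rho> ` B"
    have inj: "inj_on (inv \<rho>) B" using permutes_inj[OF permutes_inv[OF \<rho>(1)]] by (rule inj_on_subset) simp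
    have "B' \<subseteq> {..<n}" unfolding B'_def using that permutes_image[OF permutes_inv[OF \<rho>(1)]] by blast
    then have "(\<Sum>i\<in>B'. S (\<rho> i)) \<le> (\<Sum>i<card B'. S (\<rho> i))"
      by (intro sum_le_sum_initial[where n=n] \<rho>(2)) auto
    moreover have "(\<Sum>i\<in>B'. S (\<rho> i)) = sum S B"
      unfolding B'_def by (subst sum.reindex[OF inj]) (simp add: permutes_inverses[OF \<rho>(1)])
    ultimately show ?thesis using card_image[OF inj] by (simp add: B'_def)
  qed
  have dbl: "(\<Sum>i<min n (2 * k). S (\<rho> i)) \<le> 2 * (\<Sum>i<k. S (\<rho> i))" if "k \<le> n"
  proof -
    have split: "{..<min n (2 * k)} = {..<k} \<union> {k..<min n (2 * k)}" using that by auto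
    have "(\<Sum>i<min n (2 * k). S (\<rho> i)) = (\<Sum>i<k. S (\<rho> i)) + (\<Sum>i=k..<min n (2*k). S (\<rho> i))"
      unfolding split by (rule sum.union_disjoint) auto
    also have "(\<Sum>i=k..<min n (2*k). S (\<rho> i)) \<le> (\<Sum>i<card {k..<min n (2*k)}. S (\<rho> i))"
      by (intro sum_le_sum_initial[where n=n] \<rho>(2)) auto
    also have "\<dots> \<le> (\<Sum>i<k. S (\<rho> i))"
      using S by (intro sum_mono2) auto
    finally show ?thesis by simp
  qed
  have kn: "k \<le> n" using A card_mono[of "{..<n}" A] by simp
  have finA: "finite A" using A finite_subset by blast
  show ?thesis
  proof (cases "2 * k \<le> n")
    case True
    show ?thesis
    proof (cases "k = 0")
      case True
      then show ?thesis using A finA by simp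
    next
      case False
      define \<theta> where "\<theta> = u (\<pi> (2 * k - 1))"
      define B where "B = {i\<in>{..<n}. u i > \<theta>}"
      have "inv \<pi> ` B \<subseteq> {..<2 * k}"
      proof safe
        fix i assume "i \<in> B"
        then have i: "i < n" "u i > \<theta>" by (auto simp: B_def)
        have "inv \<pi> i < n" using i permutes_in_image[OF permutes_inv[OF \<pi>(1)], of i] by simp
        moreover have "u (\<pi> (inv \<pi> i)) = u i" using permutes_inverses[OF \<pi>(1)] by simp
        ultimately have "\<not> 2 * k - 1 \<le> inv \<pi> i"
          using i \<pi>(2)[of "2 * k - 1" "inv \<pi> i"] by (auto simp: \<theta>_def)
        then show "inv \<pi> i < 2 * k" by simp
      qed
      then have "card (inv \<pi> ` B) \<le> 2 * k" using card_mono[of "{..<2*k}"] by fastforce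
      moreover have "card (inv \<pi> ` B) = card B"
        using permutes_inj[OF permutes_inv[OF \<pi>(1)]] by (intro card_image) (rule inj_on_subset[OF _ subset_UNIV])
      ultimately have cB: "card B \<le> 2 * k" by simp
      have "sum u A \<le> (\<Sum>i\<in>A. \<theta> + max 0 (u i - \<theta>))" by (intro sum_mono) auto
      also have "\<dots> \<le> k * \<theta> + (\<Sum>i<n. max 0 (u i - \<theta>))"
        using A by (simp add: sum.distrib sum_mono2)
      also have "\<dots> \<le> k * \<theta> + K * sum S B"
        using garsia[of \<theta>] u by (simp add: \<theta>_def B_def)
      also have "\<dots> \<le> k * \<theta> + K * (2 * (\<Sum>i<k. S (\<rho> i)))"
      proof -
        have "sum S B \<le> (\<Sum>i<card B. S (\<rho> i))" by (rule sumS) (auto simp: B_def)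
        also have "\<dots> \<le> (\<Sum>i<2 * k. S (\<rho> i))" using cB S by (intro sum_mono2) auto
        also have "\<dots> \<le> 2 * (\<Sum>i<k. S (\<rho> i))" using dbl kn True by (simp add: min_def split: if_splits)
        finally show ?thesis using \<open>0 \<le> K\<close> by (simp add: mult_left_mono)
      qed
      also have "k * \<theta> \<le> (\<Sum>i<k. if 2 * i + 1 < n then u (\<pi> (2 * i + 1)) else 0)"
      proof -
        have "(\<Sum>i<k. \<theta>) \<le> (\<Sum>i<k. if 2 * i + 1 < n then u (\<pi> (2 * i + 1)) else 0)"
        proof (intro sum_mono)
          fix i assume "i \<in> {..<k}"
          then show "\<theta> \<le> (if 2 * i + 1 < n then u (\<pi> (2 * i + 1)) else 0)"
            using True \<pi>(2)[of "2 * i + 1" "2 * k - 1"] by (auto simp: \<theta>_def)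
        qed
        then show ?thesis by simp
      qed
      finally show ?thesis by (simp add: sum.distrib sum_distrib_left mult_ac)
    qed
  next
    case False
    have "sum u A \<le> sum u {..<n}" using A u by (intro sum_mono2) auto
    also have "\<dots> \<le> K * sum S {i\<in>{..<n}. u i > 0}" using garsia[of 0] u by (simp add: max_def)
    also have "\<dots> \<le> K * sum S {..<n}" using S \<open>0 \<le> K\<close> by (intro mult_left_mono sum_mono2) auto
    also have "\<dots> \<le> K * (2 * (\<Sum>i<k. S (\<rho> i)))"
      using sumS[of "{..<n}"] dbl[OF kn] False \<open>0 \<le> K\<close> by (intro mult_left_mono) (auto simp: min_def)
    also have "\<dots> = (\<Sum>i<k. 2 * K * S (\<rho> i))" by (simp add: sum_distrib_left mult_ac)
    also have "\<dots> \<le> (\<Sum>i<k. (if 2 * i + 1 < n then u (\<pi> (2 * i + 1)) else 0) + 2 * K * S (\<rho> i))"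
      using u by (intro sum_mono) auto
    finally show ?thesis .
  qed
qed

section \<open>Basic sequences and block sequences\<close>

text \<open>For linearly independent \<open>x\<close>: the partial sum projections on the span of \<open>x\<close> have norm at most \<open>K\<close>.\<close>
definition projection_bound :: "real \<Rightarrow> (nat \<Rightarrow> 'a::real_normed_vector) \<Rightarrow> bool" where
  "projection_bound K x \<longleftrightarrow>
     (\<forall>a m n. m \<le> n \<longrightarrow> norm (\<Sum>i<m. a i *\<^sub>R x i) \<le> K * norm (\<Sum>i<n. a i *\<^sub>R x i))"

lemma projection_boundD:
  "projection_bound K x \<Longrightarrow> m \<le> n \<Longrightarrow> norm (\<Sum>i<m. a i *\<^sub>R x i) \<le> K * norm (\<Sum>i<n. a i *\<^sub>R x i)"
  by (auto simp: projection_bound_def)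

lemma span_range_finite_expansion:
  fixes x :: "nat \<Rightarrow> 'a::real_vector"
  assumes "v \<in> span (range x)"
  shows "\<exists>a n. \<forall>m\<ge>n. v = (\<Sum>i<m. a i *\<^sub>R x i)"
  using assms
proof (induction rule: span_induct_alt)
  case base
  show ?case by (rule exI[of _ "\<lambda>_. 0"]) simp
next
  case (step c b v)
  then obtain a n k where v: "\<And>m. m \<ge> n \<Longrightarrow> v = (\<Sum>i<m. a i *\<^sub>R x i)" and b: "b = x k" by blast
  have "c *\<^sub>R b + v = (\<Sum>i<m. (a i + (if i = k then c else 0)) *\<^sub>R x i)" if "m \<ge> max n (Suc k)" for m
  proof -
    have "(\<Sum>i<m. (a i + (if i = k then c else 0)) *\<^sub>R x i)
        = (\<Sum>i<m. a i *\<^sub>R x i) + (\<Sum>i<m. if i = k then c *\<^sub>R x i else 0)"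
      by (simp add: scaleR_add_left sum.distrib if_distrib[of "\<lambda>c. c *\<^sub>R _"] cong: if_cong)
    also have "(\<Sum>i<m. if i = k then c *\<^sub>R x i else 0) = c *\<^sub>R x k"
      using that by (simp add: sum.delta)
    finally show ?thesis using v[of m] that b by simp
  qed
  then show ?case by (intro exI allI impI)
qed

lemma coordinate_bound:
  assumes "projection_bound K x" "i < n"
  shows "\<bar>a i\<bar> * norm (x i) \<le> 2 * K * norm (\<Sum>i<n. a i *\<^sub>R x i)"
proof -
  have "\<bar>a i\<bar> * norm (x i) = norm ((\<Sum>j<Suc i. a j *\<^sub>R x j) - (\<Sum>j<i. a j *\<^sub>R x j))" by simp
  also have "\<dots> \<le> norm (\<Sum>j<Suc i. a j *\<^sub>R x j) + norm (\<Sum>j<i. a j *\<^sub>R x j)" by (rule norm_triangle_ineq4)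
  also have "\<dots> \<le> K * norm (\<Sum>i<n. a i *\<^sub>R x i) + K * norm (\<Sum>i<n. a i *\<^sub>R x i)"
    using assms by (intro add_mono projection_boundD) auto
  finally show ?thesis by simp
qed

text \<open>
  Approximate \<open>v\<close> by elements \<open>w j\<close> of the span. Their coordinates form Cauchy sequences, and the
  projection bound, which is uniform in \<open>m\<close>, shows that the limits are the coordinates of \<open>v\<close>.
\<close>
lemma projection_bound_expansion:
  fixes x :: "nat \<Rightarrow> 'a::banach"
  assumes pb: "projection_bound K x" and K: "0 \<le> K" and nz: "\<And>n. x n \<noteq> 0"
    and v: "v \<in> closure (span (range x))"
  shows "\<exists>a. (\<lambda>n. a n *\<^sub>R x n) sums v"
proof -
  obtain w where w: "\<And>j. w j \<in> span (range x)" "w \<longlonglongrightarrow> v"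
    using v unfolding closure_sequential by blast
  have "\<forall>j. \<exists>a n. \<forall>m\<ge>n. w j = (\<Sum>i<m. a i *\<^sub>R x i)" using w(1) span_range_finite_expansion by blast
  then obtain A N where AN: "\<And>j m. m \<ge> N j \<Longrightarrow> w j = (\<Sum>i<m. A j i *\<^sub>R x i)" by metis
  have diff: "w j - w k = (\<Sum>i<m. (A j i - A k i) *\<^sub>R x i)" if "m \<ge> N j" "m \<ge> N k" for j k m
    using AN[OF that(1)] AN[OF that(2)] by (simp add: scaleR_diff_left sum_subtractf)
  have Cw: "Cauchy w" using w(2) by (rule LIMSEQ_imp_Cauchy)
  have "Cauchy (\<lambda>j. A j i)" for i
  proof (rule metric_CauchyI)
    fix e :: real assume "0 < e"
    define e' where "e' = e * norm (x i) / (2 * K + 1)"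
    have "e' > 0" using \<open>0 < e\<close> nz[of i] K by (simp add: e'_def)
    then obtain M where M: "\<And>j k. j \<ge> M \<Longrightarrow> k \<ge> M \<Longrightarrow> dist (w j) (w k) < e'"
      using metric_CauchyD[OF Cw] by blast
    have "dist (A j i) (A k i) < e" if "j \<ge> M" "k \<ge> M" for j k
    proof -
      define m where "m = max (Suc i) (max (N j) (N k))"
      have "\<bar>A j i - A k i\<bar> * norm (x i) \<le> 2 * K * norm (w j - w k)"
        using coordinate_bound[OF pb, of i m "\<lambda>i. A j i - A k i"] diff[of j m k] by (simp add: m_def)
      also have "\<dots> \<le> 2 * K * e'" using M[OF that] K by (intro mult_left_mono) (auto simp: dist_norm)
      also have "\<dots> < (2 * K + 1) * e'" using \<open>e' > 0\<close> by (simp add: algebra_simps)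
      also have "\<dots> = e * norm (x i)" using K by (simp add: e'_def)
      finally show ?thesis using nz[of i] by (simp add: dist_real_def)
    qed
    then show "\<exists>M. \<forall>j\<ge>M. \<forall>k\<ge>M. dist (A j i) (A k i) < e" by blast
  qed
  then have "\<forall>i. \<exists>l. (\<lambda>j. A j i) \<longlonglongrightarrow> l" using Cauchy_convergent convergent_def by metis
  then obtain a where a: "\<And>i. (\<lambda>j. A j i) \<longlonglongrightarrow> a i" by metis
  have proj: "norm ((\<Sum>i<m. A j i *\<^sub>R x i) - (\<Sum>i<m. a i *\<^sub>R x i)) \<le> K * norm (w j - v)" for j m
  proof (rule LIMSEQ_le)
    show "(\<lambda>k. norm ((\<Sum>i<m. A j i *\<^sub>R x i) - (\<Sum>i<m. A k i *\<^sub>R x i))) 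
       \<longlonglongrightarrow> norm ((\<Sum>i<m. A j i *\<^sub>R x i) - (\<Sum>i<m. a i *\<^sub>R x i))"
      by (intro tendsto_intros a)
    show "(\<lambda>k. K * norm (w j - w k)) \<longlonglongrightarrow> K * norm (w j - v)" by (intro tendsto_intros w(2))
    have "norm ((\<Sum>i<m. A j i *\<^sub>R x i) - (\<Sum>i<m. A k i *\<^sub>R x i)) \<le> K * norm (w j - w k)" for k
      using projection_boundD[OF pb, of m "max m (max (N j) (N k))" "\<lambda>i. A j i - A k i"]
      by (simp add: diff[symmetric] scaleR_diff_left sum_subtractf AN[symmetric])
    then show "\<exists>M. \<forall>k\<ge>M. norm ((\<Sum>i<m. A j i *\<^sub>R x i) - (\<Sum>i<m. A k i *\<^sub>R x i)) \<le> K * norm (w j - w k)"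
      by blast
  qed
  have "(\<lambda>m. \<Sum>i<m. a i *\<^sub>R x i) \<longlonglongrightarrow> v"
  proof (rule metric_LIMSEQ_I)
    fix e :: real assume "0 < e"
    then have "e / (1 + K) > 0" using K by simp
    then obtain j where j: "dist (w j) v < e / (1 + K)"
      using metric_LIMSEQ_D[OF w(2)] by blast
    have "dist (\<Sum>i<m. a i *\<^sub>R x i) v < e" if "m \<ge> N j" for m
    proof -
      have "dist (\<Sum>i<m. a i *\<^sub>R x i) v \<le> dist (\<Sum>i<m. a i *\<^sub>R x i) (w j) + dist (w j) v" by (rule dist_triangle)
      also have "dist (\<Sum>i<m. a i *\<^sub>R x i) (w j) \<le> K * dist (w j) v"
        using proj[of j m] AN[OF that] by (simp add: dist_norm norm_minus_commute)
      also have "K * dist (w j) v + dist (w j) v = (1 + K) * dist (w j) v" by (simp add: algebra_simps)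
      also have "\<dots> < e" using j K by (simp add: field_simps)
      finally show ?thesis by simp
    qed
    then show "\<exists>M. \<forall>m\<ge>M. dist (\<Sum>i<m. a i *\<^sub>R x i) v < e" by blast
  qed
  then show ?thesis by (auto simp: sums_def)
qed

lemma expansion_coordinate_bound:
  fixes x :: "nat \<Rightarrow> 'a::banach"
  assumes pb: "projection_bound K x" and a: "(\<lambda>n. a n *\<^sub>R x n) sums v" 
  shows "\<bar>a i\<bar> * norm (x i) \<le> 2 * K * norm v"
proof (rule LIMSEQ_le_const)
  show "(\<lambda>m. 2 * K * norm (\<Sum>n<m. a n *\<^sub>R x n)) \<longlonglongrightarrow> 2 * K * norm v"
    using a unfolding sums_def by (intro tendsto_intros)
  show "\<exists>M. \<forall>m\<ge>M. \<bar>a i\<bar> * norm (x i) \<le> 2 * K * norm (\<Sum>n<m. a n *\<^sub>R x n)"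
    using coordinate_bound[OF pb] by (intro exI[of _ "Suc i"]) auto
qed

lemma projection_bound_expansion_unique:
  fixes x :: "nat \<Rightarrow> 'a::banach"
  assumes pb: "projection_bound K x" and nz: "\<And>n. x n \<noteq> 0"
    and a: "(\<lambda>n. a n *\<^sub>R x n) sums v" and b: "(\<lambda>n. b n *\<^sub>R x n) sums v"
  shows "a = b"
proof
  fix i
  have "(\<lambda>n. (a n - b n) *\<^sub>R x n) sums (v - v)"
    unfolding scaleR_diff_left by (intro sums_diff a b)
  from expansion_coordinate_bound[OF pb this, of i]
  have "\<bar>a i - b i\<bar> * norm (x i) \<le> 0" by simp
  then show "a i = b i" using nz[of i] by (auto simp: mult_le_0_iff)
qed

lemma projection_bound_imp_basic_sequence:
  fixes x :: "nat \<Rightarrow> 'a::banach"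
  assumes "projection_bound K x" "0 \<le> K" "\<And>n. x n \<noteq> 0"
  shows "basic_sequence x"
  unfolding basic_sequence_def
proof
  fix v assume "v \<in> closure (span (range x))"
  then obtain a where a: "(\<lambda>n. a n *\<^sub>R x n) sums v" using projection_bound_expansion[OF assms] by blast
  then show "\<exists>!a. (\<lambda>n. a n *\<^sub>R x n) sums v"
    by (rule ex1I[of _ a]) (rule projection_bound_expansion_unique[OF assms(1,3) _ a])
qed

lemma coordinate_functionals:
  fixes e :: "nat \<Rightarrow> 'a::banach"
  assumes pb: "projection_bound K e" and K: "0 \<le> K" and nz: "\<And>n. e n \<noteq> 0"
    and dense: "closure (span (range e)) = UNIV"
  obtains c :: "nat \<Rightarrow> 'a \<Rightarrow> real" 
  where "\<And>v. (\<lambda>n. c n v *\<^sub>R e n) sums v" "\<And>n. bounded_linear (c n)"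
proof -
  have "\<forall>v. \<exists>a. (\<lambda>n. a n *\<^sub>R e n) sums v"
    using projection_bound_expansion[OF pb K nz] dense by blast
  then obtain a where a: "\<And>v. (\<lambda>n. a v n *\<^sub>R e n) sums v" by metis
  have uniq: "a v = b" if "(\<lambda>n. b n *\<^sub>R e n) sums v" for v b
    using projection_bound_expansion_unique[OF pb nz a that] .
  have "bounded_linear (\<lambda>v. a v n)" for n
  proof (rule bounded_linear_intro[where K = "2 * K / norm (e n)"])
    fix u v :: 'a and r :: real
    have "(\<lambda>n. (a u n + a v n) *\<^sub>R e n) sums (u + v)"
      unfolding scaleR_add_left by (intro sums_add a)
    from uniq[OF this] show "a (u + v) n = a u n + a v n" by simp
    have "(\<lambda>n. (r * a v n) *\<^sub>R e n) sums (r *\<^sub>R v)"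
      unfolding scaleR_scaleR[symmetric] by (intro sums_scaleR_right a)
    from uniq[OF this] show "a (r *\<^sub>R v) n = r *\<^sub>R a v n" by simp
    show "norm (a v n) \<le> norm v * (2 * K / norm (e n))"
      using expansion_coordinate_bound[OF pb a, of v n] nz[of n] by (simp add: field_simps)
  qed
  then show ?thesis using that[of "\<lambda>n v. a v n"] a by blast
qed

text \<open>
  One coefficient sequence \<open>b\<close> serves all partial sums of the block combination, so that bounds for
  the basis projections carry over to the blocks.
\<close>
lemma blocks_as_basis_expansion:
  fixes e :: "nat \<Rightarrow> 'a::real_vector"
  assumes pq: "\<And>k. p k \<le> q k" "\<And>k. q k \<le> p (Suc k)"
    and y: "\<And>k. y k = (\<Sum>j=p k..<q k. c k j *\<^sub>R e j)"
  shows "\<exists>b. \<forall>m\<le>n. (\<Sum>k<m. a k *\<^sub>R y k) = (\<Sum>j<p m. b j *\<^sub>R e j)"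
proof (induction n)
  case 0
  show ?case by (rule exI[of _ "\<lambda>_. 0"]) simp
next
  case (Suc n)
  then obtain b where b: "\<And>m. m \<le> n \<Longrightarrow> (\<Sum>k<m. a k *\<^sub>R y k) = (\<Sum>j<p m. b j *\<^sub>R e j)" by blast
  define b' where "b' j = (if j < p n then b j else if j < q n then a n * c n j else 0)" for j
  have "p k \<le> p (Suc k)" for k using pq(1)[of k] pq(2)[of k] by linarith
  then have pmono: "p m \<le> p n" if "m \<le> n" for m
    using that by (rule lift_Suc_mono_le)
  have old: "(\<Sum>j<p m. b' j *\<^sub>R e j) = (\<Sum>k<m. a k *\<^sub>R y k)" if "m \<le> n" for m
    unfolding b[OF that] using pmono[OF that] by (intro sum.cong) (auto simp: b'_def)
  have split: "{..<p (Suc n)} = {..<p n} \<union> ({p n..<q n} \<union> {q n..<p (Suc n)})" using pq[of n] by auto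
  have "(\<Sum>j<p (Suc n). b' j *\<^sub>R e j) = 
     (\<Sum>j<p n. b' j *\<^sub>R e j) + ((\<Sum>j=p n..<q n. b' j *\<^sub>R e j) + (\<Sum>j=q n..<p (Suc n). b' j *\<^sub>R e j))"
    unfolding split using pq[of n] by (subst sum.union_disjoint; auto intro!: sum.union_disjoint)
  also have "(\<Sum>j=q n..<p (Suc n). b' j *\<^sub>R e j) = 0"
    using pq[of n] by (intro sum.neutral) (auto simp: b'_def)
  also have "(\<Sum>j=p n..<q n. b' j *\<^sub>R e j) = a n *\<^sub>R y n"
    unfolding y scaleR_sum_right by (intro sum.cong) (auto simp: b'_def)
  finally have "(\<Sum>k<Suc n. a k *\<^sub>R y k) = (\<Sum>j<p (Suc n). b' j *\<^sub>R e j)"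
    using old[of n] by simp
  then show ?case using old by (intro exI[of _ b']) (auto simp: le_Suc_eq simp del: sum.lessThan_Suc)
qed

lemma projection_bound_blocks:
  assumes pb: "projection_bound K e" 
    and pq: "\<And>k. p k \<le> q k" "\<And>k. q k \<le> p (Suc k)"
    and y: "\<And>k. y k = (\<Sum>j=p k..<q k. c k j *\<^sub>R e j)"
  shows "projection_bound K y"
  unfolding projection_bound_def
proof (intro allI impI)
  fix a :: "nat \<Rightarrow> real" and m n :: nat assume "m \<le> n"
  obtain b where b: "\<And>m. m \<le> n \<Longrightarrow> (\<Sum>k<m. a k *\<^sub>R y k) = (\<Sum>j<p m. b j *\<^sub>R e j)"
    using blocks_as_basis_expansion[of p q y c e n a, OF pq y] by blast
  have "p k \<le> p (Suc k)" for k using pq(1)[of k] pq(2)[of k] by linarith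
  then have "p m \<le> p n"
    using \<open>m \<le> n\<close> by (rule lift_Suc_mono_le)
  then show "norm (\<Sum>i<m. a i *\<^sub>R y i) \<le> K * norm (\<Sum>i<n. a i *\<^sub>R y i)"
    unfolding b[OF \<open>m \<le> n\<close>] b[OF order_refl] by (rule projection_boundD[OF pb])
qed

text \<open>
  Each coordinate satisfies \<open>\<bar>a k\<bar> * norm (y k) \<le> 2 * K * norm Y\<close> for \<open>Y = \<Sum>k. a k *\<^sub>R y k\<close>. So the
  difference of the two sums is at most \<open>2 * K * (\<Sum>k. \<theta> k) * norm Y \<le> norm Y / 2\<close>.
\<close>
lemma perturbation_norm_bounds:
  fixes x y :: "nat \<Rightarrow> 'a::real_normed_vector"
  assumes pb: "projection_bound K y" and K: "0 \<le> K"
    and close: "\<And>k. norm (x k - y k) \<le> \<theta> k * norm (y k)"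
    and \<theta>: "\<And>k. 0 \<le> \<theta> k" "\<And>n. 4 * K * (\<Sum>k<n. \<theta> k) \<le> 1"
  shows "norm (\<Sum>k<n. a k *\<^sub>R x k) \<le> 3/2 * norm (\<Sum>k<n. a k *\<^sub>R y k)"
    and "norm (\<Sum>k<n. a k *\<^sub>R y k) \<le> 2 * norm (\<Sum>k<n. a k *\<^sub>R x k)"
proof -
  let ?X = "\<Sum>k<n. a k *\<^sub>R x k" and ?Y = "\<Sum>k<n. a k *\<^sub>R y k"
  have "norm (?X - ?Y) = norm (\<Sum>k<n. a k *\<^sub>R (x k - y k))"
    by (simp add: scaleR_diff_right sum_subtractf)
  also have "\<dots> \<le> (\<Sum>k<n. \<theta> k * (2 * K * norm ?Y))"
  proof (rule sum_norm_le)
    fix k assume "k \<in> {..<n}"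
    have "norm (a k *\<^sub>R (x k - y k)) \<le> \<bar>a k\<bar> * (\<theta> k * norm (y k))"
      using close[of k] by (simp add: mult_left_mono)
    also have "\<dots> = \<theta> k * (\<bar>a k\<bar> * norm (y k))" by simp
    also have "\<dots> \<le> \<theta> k * (2 * K * norm ?Y)"
      using coordinate_bound[OF pb, of k n a] \<open>k \<in> {..<n}\<close> \<theta>(1) by (intro mult_left_mono) auto
    finally show "norm (a k *\<^sub>R (x k - y k)) \<le> \<theta> k * (2 * K * norm ?Y)" .
  qed
  also have "\<dots> = (4 * K * (\<Sum>k<n. \<theta> k)) * (1/2 * norm ?Y)"
    by (simp add: sum_distrib_left sum_distrib_right mult_ac)
  also have "\<dots> \<le> 1 * (1/2 * norm ?Y)" by (intro mult_right_mono \<theta>(2)) simp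
  finally have *: "norm (?X - ?Y) \<le> 1/2 * norm ?Y" by simp
  show "norm ?X \<le> 3/2 * norm ?Y" using * norm_triangle_sub[of ?X ?Y] by linarith
  show "norm ?Y \<le> 2 * norm ?X" using * norm_triangle_sub[of ?Y ?X] by (simp add: norm_minus_commute)
qed

lemma sign_average_mono:
  assumes "\<And>\<epsilon>. norm (\<Sum>i<n. \<epsilon> i *\<^sub>R y i) \<le> C * norm (\<Sum>i<n. \<epsilon> i *\<^sub>R x i)"
  shows "sign_average n y \<le> C * sign_average n x"
proof -
  have "(\<Sum>\<epsilon> \<in> {..<n} \<rightarrow>\<^sub>E {-1, 1::real}. norm (\<Sum>i<n. \<epsilon> i *\<^sub>R y i)) 
     \<le> (\<Sum>\<epsilon> \<in> {..<n} \<rightarrow>\<^sub>E {-1, 1::real}. C * norm (\<Sum>i<n. \<epsilon> i *\<^sub>R x i))"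
    by (rule sum_mono) (rule assms)
  then show ?thesis unfolding sign_average_def
    by (simp add: divide_right_mono flip: sum_distrib_left)
qed

lemma RUD_perturbation:
  fixes x y :: "nat \<Rightarrow> 'a::banach"
  assumes pb: "projection_bound K y" and K: "0 \<le> K" and nz: "\<And>k. y k \<noteq> 0" and RUD: "RUD y"
    and close: "\<And>k. norm (x k - y k) \<le> \<theta> k * norm (y k)"
    and \<theta>: "\<And>k. 0 \<le> \<theta> k" "\<And>n. 4 * K * (\<Sum>k<n. \<theta> k) \<le> 1"
  shows "RUD x"
proof -
  note xy = perturbation_norm_bounds(1)[OF pb K close \<theta>]
  note yx = perturbation_norm_bounds(2)[OF pb K close \<theta>]
  obtain C where C: "\<And>n a. norm (\<Sum>i<n. a i *\<^sub>R y i) \<le> C * sign_average n (\<lambda>i. a i *\<^sub>R y i)"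
    using RUD unfolding RUD_def by blast
  have "projection_bound (3 * K) x"
    unfolding projection_bound_def
  proof (intro allI impI)
    fix a :: "nat \<Rightarrow> real" and m n :: nat assume "m \<le> n"
    have "norm (\<Sum>i<m. a i *\<^sub>R x i) \<le> 3/2 * norm (\<Sum>i<m. a i *\<^sub>R y i)" by (rule xy)
    also have "\<dots> \<le> 3/2 * (K * norm (\<Sum>i<n. a i *\<^sub>R y i))"
      using projection_boundD[OF pb \<open>m \<le> n\<close>] by (intro mult_left_mono) auto
    also have "\<dots> \<le> 3/2 * (K * (2 * norm (\<Sum>i<n. a i *\<^sub>R x i)))"
      using K by (intro mult_left_mono yx) auto
    finally show "norm (\<Sum>i<m. a i *\<^sub>R x i) \<le> 3 * K * norm (\<Sum>i<n. a i *\<^sub>R x i)" by simp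
  qed
  moreover have "x k \<noteq> 0" for k
  proof
    assume "x k = 0"
    let ?a = "\<lambda>i. if i = k then 1 else 0 :: real"
    have "(\<Sum>i<Suc k. ?a i *\<^sub>R z i) = z k" for z :: "nat \<Rightarrow> 'a" by simp
    then have "norm (y k) \<le> 2 * norm (x k)" using yx[where n="Suc k" and a="?a"] by (simp only:)
    then show False using nz[of k] \<open>x k = 0\<close> by simp
  qed
  ultimately have "basic_sequence x"
    using K by (intro projection_bound_imp_basic_sequence[of "3 * K"]) auto
  moreover have "norm (\<Sum>i<n. a i *\<^sub>R x i) \<le> (3 * \<bar>C\<bar>) * sign_average n (\<lambda>i. a i *\<^sub>R x i)" for n a
  proof -
    have nonneg: "0 \<le> sign_average n z" for z :: "nat \<Rightarrow> 'a"
      unfolding sign_average_def by (intro divide_nonneg_nonneg sum_nonneg) simp_all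
    have "norm (\<Sum>i<n. a i *\<^sub>R x i) \<le> 3/2 * norm (\<Sum>i<n. a i *\<^sub>R y i)" by (rule xy)
    also have "\<dots> \<le> 3/2 * (C * sign_average n (\<lambda>i. a i *\<^sub>R y i))" by (intro mult_left_mono C) simp
    also have "\<dots> \<le> 3/2 * (\<bar>C\<bar> * sign_average n (\<lambda>i. a i *\<^sub>R y i))"
      using nonneg by (intro mult_left_mono mult_right_mono) auto
    also have "\<dots> \<le> 3/2 * (\<bar>C\<bar> * (2 * sign_average n (\<lambda>i. a i *\<^sub>R x i)))"
      using yx by (intro mult_left_mono sign_average_mono) auto
    finally show ?thesis by simp
  qed
  ultimately show ?thesis unfolding RUD_def by blast
qed

text \<open>
  The gliding hump. The coordinates of \<open>x n\<close> tend to \<open>0\<close> because coordinate functionals are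
  continuous. So after the first \<open>P\<close> basis vectors have been used, some later \<open>x n\<close> of norm at
  least \<open>\<delta>\<close> has a negligible part on them, and its expansion can be cut off at some \<open>q > P\<close>.
\<close>
lemma Bessaga_Pelczynski_selection:
  fixes e :: "nat \<Rightarrow> 'a::banach"
  assumes pb: "projection_bound K e" and K: "0 \<le> K" and nz: "\<And>n. e n \<noteq> 0"
    and dense: "closure (span (range e)) = UNIV"
    and x: "weakly_null x" "\<not> x \<longlonglongrightarrow> 0" 
    and \<theta>: "\<And>k. 0 < \<theta> k" "\<And>k. \<theta> k \<le> 1"
  obtains r p :: "nat \<Rightarrow> nat" and c :: "nat \<Rightarrow> nat \<Rightarrow> real"
  where "strict_mono r" "strict_mono p"
    "\<And>k. (\<Sum>j=p k..<p (Suc k). c k j *\<^sub>R e j) \<noteq> 0"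
    "\<And>k. norm (x (r k) - (\<Sum>j=p k..<p (Suc k). c k j *\<^sub>R e j)) 
        \<le> \<theta> k * norm (\<Sum>j=p k..<p (Suc k). c k j *\<^sub>R e j)"
proof -
  obtain c :: "nat \<Rightarrow> 'a \<Rightarrow> real" 
    where c: "\<And>v. (\<lambda>n. c n v *\<^sub>R e n) sums v" "\<And>n. bounded_linear (c n)"
    using coordinate_functionals[OF pb K nz dense] by metis
  obtain \<delta> where \<delta>: "\<delta> > 0" and large: "\<And>N. \<exists>n\<ge>N. norm (x n) \<ge> \<delta>"
  proof -
    have "\<not> (\<forall>\<delta>>0. \<exists>N. \<forall>n\<ge>N. norm (x n - 0) < \<delta>)" using x(2) unfolding LIMSEQ_iff .
    then show ?thesis using that by (simp add: not_less) blast
  qed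
  define y where "y n P q = (\<Sum>j=P..<q. c j (x n) *\<^sub>R e j)" for n P q
  define good where "good k n P q \<longleftrightarrow> P < q \<and> norm (x n) \<ge> \<delta> \<and> norm (x n - y n P q) < \<theta> k * \<delta> / 2" 
    for k n P q
  have step: "\<exists>n q. n > N \<and> good k n P q" for k N P
  proof -
    have \<eta>: "\<theta> k * \<delta> / 4 > 0" using \<theta>(1)[of k] \<delta> by simp
    have "(\<lambda>n. c j (x n)) \<longlonglongrightarrow> 0" for j
      using x(1) c(2) unfolding weakly_null_def by blast
    then have lim: "(\<lambda>n. \<Sum>j<P. c j (x n) *\<^sub>R e j) \<longlonglongrightarrow> (\<Sum>j<P. 0 *\<^sub>R e j)"
      by (intro tendsto_intros)
    obtain N' where N': "\<And>n. n \<ge> N' \<Longrightarrow> norm (\<Sum>j<P. c j (x n) *\<^sub>R e j) < \<theta> k * \<delta> / 4"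
      using LIMSEQ_D[OF lim \<eta>] by auto
    obtain n where n: "n \<ge> max (Suc N) N'" "norm (x n) \<ge> \<delta>" using large by blast
    obtain Q where Q: "\<And>q. q \<ge> Q \<Longrightarrow> norm ((\<Sum>j<q. c j (x n) *\<^sub>R e j) - x n) < \<theta> k * \<delta> / 4"
      using LIMSEQ_D[OF c(1)[of "x n", unfolded sums_def] \<eta>] by blast
    define q where "q = max Q (Suc P)"
    have split: "{..<q} = {..<P} \<union> {P..<q}" by (auto simp: q_def)
    have "(\<Sum>j<q. c j (x n) *\<^sub>R e j) = (\<Sum>j<P. c j (x n) *\<^sub>R e j) + y n P q"
      unfolding y_def split by (rule sum.union_disjoint) auto
    then have "x n - y n P q = (\<Sum>j<P. c j (x n) *\<^sub>R e j) - ((\<Sum>j<q. c j (x n) *\<^sub>R e j) - x n)" by simp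
    also have "norm \<dots> \<le> norm (\<Sum>j<P. c j (x n) *\<^sub>R e j) + norm ((\<Sum>j<q. c j (x n) *\<^sub>R e j) - x n)"
      by (rule norm_triangle_ineq4)
    also have "\<dots> < \<theta> k * \<delta> / 2" using N'[of n] Q[of q] n by (simp add: q_def)
    finally have "good k n P q" using n by (simp add: good_def q_def)
    then show ?thesis using n by (intro exI[of _ n] exI[of _ q]) auto
  qed
  have "\<exists>s. \<forall>k. (case s k of (n, P, q) \<Rightarrow> good k n P q) \<and>
      (case (s k, s (Suc k)) of ((n, P, q), (n', P', q')) \<Rightarrow> n < n' \<and> P' = q)"
  proof (rule dependent_nat_choice)
    show "\<exists>s. case s of (n, P, q) \<Rightarrow> good 0 n P q" using step[of 0 0 0] by auto
    fix s :: "nat \<times> nat \<times> nat" and k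
    obtain n P q where s: "s = (n, P, q)" by (cases s)
    obtain n' q' where "n' > n" "good (Suc k) n' q q'" using step by blast
    then show "\<exists>s'. (case s' of (n, P, q) \<Rightarrow> good (Suc k) n P q) \<and> 
       (case (s, s') of ((n, P, q), (n', P', q')) \<Rightarrow> n < n' \<and> P' = q)"
      using s by (intro exI[of _ "(n', q, q')"]) auto
  qed
  then obtain s where s: "\<And>k. (case s k of (n, P, q) \<Rightarrow> good k n P q) \<and>
      (case (s k, s (Suc k)) of ((n, P, q), (n', P', q')) \<Rightarrow> n < n' \<and> P' = q)" by blast
  define r where "r k = fst (s k)" for k
  define p where "p k = fst (snd (s k))" for k
  have rp: "r k < r (Suc k)" "good k (r k) (p k) (p (Suc k))" for k
    using s[of k] by (auto simp: r_def p_def split: prod.splits)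
  have close: "norm (x (r k) - y (r k) (p k) (p (Suc k))) < \<theta> k * \<delta> / 2" 
    and lower: "\<delta> / 2 < norm (y (r k) (p k) (p (Suc k)))" for k
  proof -
    show 1: "norm (x (r k) - y (r k) (p k) (p (Suc k))) < \<theta> k * \<delta> / 2"
      using rp(2)[of k] by (simp add: good_def)
    have "\<theta> k * \<delta> \<le> 1 * \<delta>" using \<theta>(2)[of k] \<delta> by (intro mult_right_mono) auto
    then show "\<delta> / 2 < norm (y (r k) (p k) (p (Suc k)))"
      using 1 rp(2)[of k] norm_triangle_sub[of "x (r k)" "y (r k) (p k) (p (Suc k))"] by (simp add: good_def)
  qed
  show ?thesis
  proof (rule that[of r p "\<lambda>k j. c j (x (r k))"])
    show "strict_mono r" using rp(1) by (rule strict_monoI_Suc)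
    show "strict_mono p" using rp(2) by (intro strict_monoI_Suc) (simp add: good_def)
    show "(\<Sum>j=p k..<p (Suc k). c j (x (r k)) *\<^sub>R e j) \<noteq> 0" for k
      using lower[of k] \<delta> unfolding y_def by auto
    have "\<theta> k * (\<delta> / 2) \<le> \<theta> k * norm (y (r k) (p k) (p (Suc k)))" for k
      using lower[of k] \<theta>(1)[of k] by (intro mult_left_mono) auto
    then show "norm (x (r k) - (\<Sum>j=p k..<p (Suc k). c j (x (r k)) *\<^sub>R e j)) 
        \<le> \<theta> k * norm (\<Sum>j=p k..<p (Suc k). c j (x (r k)) *\<^sub>R e j)" for k
      using close[of k] unfolding y_def times_divide_eq_right by (meson less_le_trans less_imp_le)
  qed
qed

lemma weakly_null_RUD_subsequence:
  fixes e x :: "nat \<Rightarrow> 'a::banach"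
  assumes pb: "projection_bound K e" and K: "0 < K" and nz: "\<And>n. e n \<noteq> 0"
    and dense: "closure (span (range e)) = UNIV"
    and blocks: "\<And>(p::nat \<Rightarrow> nat) (c::nat \<Rightarrow> nat \<Rightarrow> real) y. strict_mono p \<Longrightarrow> 
        (\<And>k. y k = (\<Sum>j=p k..<p (Suc k). c k j *\<^sub>R e j)) \<Longrightarrow> (\<And>k. y k \<noteq> 0) \<Longrightarrow> RUD y"
    and x: "weakly_null x" "\<not> x \<longlonglongrightarrow> 0"
  shows "\<exists>r. strict_mono r \<and> RUD (x \<circ> r)"
proof -
  define \<theta> where "\<theta> k = min 1 (1 / (4 * K)) * (1/2) ^ Suc k" for k
  have m0: "0 < min 1 (1 / (4 * K))" "min 1 (1 / (4 * K)) \<le> 1" using K by auto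
  have \<theta>: "0 < \<theta> k" "\<theta> k \<le> 1" for k
    using m0 power_le_one[of "1/2::real" "Suc k"] unfolding \<theta>_def by (auto intro: mult_le_one simp del: power_Suc)
  have "4 * K * (\<Sum>k<n. \<theta> k) \<le> 1" for n
  proof -
    have "(\<Sum>k<n. (1/2::real) ^ Suc k) \<le> 1"
    proof -
      have "(\<Sum>k<n. (1/2::real) ^ Suc k) = 1 - (1/2) ^ n" by (induction n) auto
      then show ?thesis by simp
    qed
    then have "(\<Sum>k<n. \<theta> k) \<le> min 1 (1 / (4 * K))"
      using mult_left_mono[of "\<Sum>k<n. (1/2::real) ^ Suc k" 1 "min 1 (1 / (4 * K))"] m0
      unfolding \<theta>_def sum_distrib_left[symmetric] by simp
    also have "\<dots> \<le> 1 / (4 * K)" by simp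
    finally show ?thesis using K by (simp add: field_simps)
  qed
  note \<theta>_sum = this
  obtain r p :: "nat \<Rightarrow> nat" and c :: "nat \<Rightarrow> nat \<Rightarrow> real" where r: "strict_mono r" and p: "strict_mono p"
    and y: "\<And>k. (\<Sum>j=p k..<p (Suc k). c k j *\<^sub>R e j) \<noteq> 0"
    "\<And>k. norm (x (r k) - (\<Sum>j=p k..<p (Suc k). c k j *\<^sub>R e j)) 
        \<le> \<theta> k * norm (\<Sum>j=p k..<p (Suc k). c k j *\<^sub>R e j)"
    by (rule Bessaga_Pelczynski_selection[OF pb less_imp_le[OF K] nz dense x \<theta>]) (rule that)
  define z where "z k = (\<Sum>j=p k..<p (Suc k). c k j *\<^sub>R e j)" for k
  have pmono: "p k \<le> p (Suc k)" for k using p by (simp add: strict_mono_less_eq)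
  have "RUD (x \<circ> r)"
  proof (rule RUD_perturbation[where y = z and \<theta> = \<theta> and K = K])
    show "projection_bound K z"
      by (rule projection_bound_blocks[where p=p and q="\<lambda>k. p (Suc k)" and c=c, OF pb pmono order_refl z_def])
    show "RUD z" using y(1) by (intro blocks[OF p z_def]) (simp add: z_def)
    show "norm ((x \<circ> r) k - z k) \<le> \<theta> k * norm (z k)" for k using y(2)[of k] by (simp add: z_def)
    show "4 * K * sum \<theta> {..<n} \<le> 1" for n by (rule \<theta>_sum)
    show "0 \<le> K" using K by simp
    show "z k \<noteq> 0" for k using y(1)[of k] by (simp only: z_def not_False_eq_True)
    show "0 \<le> \<theta> k" for k using \<theta>(1)[of k] by linarith
  qed
  with r show ?thesis by blast
qed

section \<open>Integral functionals and order continuity\<close>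

context koethe_space
begin

lemma rep_measurable [measurable]: "rep x \<in> borel_measurable I01"
  using rep_integrable by (rule borel_measurable_integrable)

lemma represents_rep: "represents rep x (rep x)"
  by (simp add: represents_def)

lemma represents_cong:
  assumes "represents rep x f" "AE t in I01. f t = g t"
  shows "represents rep x g"
  using assms unfolding represents_def by eventually_elim simp

lemma represents_unique:
  assumes "represents rep x f" "represents rep y f"
  shows "x = y"
  using assms by (intro rep_inject) (auto simp: represents_def elim: eventually_elim2)

lemma class_of_eq:
  assumes "represents rep x f"
  shows "class_of rep f = x"
  unfolding class_of_def by (rule the_equality[where a=x]) (use assms represents_unique in blast)+

lemma represents_add:
  assumes "represents rep x f" "represents rep y g"
  shows "represents rep (x + y) (\<lambda>t. f t + g t)"
  using rep_add[of x y] assms unfolding represents_def by eventually_elim simp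

lemma represents_scaleR:
  assumes "represents rep x f"
  shows "represents rep (c *\<^sub>R x) (\<lambda>t. c * f t)"
  using rep_scaleR[of c x] assms unfolding represents_def by eventually_elim simp

lemma represents_diff:
  assumes "represents rep x f" "represents rep y g"
  shows "represents rep (x - y) (\<lambda>t. f t - g t)"
  using represents_add[OF assms(1) represents_scaleR[OF assms(2), of "-1"]] by simp

lemma represents_zero: "represents rep 0 (\<lambda>t. 0)"
  using represents_scaleR[OF represents_rep, of 0 0] by simp

lemma represents_sum:
  assumes "\<And>i. i \<in> A \<Longrightarrow> represents rep (x i) (f i)"
  shows "represents rep (\<Sum>i\<in>A. x i) (\<lambda>t. \<Sum>i\<in>A. f i t)"
  using assms by (induction A rule: infinite_finite_induct) (auto intro: represents_zero represents_add)

lemma norm_mono: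
  assumes "represents rep x f" "represents rep y g" "AE t in I01. \<bar>f t\<bar> \<le> \<bar>g t\<bar>"
  shows "norm x \<le> norm y"
proof -
  have "AE t in I01. \<bar>rep x t\<bar> \<le> \<bar>rep y t\<bar>"
    using assms unfolding represents_def by eventually_elim simp
  from solid[OF rep_measurable this]
  obtain z where z: "represents rep z (rep x)" "norm z \<le> norm y" by blast
  then show ?thesis using rep_inject[OF z(1)] by simp
qed

lemma represents_abs:
  obtains y where "represents rep y (\<lambda>t. \<bar>rep x t\<bar>)" "norm y = norm x"
proof -
  obtain y where y: "represents rep y (\<lambda>t. \<bar>rep x t\<bar>)" 
    using solid[of "\<lambda>t. \<bar>rep x t\<bar>" x] by auto
  have "norm y \<le> norm x" "norm x \<le> norm y"
    by (rule norm_mono[OF y represents_rep] norm_mono[OF represents_rep y]; simp)+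
  then show ?thesis using that y by simp
qed

definition restr :: "real set \<Rightarrow> 'a \<Rightarrow> 'a" where
  "restr A x = class_of rep (\<lambda>t. indicat_real A t * rep x t)"

lemma represents_restr:
  assumes "A \<in> sets I01"
  shows "represents rep (restr A x) (\<lambda>t. indicat_real A t * rep x t)"
proof -
  have "\<exists>y. represents rep y (\<lambda>t. indicat_real A t * rep x t) \<and> norm y \<le> norm x"
    using assms by (intro solid) (auto simp: indicator_def)
  then show ?thesis unfolding restr_def using class_of_eq by metis
qed

end

context ri_space
begin

lemma bounded_in_space:
  assumes "f \<in> borel_measurable I01" "AE t in I01. \<bar>f t\<bar> \<le> M"
  shows "represents rep (class_of rep f) f" "norm (class_of rep f) \<le> M"
  using Linfinity_norm_le[OF assms] class_of_eq by metis+

lemma L1_dist_le: "(\<integral>t. \<bar>rep x t - rep y t\<bar> \<partial>I01) \<le> norm (x - y)"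
proof -
  have "AE t in I01. rep (x - y) t = rep x t - rep y t"
    using represents_diff[OF represents_rep represents_rep] by (simp add: represents_def)
  then have "(\<integral>t. \<bar>rep x t - rep y t\<bar> \<partial>I01) = (\<integral>t. \<bar>rep (x - y) t\<bar> \<partial>I01)"
    by (intro integral_cong_AE) auto
  also have "\<dots> \<le> norm (x - y)" by (rule L1_norm_le)
  finally show ?thesis .
qed

text \<open>Norm convergence implies convergence in \<open>L\<^sub>1\<close>, so the positive cone is closed.\<close>
lemma nonneg_closed:
  assumes lim: "w \<longlonglongrightarrow> v" and nonneg: "\<And>n. AE t in I01. 0 \<le> rep (w n) t"
  shows "AE t in I01. 0 \<le> rep v t"
proof -
  define m where "m t = max 0 (- rep v t)" for t
  have int: "integrable I01 m" unfolding m_def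
    by (intro Bochner_Integration.integrable_max integrable_minus rep_integrable integrable_zero)
  have "(\<integral>t. m t \<partial>I01) \<le> norm (v - w n)" for n
  proof -
    have "(\<integral>t. m t \<partial>I01) \<le> (\<integral>t. \<bar>rep v t - rep (w n) t\<bar> \<partial>I01)"
    proof (rule integral_mono_AE[OF int])
      show "integrable I01 (\<lambda>t. \<bar>rep v t - rep (w n) t\<bar>)"
        by (intro integrable_abs Bochner_Integration.integrable_diff rep_integrable)
      show "AE t in I01. m t \<le> \<bar>rep v t - rep (w n) t\<bar>"
        using nonneg[of n] by eventually_elim (auto simp: m_def)
    qed
    also have "\<dots> \<le> norm (v - w n)" by (rule L1_dist_le)
    finally show ?thesis .
  qed
  moreover have "(\<lambda>n. norm (v - w n)) \<longlonglongrightarrow> norm (v - v)" by (intro tendsto_intros lim)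
  ultimately have "(\<integral>t. m t \<partial>I01) \<le> norm (v - v)" by (intro LIMSEQ_le_const) auto
  moreover have "0 \<le> (\<integral>t. m t \<partial>I01)" by (intro Bochner_Integration.integral_nonneg) (simp add: m_def)
  ultimately have int0: "(\<integral>t. m t \<partial>I01) = 0" by simp
  have "AE t in I01. 0 \<le> m t" by (simp add: m_def)
  from integral_nonneg_eq_0_iff_AE[OF int this] int0 have "AE t in I01. m t = 0" by blast
  then show ?thesis by eventually_elim (auto simp: m_def)
qed

lemma dual1_integrable: "g \<in> dual1 rep \<Longrightarrow> integrable I01 (\<lambda>t. rep x t * g t)"
  by (auto simp: dual1_def koethe_dual_def)

lemma dual1_measurable: "g \<in> dual1 rep \<Longrightarrow> g \<in> borel_measurable I01"
  by (auto simp: dual1_def koethe_dual_def)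

text \<open>
  If \<open>\<integral> z g\<close> were unbounded on the unit ball, choose \<open>z n\<close> there with \<open>\<bar>\<integral> z n g\<bar> > 4 ^ n\<close>. The
  element \<open>v = \<Sum>n. (1/2) ^ n * \<bar>z n\<bar>\<close> dominates all \<open>(1/2) ^ n * \<bar>z n\<bar>\<close>, so the integral of
  \<open>\<bar>v g\<bar>\<close> exceeds \<open>2 ^ n\<close> for all \<open>n\<close>, although \<open>g\<close> is in the Koethe dual.
\<close>
lemma dual1_functional_bounded:
  assumes g: "g \<in> dual1 rep"
  shows "\<exists>C. \<forall>z. norm z \<le> 1 \<longrightarrow> \<bar>\<integral>t. rep z t * g t \<partial>I01\<bar> \<le> C"
proof (rule ccontr)
  assume "\<not> ?thesis"
  then have "\<forall>C. \<exists>z. norm z \<le> 1 \<and> C < \<bar>\<integral>t. rep z t * g t \<partial>I01\<bar>" by (simp add: not_le)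
  then have "\<forall>n::nat. \<exists>z. norm z \<le> 1 \<and> 4 ^ n < \<bar>\<integral>t. rep z t * g t \<partial>I01\<bar>" by blast
  then obtain z where z: "\<And>n::nat. norm (z n) \<le> 1" "\<And>n. 4 ^ n < \<bar>\<integral>t. rep (z n) t * g t \<partial>I01\<bar>" by metis
  have "\<forall>n. \<exists>y. represents rep y (\<lambda>t. \<bar>rep (z n) t\<bar>) \<and> norm y = norm (z n)" using represents_abs by blast
  then obtain a where a: "\<And>n. represents rep (a n) (\<lambda>t. \<bar>rep (z n) t\<bar>)" "\<And>n. norm (a n) = norm (z n)" by metis
  define w where "w n = (1/2) ^ n *\<^sub>R a n" for n
  have w: "represents rep (w n) (\<lambda>t. (1/2) ^ n * \<bar>rep (z n) t\<bar>)" for n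
    unfolding w_def by (intro represents_scaleR a)
  have wnonneg: "AE t in I01. 0 \<le> rep (w n) t" for n
    using w[of n] unfolding represents_def by eventually_elim simp
  have "summable w"
  proof (rule summable_norm_cancel, rule summable_comparison_test')
    show "summable (\<lambda>n. (1/2::real) ^ n)" by simp
    show "norm (norm (w n)) \<le> (1/2) ^ n" if "n \<ge> 0" for n
      using z(1)[of n] by (simp add: w_def a power_divide divide_right_mono)
  qed
  then obtain v where v: "w sums v" by (auto simp: summable_def)
  have dom: "AE t in I01. rep (w n) t \<le> rep v t" for n
  proof -
    have "(\<lambda>m. \<Sum>k<m. w k) \<longlonglongrightarrow> v" using v by (simp add: sums_def)
    then have "(\<lambda>m. (\<Sum>k<m + Suc n. w k) - w n) \<longlonglongrightarrow> v - w n"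
      by (intro tendsto_intros LIMSEQ_ignore_initial_segment)
    moreover have "AE t in I01. 0 \<le> rep ((\<Sum>k<m + Suc n. w k) - w n) t" for m
    proof -
      have eq: "(\<Sum>k<m + Suc n. w k) - w n = (\<Sum>k\<in>{..<m + Suc n} - {n}. w k)"
        by (subst sum.remove[of _ n]) auto
      have "represents rep (\<Sum>k\<in>{..<m + Suc n} - {n}. w k) 
         (\<lambda>t. \<Sum>k\<in>{..<m + Suc n} - {n}. (1/2) ^ k * \<bar>rep (z k) t\<bar>)"
        by (intro represents_sum w)
      then show ?thesis unfolding eq represents_def
        by eventually_elim (simp add: sum_nonneg)
    qed
    ultimately have "AE t in I01. 0 \<le> rep (v - w n) t" by (rule nonneg_closed)
    then show ?thesis using represents_diff[OF represents_rep represents_rep, of v "w n"]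
      unfolding represents_def by eventually_elim simp
  qed
  define B where "B = (\<integral>t. \<bar>rep v t * g t\<bar> \<partial>I01)"
  have "2 ^ n < B" for n :: nat
  proof -
    have "4 ^ n < \<bar>\<integral>t. rep (z n) t * g t \<partial>I01\<bar>" by (rule z)
    also have "\<dots> \<le> (\<integral>t. \<bar>rep (z n) t * g t\<bar> \<partial>I01)" by (rule integral_abs_bound)
    also have "\<dots> \<le> (\<integral>t. 2 ^ n * \<bar>rep v t * g t\<bar> \<partial>I01)"
    proof (rule integral_mono_AE)
      show "AE t in I01. \<bar>rep (z n) t * g t\<bar> \<le> 2 ^ n * \<bar>rep v t * g t\<bar>"
        using dom[of n] w[of n] unfolding represents_def
      proof eventually_elim
        case (elim t)
        then have "\<bar>rep (z n) t\<bar> \<le> 2 ^ n * rep v t" by (simp add: power_divide field_simps)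
        also have "\<dots> \<le> 2 ^ n * \<bar>rep v t\<bar>" by simp
        finally show ?case using mult_right_mono[of "\<bar>rep (z n) t\<bar>" "2 ^ n * \<bar>rep v t\<bar>" "\<bar>g t\<bar>"]
          by (simp add: abs_mult mult.assoc)
      qed
    qed (auto intro!: dual1_integrable[OF g] integrable_mult_right)
    also have "\<dots> = 2 ^ n * B" by (simp add: B_def)
    finally have "(2::real) ^ n * 2 ^ n < 2 ^ n * B" by (simp flip: power_mult_distrib)
    then show ?thesis by simp
  qed
  moreover obtain n :: nat where "B < 2 ^ n" using real_arch_pow[of 2 B] by auto
  ultimately show False using less_asym by blast
qed

text \<open>
  The supremum in \<open>dual1_norm\<close> is over a bounded set by \<open>dual1_functional_bounded\<close>, so it is an
  upper bound and not a default value.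
\<close>
lemma dual1_ball_bound:
  assumes g: "g \<in> dual1 rep" and "dual1_norm rep g \<le> 1"
  shows "\<bar>\<integral>t. rep z t * g t \<partial>I01\<bar> \<le> norm z"
proof (cases "z = 0")
  case True
  have "(\<integral>t. rep 0 t * g t \<partial>I01) = (\<integral>t. 0 \<partial>I01)"
    using represents_zero dual1_measurable[OF g] unfolding represents_def
    by (intro integral_cong_AE) (auto elim: eventually_mono)
  then show ?thesis using True by simp
next
  case False
  define u where "u = (1 / norm z) *\<^sub>R z"
  have u: "norm u \<le> 1" using False by (simp add: u_def)
  obtain C where C: "\<And>z. norm z \<le> 1 \<Longrightarrow> \<bar>\<integral>t. rep z t * g t \<partial>I01\<bar> \<le> C"
    using dual1_functional_bounded[OF g] by blast
  have "\<bar>\<integral>t. rep u t * g t \<partial>I01\<bar> \<le> dual1_norm rep g"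
    unfolding dual1_norm_def dual_norm_def
    by (rule cSUP_upper) (use u C in \<open>auto intro!: bdd_aboveI2 simp: dist_norm\<close>)
  then have "\<bar>\<integral>t. rep u t * g t \<partial>I01\<bar> \<le> 1" using assms(2) by linarith
  moreover have "(\<integral>t. rep u t * g t \<partial>I01) = (\<integral>t. (1 / norm z) * (rep z t * g t) \<partial>I01)"
    using rep_scaleR[of "1 / norm z" z] dual1_measurable[OF g] unfolding u_def represents_def
    by (intro integral_cong_AE) (auto elim: eventually_mono)
  ultimately show ?thesis using False by (simp add: abs_mult divide_le_eq)
qed

lemma norming_functional:
  assumes "\<eta> < norm x"
  obtains g where "g \<in> dual1 rep" "\<eta> < \<bar>\<integral>t. rep x t * g t \<partial>I01\<bar>" 
    "\<And>z. \<bar>\<integral>t. rep z t * g t \<partial>I01\<bar> \<le> norm z"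
proof -
  let ?B = "{g \<in> dual1 rep. dual1_norm rep g \<le> 1}"
  have "(\<lambda>_. 0) \<in> ?B"
    by (auto simp: dual1_def koethe_dual_def dual1_norm_def dual_norm_def image_constant_conv)
  then have ne: "(\<lambda>f. \<bar>\<integral>t. f t * rep x t \<partial>I01\<bar>) ` ?B \<noteq> {}" by blast
  have "\<eta> < Sup ((\<lambda>f. \<bar>\<integral>t. f t * rep x t \<partial>I01\<bar>) ` ?B)"
    using assms norming[of x] by (simp add: dual2_norm_def dual_norm_def)
  from less_cSupD[OF ne this]
  obtain g where g: "g \<in> ?B" "\<eta> < \<bar>\<integral>t. g t * rep x t \<partial>I01\<bar>" by blast
  then show ?thesis using that[of g] dual1_ball_bound by (simp add: mult.commute)
qed

text \<open>
  A norming integral functional is continuous under dominated convergence, so norms cannot drop in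
  the limit.
\<close>
lemma restr_Fatou:
  assumes A: "\<And>n. A n \<in> sets I01" and null: "AE t in I01. eventually (\<lambda>n. t \<notin> A n) sequentially"
    and B: "B \<in> sets I01" and \<eta>: "\<eta> < norm (restr B x)"
  shows "eventually (\<lambda>m. \<eta> < norm (restr (B - A m) x)) sequentially"
proof -
  obtain g where g: "g \<in> dual1 rep" "\<eta> < \<bar>\<integral>t. rep (restr B x) t * g t \<partial>I01\<bar>" 
    "\<And>z. \<bar>\<integral>t. rep z t * g t \<partial>I01\<bar> \<le> norm z"
    using norming_functional[OF \<eta>] by blast
  note [measurable] = dual1_measurable[OF g(1)]
  have "(\<lambda>m. \<integral>t. rep (restr (B - A m) x) t * g t \<partial>I01) \<longlonglongrightarrow> (\<integral>t. rep (restr B x) t * g t \<partial>I01)"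
  proof (rule integral_dominated_convergence[where w = "\<lambda>t. \<bar>rep x t * g t\<bar>"])
    show "integrable I01 (\<lambda>t. \<bar>rep x t * g t\<bar>)" using dual1_integrable[OF g(1)] by simp
    have 1: "AE t in I01. \<forall>m. rep (restr (B - A m) x) t = indicat_real (B - A m) t * rep x t"
      unfolding AE_all_countable using represents_restr[of "B - A _" x] A B by (auto simp: represents_def)
    have 2: "AE t in I01. rep (restr B x) t = indicat_real B t * rep x t"
      using represents_restr[OF B] by (simp add: represents_def)
    show "AE t in I01. (\<lambda>m. rep (restr (B - A m) x) t * g t) \<longlonglongrightarrow> rep (restr B x) t * g t"
      using 1 2 null
    proof eventually_elim
      case (elim t)
      have "eventually (\<lambda>m. rep (restr (B - A m) x) t * g t = rep (restr B x) t * g t) sequentially"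
        using elim(3) by eventually_elim (use elim(1,2) in \<open>simp add: indicator_def\<close>)
      then show ?case by (rule tendsto_eventually)
    qed
    show "AE t in I01. norm (rep (restr (B - A m) x) t * g t) \<le> \<bar>rep x t * g t\<bar>" for m
      using 1 by eventually_elim (auto simp: indicator_def)
  qed auto
  then have "(\<lambda>m. \<bar>\<integral>t. rep (restr (B - A m) x) t * g t \<partial>I01\<bar>) \<longlonglongrightarrow> \<bar>\<integral>t. rep (restr B x) t * g t \<partial>I01\<bar>"
    by (rule tendsto_rabs)
  from order_tendstoD(1)[OF this g(2)] show ?thesis
    by eventually_elim (use g(3) less_le_trans in blast)
qed

end

text \<open>Each ball of radius \<open>\<delta> / 2\<close> contains a point of a countable dense set, and these balls are disjoint.\<close>
lemma countable_separated_family: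
  fixes f :: "'i \<Rightarrow> 'a::metric_space"
  assumes sep: "separable_space (euclidean :: 'a topology)" and "0 < \<delta>"
    and far: "\<And>i j. i \<noteq> j \<Longrightarrow> \<delta> \<le> dist (f i) (f j)"
  shows "countable (UNIV :: 'i set)"
proof -
  obtain Q :: "'a set" where Q: "countable Q" "closure Q = UNIV"
    using sep by (auto simp: separable_space_def)
  have "\<forall>i. \<exists>q\<in>Q. dist q (f i) < \<delta> / 2"
    using Q(2) \<open>0 < \<delta>\<close> by (metis UNIV_I closure_approachable half_gt_zero)
  then obtain q where q: "\<And>i. q i \<in> Q" "\<And>i. dist (q i) (f i) < \<delta> / 2" by metis
  have "inj q"
  proof (rule injI, rule ccontr)
    fix i j assume eq: "q i = q j" and "i \<noteq> j"
    have "dist (f i) (f j) \<le> dist (q i) (f i) + dist (q j) (f j)" 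
      using dist_triangle3[of "f i" "f j" "q i"] eq by simp
    also have "\<dots> < \<delta>" using q(2)[of i] q(2)[of j] by simp
    finally show False using far[OF \<open>i \<noteq> j\<close>] by simp
  qed
  moreover have "countable (range q)" using Q(1) by (rule countable_subset[rotated]) (use q(1) in blast)
  ultimately show ?thesis by (rule countable_image_inj_on[rotated])
qed

lemma uncountable_nat_sets: "uncountable (UNIV :: nat set set)"
proof
  assume "countable (UNIV :: nat set set)"
  then have "range (from_nat_into (UNIV :: nat set set)) = UNIV" by (intro range_from_nat_into) auto
  then show False using Cantors_theorem[of "UNIV :: nat set"] by (metis Pow_UNIV)
qed

locale separable_ri_space = ri_space rep for rep :: "'a::banach \<Rightarrow> real \<Rightarrow> real" +
  assumes separable: "separable_space (euclidean :: 'a topology)"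
begin

text \<open>
  Suppose that \<open>norm (restr (A n) x)\<close> stays above \<open>\<epsilon>\<close>. By the Fatou property there are indices
  \<open>m k\<close> such that the restrictions of \<open>x\<close> to the disjoint sets \<open>D k = A (m k) - A (m (Suc k))\<close> have
  norm above \<open>\<epsilon> / 2\<close>. The restrictions of \<open>x\<close> to \<open>\<Union>k\<in>M. D k\<close>, for \<open>M\<close> a set of natural
  numbers, are then uncountably many elements with mutual distance at least \<open>\<epsilon> / 2\<close>.
\<close>
lemma restr_vanishing:
  assumes A: "\<And>n. A n \<in> sets I01" and dec: "decseq A" 
    and null: "AE t in I01. eventually (\<lambda>n. t \<notin> A n) sequentially"
  shows "(\<lambda>n. norm (restr (A n) x)) \<longlonglongrightarrow> 0"
proof (rule ccontr)
  assume nlim: "\<not> ?thesis"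
  have restr_mono: "norm (restr B x) \<le> norm (restr C x)" if "B \<subseteq> C" "B \<in> sets I01" "C \<in> sets I01" for B C
    by (rule norm_mono[OF represents_restr represents_restr]) (use that in \<open>auto simp: indicator_def\<close>)
  obtain \<epsilon> where \<epsilon>: "\<epsilon> > 0" and "\<And>N. \<exists>n\<ge>N. \<epsilon> \<le> norm (restr (A n) x)"
    using nlim unfolding LIMSEQ_iff by (auto simp: not_less)
  then have large: "\<epsilon> \<le> norm (restr (A N) x)" for N
  proof -
    obtain n where n: "n \<ge> N" "\<epsilon> \<le> norm (restr (A n) x)"
      using \<open>\<And>N. \<exists>n\<ge>N. \<epsilon> \<le> norm (restr (A n) x)\<close> by blast
    then show ?thesis using restr_mono[OF decseqD[OF dec n(1)] A A] by linarith
  qed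
  have "\<exists>m. \<forall>k. m k < m (Suc k) \<and> \<epsilon> / 2 < norm (restr (A (m k) - A (m (Suc k))) x)"
  proof -
    have step: "\<exists>m'>m. \<epsilon> / 2 < norm (restr (A m - A m') x)" for m
    proof -
      have "\<epsilon> / 2 < norm (restr (A m) x)" using large[of m] \<epsilon> by linarith
      from eventually_conj[OF restr_Fatou[OF A null A this] eventually_gt_at_top[of m]]
      show ?thesis unfolding eventually_sequentially by blast
    qed
    have "\<exists>m. \<forall>k. True \<and> (m k < m (Suc k) \<and> \<epsilon> / 2 < norm (restr (A (m k) - A (m (Suc k))) x))"
      by (rule dependent_nat_choice) (use step in auto)
    then show ?thesis by simp
  qed
  then obtain m where m: "\<And>k. m k < m (Suc k)" "\<And>k. \<epsilon> / 2 < norm (restr (A (m k) - A (m (Suc k))) x)"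
    by blast
  have mm: "strict_mono m" using m(1) by (rule strict_monoI_Suc)
  define D where "D k = A (m k) - A (m (Suc k))" for k
  have D: "D k \<in> sets I01" for k using A by (auto simp: D_def)
  have disj: "D i \<inter> D j = {}" if "i < j" for i j
  proof -
    have "A (m j) \<subseteq> A (m (Suc i))" using that dec mm by (intro decseqD[OF dec]) (simp add: strict_mono_less_eq)
    then show ?thesis by (auto simp: D_def)
  qed
  have disj': "D i \<inter> D j = {}" if "i \<noteq> j" for i j
    using disj[of i j] disj[of j i] that by (cases i j rule: linorder_cases) auto
  define f where "f M = restr (\<Union>k\<in>M. D k) x" for M :: "nat set"
  have f: "represents rep (f M) (\<lambda>t. indicat_real (\<Union>k\<in>M. D k) t * rep x t)" for M
    unfolding f_def by (rule represents_restr) (use D in blast)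
  have far: "\<epsilon> / 2 \<le> norm (f M - f M')" if "k \<in> M" "k \<notin> M'" for k M M'
  proof -
    have "\<epsilon> / 2 \<le> norm (restr (D k) x)" using m(2)[of k] by (simp add: D_def)
    also have "\<dots> \<le> norm (f M - f M')"
    proof (rule norm_mono[OF represents_restr[OF D] represents_diff[OF f f]], rule AE_I2)
      fix t
      have "t \<notin> (\<Union>k\<in>M'. D k)" if "t \<in> D k"
      proof
        assume "t \<in> (\<Union>k\<in>M'. D k)"
        then obtain j where j: "j \<in> M'" "t \<in> D j" by blast
        then have "k \<noteq> j" using \<open>k \<notin> M'\<close> by blast
        from disj'[OF this] j that show False by blast
      qed
      then show "\<bar>indicat_real (D k) t * rep x t\<bar> \<le> 
          \<bar>indicat_real (\<Union>k\<in>M. D k) t * rep x t - indicat_real (\<Union>k\<in>M'. D k) t * rep x t\<bar>"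
        using \<open>k \<in> M\<close> by (auto simp: indicator_def)
    qed
    finally show ?thesis .
  qed
  have "countable (UNIV :: nat set set)"
  proof (rule countable_separated_family[OF separable, of "\<epsilon> / 2" f])
    fix M M' :: "nat set" assume "M \<noteq> M'"
    then obtain k where "k \<in> M \<and> k \<notin> M' \<or> k \<in> M' \<and> k \<notin> M" by blast
    then show "\<epsilon> / 2 \<le> dist (f M) (f M')"
      using far[of k M M'] far[of k M' M] by (auto simp: dist_norm norm_minus_commute)
  qed (use \<epsilon> in simp)
  then show False using uncountable_nat_sets by simp
qed

text \<open>
  Outside the set \<open>A N\<close> where some \<open>z k\<close> with \<open>k \<ge> N\<close> exceeds \<open>e / 2\<close>, the norm is controlled by that
  of the constant \<open>e / 2\<close>; on \<open>A N\<close> it is controlled by the restriction of \<open>x\<close>.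
\<close>
lemma order_continuous:
  assumes dom: "\<And>k. AE t in I01. \<bar>rep (z k) t\<bar> \<le> \<bar>rep x t\<bar>"
    and lim: "AE t in I01. (\<lambda>k. rep (z k) t) \<longlonglongrightarrow> 0"
  shows "z \<longlonglongrightarrow> 0"
proof (rule LIMSEQ_I)
  fix e :: real assume "0 < e"
  define A where "A n = (\<Union>k\<in>{n..}. {t \<in> space I01. e / 2 < \<bar>rep (z k) t\<bar>})" for n
  have A: "A n \<in> sets I01" for n unfolding A_def by (intro sets.countable_UN'') measurable
  have "decseq A" unfolding A_def by (intro decseq_SucI) force
  moreover have "AE t in I01. eventually (\<lambda>n. t \<notin> A n) sequentially"
    using lim
  proof eventually_elim
    case (elim t)
    obtain N where "\<And>n. n \<ge> N \<Longrightarrow> \<bar>rep (z n) t\<bar> < e / 2"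
      using LIMSEQ_D[OF elim, of "e/2"] \<open>0 < e\<close> by auto
    then have "\<bar>rep (z k) t\<bar> < e / 2" if "n \<ge> N" "k \<ge> n" for n k using that by simp
    then have "t \<notin> A n" if "n \<ge> N" for n
      using that unfolding A_def by (auto simp: not_less intro: less_imp_le)
    then show ?case unfolding eventually_sequentially by blast
  qed
  ultimately have "(\<lambda>n. norm (restr (A n) x)) \<longlonglongrightarrow> 0" using A by (intro restr_vanishing)
  then obtain N where N: "norm (restr (A N) x) < e / 2"
    using LIMSEQ_D[of "\<lambda>n. norm (restr (A n) x)" 0 "e/2"] \<open>0 < e\<close> by auto
  obtain c where c: "represents rep c (\<lambda>t. e / 2)" "norm c \<le> e / 2"
    using Linfinity_norm_le[of "\<lambda>t. e / 2" "e / 2"] \<open>0 < e\<close> by auto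
  obtain y where y: "represents rep y (\<lambda>t. \<bar>rep (restr (A N) x) t\<bar>)" "norm y = norm (restr (A N) x)"
    using represents_abs by blast
  have "norm (z k - 0) < e" if "k \<ge> N" for k
  proof -
    have "norm (z k) \<le> norm (c + y)"
    proof (rule norm_mono[OF represents_rep represents_add[OF c(1) y(1)]])
      show "AE t in I01. \<bar>rep (z k) t\<bar> \<le> \<bar>e / 2 + \<bar>rep (restr (A N) x) t\<bar>\<bar>"
        using dom[of k] represents_restr[OF A, of N x, unfolded represents_def] AE_space
      proof eventually_elim
        case (elim t)
        show ?case
        proof (cases "t \<in> A N")
          case True then show ?thesis using elim \<open>0 < e\<close> by simp
        next
          case False
          then have "\<bar>rep (z k) t\<bar> \<le> e / 2" using that elim(3) by (auto simp: A_def not_less)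
          then show ?thesis by simp
        qed
      qed
    qed
    also have "\<dots> \<le> norm c + norm y" by (rule norm_triangle_ineq)
    also have "\<dots> < e" using c(2) y(2) N by linarith
    finally show ?thesis by simp
  qed
  then show "\<exists>N. \<forall>k\<ge>N. norm (z k - 0) < e" by blast
qed

end

section \<open>Dyadic step functions\<close>

text \<open>
  The cells of level \<open>N\<close> are the intervals \<open>[i / 2 ^ N, (i + 1) / 2 ^ N)\<close> for \<open>i < 2 ^ N\<close>. The
  endpoint \<open>1\<close> of the unit interval has the extra index \<open>2 ^ N\<close>.
\<close>
definition cell_index :: "nat \<Rightarrow> real \<Rightarrow> nat" where
  "cell_index N t = nat \<lfloor>2 ^ N * t\<rfloor>"

definition step_fun :: "nat \<Rightarrow> (nat \<Rightarrow> real) \<Rightarrow> real \<Rightarrow> real" where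
  "step_fun N v t = v (cell_index N t)"

lemma cell_index_less:
  assumes "0 \<le> t" "t < 1"
  shows "cell_index N t < 2 ^ N"
proof -
  have "2 ^ N * t < 2 ^ N" using assms by simp
  then have "\<lfloor>2 ^ N * t\<rfloor> < 2 ^ N" by (simp add: floor_less_iff)
  then show ?thesis unfolding cell_index_def by (simp add: nat_less_iff assms(1))
qed

lemma cell_index_one: "cell_index N 1 = 2 ^ N"
proof -
  have "\<lfloor>2 ^ N * 1 :: real\<rfloor> = 2 ^ N" by simp
  then show ?thesis by (simp only: cell_index_def nat_power_eq nat_numeral)
qed

lemma cell_index_bounds:
  assumes "0 \<le> t"
  shows "real (cell_index N t) \<le> 2 ^ N * t" "2 ^ N * t < real (cell_index N t) + 1"
  using assms unfolding cell_index_def by (simp_all add: of_nat_nat)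

lemma cell_index_eqI:
  assumes "0 \<le> t" "real i \<le> 2 ^ N * t" "2 ^ N * t < real i + 1"
  shows "cell_index N t = i"
proof -
  have "\<lfloor>2 ^ N * t\<rfloor> = int i" using assms(2,3) by (intro floor_unique) auto
  then show ?thesis by (simp add: cell_index_def)
qed

lemma cell_index_Suc_div:
  assumes "0 \<le> t"
  shows "cell_index (Suc N) t div 2 = cell_index N t"
proof (rule cell_index_eqI[symmetric, OF assms])
  let ?j = "cell_index (Suc N) t"
  have "2 * (?j div 2) \<le> ?j" "?j \<le> 2 * (?j div 2) + 1" by auto
  then have "2 * real (?j div 2) \<le> real ?j" "real ?j \<le> 2 * real (?j div 2) + 1" by linarith+
  then show "real (?j div 2) \<le> 2 ^ N * t" "2 ^ N * t < real (?j div 2) + 1"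
    using cell_index_bounds[OF assms, of "Suc N"] by auto
qed

lemma AE_I01_neq: "AE t in I01. t \<noteq> a"
proof -
  have "AE t in lebesgue. t \<noteq> a" by (rule AE_completion[OF AE_lborel_singleton])
  then have "AE t in lebesgue. t \<in> {0..1} \<longrightarrow> t \<noteq> a" by eventually_elim simp
  then show ?thesis by (subst AE_restrict_space_iff) auto
qed

lemma AE_I01_half_open: "AE t in I01. 0 \<le> t \<and> t < 1"
  using AE_I01_neq[of 1] AE_space by eventually_elim auto

lemma borel_measurable_I01:
  assumes "f \<in> borel_measurable borel"
  shows "f \<in> borel_measurable I01"
  using assms by (intro measurable_restrict_space1 measurable_completion) simp

lemma measurable_cell_index: "cell_index N \<in> measurable borel (count_space UNIV)"
proof -
  have "(\<lambda>t::real. nat \<lfloor>2 ^ N * t\<rfloor>) \<in> measurable borel (count_space UNIV)" by measurable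
  then show ?thesis unfolding cell_index_def[abs_def] .
qed

lemma step_fun_measurable: "step_fun N v \<in> borel_measurable I01"
proof (rule borel_measurable_I01)
  show "step_fun N v \<in> borel_measurable borel"
    unfolding step_fun_def[abs_def] by (rule measurable_compose[OF measurable_cell_index]) simp
qed

text \<open>
  Translates the cell with index \<open>i\<close> onto the cell with index \<open>\<pi> i\<close>. A permutation of \<open>{..<2 ^ N}\<close> fixes
  \<open>2 ^ N\<close>, so the endpoint \<open>1\<close> stays in place.
\<close>
definition cell_shift :: "nat \<Rightarrow> (nat \<Rightarrow> nat) \<Rightarrow> real \<Rightarrow> real" where
  "cell_shift N \<pi> t = t + (real (\<pi> (cell_index N t)) - real (cell_index N t)) / 2 ^ N"

lemma cell_index_range: "t \<in> {0..1} \<Longrightarrow> cell_index N t \<le> 2 ^ N"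
  using cell_index_less[of t N] cell_index_one[of N] by (cases "t = 1") auto

lemma cell_shift_maps_cells:
  assumes \<pi>: "\<pi> permutes {..<2 ^ N}" and t: "t \<in> {0..1}"
  shows "cell_shift N \<pi> t \<in> {0..1}" "cell_index N (cell_shift N \<pi> t) = \<pi> (cell_index N t)"
proof -
  let ?i = "cell_index N t"
  have eq: "2 ^ N * cell_shift N \<pi> t = 2 ^ N * t - real ?i + real (\<pi> ?i)"
    by (simp add: cell_shift_def field_simps)
  have b: "real (\<pi> ?i) \<le> 2 ^ N * cell_shift N \<pi> t" "2 ^ N * cell_shift N \<pi> t < real (\<pi> ?i) + 1"
    using cell_index_bounds[of t N] t unfolding eq by auto
  have "2 ^ N * 0 \<le> 2 ^ N * cell_shift N \<pi> t" using b(1) by simp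
  then have nonneg: "0 \<le> cell_shift N \<pi> t"
    by (simp only: mult_le_cancel_left_pos zero_less_power zero_less_numeral)
  show "cell_index N (cell_shift N \<pi> t) = \<pi> ?i" by (rule cell_index_eqI[OF nonneg b])
  have "cell_shift N \<pi> t \<le> 1"
  proof (cases "t = 1")
    case True
    then have "?i = 2 ^ N" by (simp add: cell_index_one)
    then have "\<pi> ?i = ?i" using permutes_not_in[OF \<pi>, of ?i] by simp
    then show ?thesis using True by (simp add: cell_shift_def)
  next
    case False
    then have "?i < 2 ^ N" using t by (intro cell_index_less) auto
    then have "\<pi> ?i < 2 ^ N" using permutes_in_image[OF \<pi>, of ?i] by simp
    then have "real (\<pi> ?i) + 1 \<le> 2 ^ N" by (metis Suc_leI of_nat_Suc of_nat_le_iff of_nat_numeral of_nat_power add.commute)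
    then have "2 ^ N * cell_shift N \<pi> t \<le> 2 ^ N * 1" using b(2) by linarith
    then show ?thesis by (simp only: mult_le_cancel_left_pos zero_less_power zero_less_numeral)
  qed
  with nonneg show "cell_shift N \<pi> t \<in> {0..1}" by simp
qed

lemma cell_shift_inverse:
  assumes \<pi>: "\<pi> permutes {..<2 ^ N}" and t: "t \<in> {0..1}"
  shows "cell_shift N (inv \<pi>) (cell_shift N \<pi> t) = t"
proof -
  have "cell_shift N (inv \<pi>) (cell_shift N \<pi> t) = cell_shift N \<pi> t + 
      (real (inv \<pi> (\<pi> (cell_index N t))) - real (\<pi> (cell_index N t))) / 2 ^ N"
    unfolding cell_shift_def[of N "inv \<pi>"] cell_shift_maps_cells(2)[OF assms] ..
  then show ?thesis
    by (simp add: permutes_inverses[OF \<pi>] cell_shift_def diff_divide_distrib)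
qed

lemma emeasure_I01: "A \<subseteq> {0..1} \<Longrightarrow> emeasure I01 A = emeasure lebesgue A"
  by (rule emeasure_restrict_space) auto

lemma sets_I01: "A \<in> sets I01 \<longleftrightarrow> A \<in> sets lebesgue \<and> A \<subseteq> {0..1}"
  by (subst sets_restrict_space_iff) auto

text \<open>
  The preimage of \<open>A\<close> is a disjoint union of translates of the parts of \<open>A\<close> in the cells, and Lebesgue
  measure is translation invariant.
\<close>
lemma cell_shift_preimage:
  assumes \<pi>: "\<pi> permutes {..<2 ^ N}" and A: "A \<in> sets I01"
  shows "cell_shift N \<pi> -` A \<inter> {0..1} \<in> sets I01"
    and "emeasure I01 (cell_shift N \<pi> -` A \<inter> {0..1}) = emeasure I01 A"
proof -
  define s where "s i = (real (\<pi> i) - real i) / 2 ^ N" for i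
  define C where "C i = {t \<in> {0..1}. cell_index N t = i}" for i
  define B where "B i = (\<lambda>t. - s i + t) ` (A \<inter> C (\<pi> i))" for i
  have A': "A \<in> sets lebesgue" "A \<subseteq> {0..1}" using A by (auto simp: sets_I01)
  have \<pi>': "inv \<pi> permutes {..<2 ^ N}" using \<pi> by (rule permutes_inv)
  have "cell_index N -` {i} \<inter> space borel \<in> sets borel" for i
    by (rule measurable_sets[OF measurable_cell_index]) simp
  then have "C i \<in> sets borel" for i
    unfolding C_def using sets.Int[of "cell_index N -` {i}" borel "{0..1}"] 
    by (simp add: vimage_def Collect_conj_eq Int_commute)
  then have C: "C i \<in> sets lebesgue" for i using sets_completionI_sets by fastforce
  have B: "B i \<in> sets lebesgue" for i unfolding B_def
    by (intro lebesgue_sets_translation sets.Int A' C)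
  have emB: "emeasure lebesgue (B i) = emeasure lebesgue (A \<inter> C (\<pi> i))" for i
    using emeasure_lebesgue_affine[of 1 "- s i" "A \<inter> C (\<pi> i)"] by (simp add: B_def add.commute)
  have Beq: "B i = {t \<in> C i. cell_shift N \<pi> t \<in> A}" for i
  proof (intro set_eqI iffI)
    fix t assume "t \<in> B i"
    then obtain r where r: "r \<in> A" "r \<in> C (\<pi> i)" "t = - s i + r" by (auto simp: B_def)
    have "t = cell_shift N (inv \<pi>) r"
      using r by (simp add: cell_shift_def C_def s_def permutes_inverses[OF \<pi>] diff_divide_distrib)
    moreover have "r \<in> {0..1}" "cell_index N r = \<pi> i" using r by (auto simp: C_def)
    ultimately show "t \<in> {t \<in> C i. cell_shift N \<pi> t \<in> A}"
      using cell_shift_maps_cells[OF \<pi>', of r] cell_shift_inverse[OF \<pi>', of r] r(1)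
      by (simp add: C_def permutes_inverses[OF \<pi>] permutes_inv_inv[OF \<pi>])
  next
    fix t assume t: "t \<in> {t \<in> C i. cell_shift N \<pi> t \<in> A}"
    then have "cell_shift N \<pi> t \<in> A \<inter> C (\<pi> i)" using cell_shift_maps_cells[OF \<pi>, of t] by (auto simp: C_def)
    moreover have "t = - s i + cell_shift N \<pi> t" using t by (auto simp: cell_shift_def s_def C_def)
    ultimately show "t \<in> B i" unfolding B_def by blast
  qed
  have pre: "cell_shift N \<pi> -` A \<inter> {0..1} = (\<Union>i\<in>{..2 ^ N}. B i)"
    using cell_index_range[of _ N] by (auto simp: Beq C_def)
  then show "cell_shift N \<pi> -` A \<inter> {0..1} \<in> sets I01" using B by (auto simp: sets_I01)
  have "emeasure I01 (cell_shift N \<pi> -` A \<inter> {0..1}) = emeasure lebesgue (\<Union>i\<in>{..2 ^ N}. B i)"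
    unfolding pre[symmetric] by (rule emeasure_I01) simp
  also have "\<dots> = (\<Sum>i\<le>2 ^ N. emeasure lebesgue (B i))"
    using B by (intro sum_emeasure[symmetric]) (auto simp: disjoint_family_on_def Beq C_def)
  also have "\<dots> = (\<Sum>i\<le>2 ^ N. emeasure lebesgue (A \<inter> C (\<pi> i)))" by (simp add: emB)
  also have "\<dots> = (\<Sum>i\<le>2 ^ N. emeasure lebesgue (A \<inter> C i))"
  proof -
    have "\<pi> permutes {..2 ^ N}" by (rule permutes_subset[OF \<pi>]) auto
    from sum.permute[OF this, of "\<lambda>i. emeasure lebesgue (A \<inter> C i)"] show ?thesis by (simp add: comp_def)
  qed
  also have "\<dots> = emeasure lebesgue (\<Union>i\<in>{..2 ^ N}. A \<inter> C i)"
    using A' C by (intro sum_emeasure) (auto simp: disjoint_family_on_def C_def)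
  also have "(\<Union>i\<in>{..2 ^ N}. A \<inter> C i) = A"
    using A' cell_index_range[of _ N] by (auto simp: C_def)
  also have "emeasure lebesgue A = emeasure I01 A" using A' by (simp add: emeasure_I01)
  finally show "emeasure I01 (cell_shift N \<pi> -` A \<inter> {0..1}) = emeasure I01 A" .
qed

lemma automorphism_pair_cell_shift:
  assumes \<pi>: "\<pi> permutes {..<2 ^ N}"
  shows "automorphism_pair (cell_shift N (inv \<pi>)) (cell_shift N \<pi>)"
proof -
  have \<pi>': "inv \<pi> permutes {..<2 ^ N}" using \<pi> by (rule permutes_inv)
  have meas: "cell_shift N \<rho> \<in> measurable I01 I01" if "\<rho> permutes {..<2 ^ N}" for \<rho>
    using cell_shift_preimage(1)[OF that] cell_shift_maps_cells(1)[OF that] by (intro measurableI) auto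
  have "distr I01 I01 (cell_shift N (inv \<pi>)) = I01"
  proof (rule measure_eqI)
    fix A assume "A \<in> sets (distr I01 I01 (cell_shift N (inv \<pi>)))"
    then have A: "A \<in> sets I01" by simp
    show "emeasure (distr I01 I01 (cell_shift N (inv \<pi>))) A = emeasure I01 A"
      using emeasure_distr[OF meas[OF \<pi>'] A] cell_shift_preimage(2)[OF \<pi>' A] by simp
  qed simp
  then show ?thesis
    unfolding automorphism_pair_def
    using meas \<pi> \<pi>' cell_shift_inverse[OF \<pi>] cell_shift_inverse[OF \<pi>'] permutes_inv_inv[OF \<pi>] by auto
qed

lemma L1_dist_dilate_half:
  fixes f g :: "real \<Rightarrow> real"
  assumes "integrable I01 f" "integrable I01 g"
  shows "integrable I01 (dilate (1/2) f)"
    and "(\<integral>t. \<bar>dilate (1/2) f t - dilate (1/2) g t\<bar> \<partial>I01) = (\<integral>t. \<bar>f t - g t\<bar> \<partial>I01) / 2"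
proof -
  define F where "F f t = (if t \<in> {0..1} then f t else 0)" for f :: "real \<Rightarrow> real" and t
  have F: "indicator {0..1} t *\<^sub>R f t = F f t" for f t by (simp add: F_def)
  have Ff: "integrable lebesgue (F f)"
    using assms(1) by (subst (asm) integrable_restrict_space) (auto simp: F simp del: real_scaleR_def)
  have ind: "indicator {0..1} t *\<^sub>R dilate (1/2) f t = F f (0 + 2 * t)" for f t
    by (auto simp: F_def dilate_def indicator_def mult.commute)
  have "integrable lebesgue (\<lambda>t. F f (0 + 2 * t))"
    by (subst lebesgue_integrable_real_affine_iff) (simp_all add: Ff)
  then show "integrable I01 (dilate (1/2) f)"
    by (subst integrable_restrict_space) (auto simp: ind simp del: real_scaleR_def)
  have "(\<integral>t. \<bar>dilate (1/2) f t - dilate (1/2) g t\<bar> \<partial>I01) 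
      = (\<integral>t. indicator {0..1} t *\<^sub>R \<bar>dilate (1/2) f t - dilate (1/2) g t\<bar> \<partial>lebesgue)"
    by (subst integral_restrict_space) auto
  also have "\<dots> = (\<integral>t. F (\<lambda>t. \<bar>f t - g t\<bar>) (0 + 2 * t) \<partial>lebesgue)"
    by (intro Bochner_Integration.integral_cong) (auto simp: F_def dilate_def indicator_def mult.commute)
  also have "\<dots> = (\<integral>t. F (\<lambda>t. \<bar>f t - g t\<bar>) t \<partial>lebesgue) / 2"
    using lebesgue_integral_real_affine[of 2 "F (\<lambda>t. \<bar>f t - g t\<bar>)" 0] by simp
  also have "(\<integral>t. F (\<lambda>t. \<bar>f t - g t\<bar>) t \<partial>lebesgue) = (\<integral>t. \<bar>f t - g t\<bar> \<partial>I01)"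
    by (subst integral_restrict_space) (simp_all only: F[of _ "\<lambda>t. \<bar>f t - g t\<bar>"], simp)
  finally show "(\<integral>t. \<bar>dilate (1/2) f t - dilate (1/2) g t\<bar> \<partial>I01) = (\<integral>t. \<bar>f t - g t\<bar> \<partial>I01) / 2" .
qed

lemma AE_eq_if_L1_dist_0:
  fixes f g :: "real \<Rightarrow> real"
  assumes "integrable I01 f" "integrable I01 g" "(\<integral>t. \<bar>f t - g t\<bar> \<partial>I01) \<le> 0"
  shows "AE t in I01. f t = g t"
proof -
  have int: "integrable I01 (\<lambda>t. \<bar>f t - g t\<bar>)"
    by (intro integrable_abs Bochner_Integration.integrable_diff assms)
  have "0 \<le> (\<integral>t. \<bar>f t - g t\<bar> \<partial>I01)" by (intro Bochner_Integration.integral_nonneg) simp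
  with assms(3) have "(\<integral>t. \<bar>f t - g t\<bar> \<partial>I01) = 0" by simp
  moreover have "AE t in I01. 0 \<le> \<bar>f t - g t\<bar>" by simp
  ultimately have "AE t in I01. \<bar>f t - g t\<bar> = 0" using integral_nonneg_eq_0_iff_AE[OF int] by blast
  then show ?thesis by eventually_elim simp
qed

lemma step_fun_uniform_approximation:
  assumes "continuous_on UNIV g" "0 < e"
  shows "\<exists>N v. \<forall>t\<in>{0..1}. \<bar>step_fun N v t - g t\<bar> < e"
proof -
  have "uniformly_continuous_on {0..1} g"
    using assms(1) by (intro compact_uniformly_continuous) (auto intro: continuous_on_subset)
  then obtain d where d: "d > 0" "\<And>s t. s \<in> {0..1} \<Longrightarrow> t \<in> {0..1} \<Longrightarrow> dist s t < d \<Longrightarrow> dist (g s) (g t) < e"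
    using assms(2) unfolding uniformly_continuous_on_def by metis
  obtain N :: nat where "(1/2) ^ N < d" using real_arch_pow_inv[of d "1/2"] d(1) by auto
  then have N: "1 / 2 ^ N < d" by (simp add: power_divide)
  have "\<bar>step_fun N (\<lambda>i. g (real i / 2 ^ N)) t - g t\<bar> < e" if t: "t \<in> {0..1}" for t
  proof -
    let ?s = "real (cell_index N t) / 2 ^ N"
    have b: "real (cell_index N t) \<le> 2 ^ N * t" "2 ^ N * t < real (cell_index N t) + 1"
      using cell_index_bounds[of t N] t by auto
    then have le: "?s \<le> t" "t < ?s + 1 / 2 ^ N" by (simp_all add: field_simps)
    have "dist ?s t < d" using le N by (simp add: dist_real_def)
    moreover have "0 \<le> ?s" by simp
    then have "?s \<in> {0..1}" using le(1) t unfolding atLeastAtMost_iff by linarith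
    ultimately have "dist (g ?s) (g t) < e" using d(2) t by blast
    then show ?thesis by (simp add: step_fun_def dist_real_def)
  qed
  then show ?thesis by blast
qed

text \<open>
  A Lebesgue measurable function is an almost everywhere limit of continuous functions, and these are
  uniformly approximated by step functions.
\<close>
lemma measurable_AE_limit_step_funs:
  assumes "f \<in> borel_measurable I01"
  obtains N v where "AE t in I01. (\<lambda>n. step_fun (N n) (v n) t) \<longlonglongrightarrow> f t"
proof -
  have "f measurable_on {0..1}" using assms by (subst measurable_on_iff_borel_measurable) auto
  then obtain Z g where Z: "negligible Z" and g: "\<And>n. continuous_on UNIV (g n)"
    "\<And>t. t \<notin> Z \<Longrightarrow> (\<lambda>n. g n t) \<longlonglongrightarrow> (if t \<in> {0..1} then f t else 0)"
    unfolding measurable_on_def by blast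
  have "\<forall>n. \<exists>N v. \<forall>t\<in>{0..1}. \<bar>step_fun N v t - g n t\<bar> < 1 / real (Suc n)"
    using step_fun_uniform_approximation[OF g(1)] by simp
  then obtain N v where Nv: "\<And>n t. t \<in> {0..1} \<Longrightarrow> \<bar>step_fun (N n) (v n) t - g n t\<bar> < 1 / real (Suc n)"
    by metis
  have "AE t in lebesgue. t \<in> {0..1} \<longrightarrow> t \<notin> Z"
    using Z AE_not_in[of Z lebesgue] by (auto simp: negligible_iff_null_sets elim: eventually_mono)
  then have "AE t in I01. t \<notin> Z" by (subst AE_restrict_space_iff) auto
  then have "AE t in I01. (\<lambda>n. step_fun (N n) (v n) t) \<longlonglongrightarrow> f t"
    using AE_space
  proof eventually_elim
    case (elim t)
    then have t: "t \<in> {0..1}" by simp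
    have "(\<lambda>n. step_fun (N n) (v n) t - g n t) \<longlonglongrightarrow> 0"
    proof (rule Lim_null_comparison)
      show "eventually (\<lambda>n. norm (step_fun (N n) (v n) t - g n t) \<le> 1 / real (Suc n)) sequentially"
        using Nv[OF t] by (intro always_eventually) (auto intro: less_imp_le)
      show "(\<lambda>n. 1 / real (Suc n)) \<longlonglongrightarrow> 0" by (rule LIMSEQ_Suc[OF lim_1_over_n])
    qed
    from tendsto_add[OF this g(2)[OF elim(1)]] show ?case using t by simp
  qed
  then show ?thesis using that by blast
qed

context ri_space
begin

definition stepv :: "nat \<Rightarrow> (nat \<Rightarrow> real) \<Rightarrow> 'a" where
  "stepv N v = class_of rep (step_fun N v)"

lemma represents_stepv: "represents rep (stepv N v) (step_fun N v)"
  unfolding stepv_def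
proof (rule bounded_in_space(1)[OF step_fun_measurable])
  show "AE t in I01. \<bar>step_fun N v t\<bar> \<le> (\<Sum>i<2^N. \<bar>v i\<bar>)"
    using AE_I01_half_open
  proof eventually_elim
    case (elim t)
    then show ?case unfolding step_fun_def using cell_index_less[of t N] 
      by (intro member_le_sum[of _ _ "\<lambda>i. \<bar>v i\<bar>"]) auto
  qed
qed

lemma stepv_eqI:
  assumes "represents rep x f" "AE t in I01. f t = step_fun N v t"
  shows "x = stepv N v"
  using represents_unique[OF represents_cong[OF assms] represents_stepv] .

lemma stepv_cong: 
  assumes "\<And>i. i < 2 ^ N \<Longrightarrow> v i = w i"
  shows "stepv N v = stepv N w"
  by (rule stepv_eqI[OF represents_stepv]) 
    (use AE_I01_half_open in eventually_elim, auto simp: step_fun_def cell_index_less assms)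

lemma stepv_add: "stepv N (\<lambda>i. v i + w i) = stepv N v + stepv N w"
  by (rule stepv_eqI[OF represents_add[OF represents_stepv represents_stepv], symmetric]) (simp add: step_fun_def)

lemma stepv_diff: "stepv N (\<lambda>i. v i - w i) = stepv N v - stepv N w"
  by (rule stepv_eqI[OF represents_diff[OF represents_stepv represents_stepv], symmetric]) (simp add: step_fun_def)

lemma stepv_scaleR: "stepv N (\<lambda>i. c * v i) = c *\<^sub>R stepv N v"
  by (rule stepv_eqI[OF represents_scaleR[OF represents_stepv], symmetric]) (simp add: step_fun_def)

lemma stepv_sum: "stepv N (\<lambda>i. \<Sum>k\<in>A. v k i) = (\<Sum>k\<in>A. stepv N (v k))"
  by (rule stepv_eqI[OF represents_sum[OF represents_stepv], symmetric]) (simp add: step_fun_def)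

lemma norm_stepv_mono:
  assumes "\<And>i. i < 2 ^ N \<Longrightarrow> \<bar>v i\<bar> \<le> \<bar>w i\<bar>"
  shows "norm (stepv N v) \<le> norm (stepv N w)"
  by (rule norm_mono[OF represents_stepv represents_stepv])
    (use AE_I01_half_open in eventually_elim, auto simp: step_fun_def cell_index_less assms)

lemma stepv_refine: "stepv N v = stepv (Suc N) (\<lambda>i. v (i div 2))"
  by (rule stepv_eqI[OF represents_stepv])
    (use AE_I01_half_open in eventually_elim, auto simp: step_fun_def cell_index_Suc_div)

lemma stepv_refine_exists: "N \<le> M \<Longrightarrow> \<exists>w. stepv N v = stepv M w"
proof (induction M rule: dec_induct)
  case (step M)
  then show ?case using stepv_refine by metis
qed blast

lemma norm_stepv_permute:
  assumes \<pi>: "\<pi> permutes {..<2 ^ N}"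
  shows "norm (stepv N (\<lambda>i. v (\<pi> i))) = norm (stepv N v)"
proof (rule rearrangement_norm[OF automorphism_pair_cell_shift[OF \<pi>] represents_stepv])
  show "represents rep (stepv N (\<lambda>i. v (\<pi> i))) (\<lambda>t. step_fun N v (cell_shift N \<pi> t))"
  proof (rule represents_cong[OF represents_stepv])
    show "AE t in I01. step_fun N (\<lambda>i. v (\<pi> i)) t = step_fun N v (cell_shift N \<pi> t)"
      using AE_space by eventually_elim (simp add: step_fun_def cell_shift_maps_cells(2)[OF \<pi>])
  qed
qed

lemma dilation_stepv: 
  "represents rep (stepv (Suc N) (\<lambda>i. if i < 2 ^ N then v i else 0)) (dilate (1/2) (rep (stepv N v)))"
proof -
  let ?w = "\<lambda>i. if i < 2 ^ N then v i else 0"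
  have "integrable I01 (step_fun N v)"
    using rep_integrable[of "stepv N v"] represents_stepv[of N v] step_fun_measurable[of N v]
    by (subst integrable_cong_AE[of _ _ "rep (stepv N v)"]) (auto simp: represents_def elim: eventually_mono)
  note int = this rep_integrable[of "stepv N v"]
  have "(\<integral>t. \<bar>step_fun N v t - rep (stepv N v) t\<bar> \<partial>I01) = (\<integral>t. 0 \<partial>I01)"
    using represents_stepv[of N v] step_fun_measurable[of N v] unfolding represents_def
    by (intro integral_cong_AE) (auto elim: eventually_mono)
  then have "AE t in I01. dilate (1/2) (step_fun N v) t = dilate (1/2) (rep (stepv N v)) t"
    using L1_dist_dilate_half(2)[OF int] by (intro AE_eq_if_L1_dist_0 L1_dist_dilate_half(1)[OF int] 
        L1_dist_dilate_half(1)[OF int(2,1)]) simp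
  moreover have "AE t in I01. step_fun (Suc N) ?w t = dilate (1/2) (step_fun N v) t"
    using AE_I01_half_open AE_I01_neq[of "1/2"]
  proof eventually_elim
    case (elim t)
    have c: "cell_index (Suc N) t = cell_index N (2 * t)" by (simp add: cell_index_def mult_ac)
    show ?case
    proof (cases "t < 1/2")
      case True
      then show ?thesis using cell_index_less[of "2 * t" N] elim c by (simp add: step_fun_def dilate_def mult.commute)
    next
      case False
      then have "1/2 \<le> t" by simp
      then have "2 ^ N \<le> 2 ^ N * (2 * t)" by simp
      then have "2 ^ N \<le> cell_index N (2 * t)" unfolding cell_index_def by (simp add: le_nat_iff le_floor_iff)
      then show ?thesis using elim c False by (simp add: step_fun_def dilate_def)
    qed
  qed
  ultimately have "AE t in I01. step_fun (Suc N) ?w t = dilate (1/2) (rep (stepv N v)) t"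
    by eventually_elim simp
  then show ?thesis by (rule represents_cong[OF represents_stepv])
qed

text \<open>
  The dilated function is \<open>v\<close> on \<open>2 ^ N\<close> cells of half the length followed by zeros. A permutation of the
  finer cells turns it into \<open>v 0, 0, v 1, 0, ...\<close>, which is dominated by \<open>v 0, v 0, v 1, v 1, ...\<close>, and
  this is \<open>v\<close> itself on the finer level.
\<close>
lemma norm_dilation_stepv_le:
  "norm (stepv (Suc N) (\<lambda>i. if i < 2 ^ N then v i else 0)) \<le> norm (stepv N v)"
proof -
  define n :: nat where "n = 2 ^ N"
  define \<pi> where "\<pi> j = (if j < 2 * n then (if even j then j div 2 else n + j div 2) else j)" for j
  define \<pi>' where "\<pi>' i = (if i < n then 2 * i else 2 * (i - n) + 1)" for i
  have "bij_betw \<pi> {..<2 * n} {..<2 * n}"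
    by (rule bij_betw_byWitness[where f' = \<pi>']) (auto simp: \<pi>_def \<pi>'_def elim!: oddE)
  then have "\<pi> permutes {..<2 * n}" by (rule bij_imp_permutes) (simp add: \<pi>_def)
  then have \<pi>: "\<pi> permutes {..<2 ^ Suc N}" by (simp add: n_def)
  have "norm (stepv (Suc N) (\<lambda>i. if i < 2 ^ N then v i else 0))
     = norm (stepv (Suc N) (\<lambda>i. if \<pi> i < 2 ^ N then v (\<pi> i) else 0))"
    by (rule norm_stepv_permute[OF \<pi>, symmetric])
  also have "\<dots> \<le> norm (stepv (Suc N) (\<lambda>i. v (i div 2)))"
  proof (rule norm_stepv_mono)
    fix i :: nat assume "i < 2 ^ Suc N"
    then have "\<pi> i = (if even i then i div 2 else n + i div 2)" by (simp add: \<pi>_def n_def)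
    then show "\<bar>if \<pi> i < 2 ^ N then v (\<pi> i) else 0\<bar> \<le> \<bar>v (i div 2)\<bar>" by (simp add: n_def)
  qed
  also have "\<dots> = norm (stepv N v)" by (simp only: stepv_refine[symmetric])
  finally show ?thesis .
qed

lemma norming_linear_functional:
  assumes "\<eta> < norm x"
  obtains \<phi> :: "'a \<Rightarrow> real" where "linear \<phi>" "\<eta> < \<bar>\<phi> x\<bar>" "\<And>z. \<bar>\<phi> z\<bar> \<le> norm z"
proof -
  obtain g where g: "g \<in> dual1 rep" "\<eta> < \<bar>\<integral>t. rep x t * g t \<partial>I01\<bar>" 
    "\<And>z. \<bar>\<integral>t. rep z t * g t \<partial>I01\<bar> \<le> norm z"
    using norming_functional[OF assms] by blast
  note [measurable] = dual1_measurable[OF g(1)]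
  have "linear (\<lambda>z. \<integral>t. rep z t * g t \<partial>I01)"
  proof (rule linearI)
    fix u v :: 'a and c :: real
    have "(\<integral>t. rep (u + v) t * g t \<partial>I01) = (\<integral>t. rep u t * g t + rep v t * g t \<partial>I01)"
      using rep_add[of u v] unfolding represents_def
      by (intro integral_cong_AE) (auto elim!: eventually_mono simp: algebra_simps)
    also have "\<dots> = (\<integral>t. rep u t * g t \<partial>I01) + (\<integral>t. rep v t * g t \<partial>I01)"
      by (intro Bochner_Integration.integral_add dual1_integrable[OF g(1)])
    finally show "(\<integral>t. rep (u + v) t * g t \<partial>I01) = (\<integral>t. rep u t * g t \<partial>I01) + (\<integral>t. rep v t * g t \<partial>I01)" .
    have "(\<integral>t. rep (c *\<^sub>R u) t * g t \<partial>I01) = (\<integral>t. c * (rep u t * g t) \<partial>I01)"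
      using rep_scaleR[of c u] unfolding represents_def
      by (intro integral_cong_AE) (auto elim!: eventually_mono)
    then show "(\<integral>t. rep (c *\<^sub>R u) t * g t \<partial>I01) = c *\<^sub>R (\<integral>t. rep u t * g t \<partial>I01)" by simp
  qed
  then show ?thesis using that g by blast
qed

text \<open>On step functions of a fixed level a norming functional is given by finitely many coefficients.\<close>
lemma norming_step_coefficients:
  assumes "\<eta> < norm (stepv N u)"
  obtains \<gamma> where "\<eta> < \<bar>\<Sum>i<2^N. u i * \<gamma> i\<bar>" "\<And>v. \<bar>\<Sum>i<2^N. v i * \<gamma> i\<bar> \<le> norm (stepv N v)"
proof -
  obtain \<phi> :: "'a \<Rightarrow> real" where \<phi>: "linear \<phi>" "\<eta> < \<bar>\<phi> (stepv N u)\<bar>" "\<And>z. \<bar>\<phi> z\<bar> \<le> norm z"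
    using norming_linear_functional[OF assms] by blast
  define \<gamma> where "\<gamma> k = \<phi> (stepv N (\<lambda>i. if i = k then 1 else 0))" for k
  have eq: "\<phi> (stepv N v) = (\<Sum>k<2^N. v k * \<gamma> k)" for v
  proof -
    have "stepv N v = stepv N (\<lambda>i. \<Sum>k<2^N. v k * (if i = k then 1 else 0))"
      by (rule stepv_cong) (simp add: if_distrib cong: if_cong)
    also have "\<dots> = (\<Sum>k<2^N. v k *\<^sub>R stepv N (\<lambda>i. if i = k then 1 else 0))"
      by (simp only: stepv_sum stepv_scaleR)
    finally show ?thesis by (simp add: linear_sum[OF \<phi>(1)] linear_scale[OF \<phi>(1)] \<gamma>_def)
  qed
  show ?thesis
    by (rule that[of \<gamma>]) (use \<phi>(2,3) in \<open>simp_all only: eq[symmetric]\<close>)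
qed

text \<open>
  Choose norming coefficients \<open>\<gamma>\<close> for \<open>u\<close> and rearrange the cells so that \<open>\<bar>\<gamma>\<bar>\<close> is decreasing.
  By \<open>garsia_submajorization\<close>, every initial segment of the rearranged \<open>u\<close> has a sum at most that of the
  sequence \<open>w\<close> composed of the dilation of \<open>u\<^sup>*\<close> and of \<open>2 * K * S\<^sup>*\<close>. So \<open>\<Sum>i. u i * \<gamma> i\<close> is at
  most the norm of \<open>w\<close>.
\<close>
lemma norm_le_of_garsia:
  assumes N: "0 < N" and K: "0 \<le> K" and u: "\<And>i. 0 \<le> u i" and S: "\<And>i. 0 \<le> S i"
    and garsia: "\<And>\<theta>. 0 \<le> \<theta> \<Longrightarrow> 
      (\<Sum>i<2^N. max 0 (u i - \<theta>)) \<le> K * sum S {i\<in>{..<2^N}. u i > \<theta>}"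
    and dil: "\<And>v. norm (stepv (Suc N) (\<lambda>i. if i < 2 ^ N then v i else 0)) \<le> r * norm (stepv N v)"
  shows "norm (stepv N u) \<le> r * norm (stepv N u) + 2 * K * norm (stepv N S)"
proof (rule dense_le)
  fix \<eta> assume "\<eta> < norm (stepv N u)"
  then obtain \<gamma> where \<gamma>: "\<eta> < \<bar>\<Sum>i<2^N. u i * \<gamma> i\<bar>" 
    "\<And>v. \<bar>\<Sum>i<2^N. v i * \<gamma> i\<bar> \<le> norm (stepv N v)"
    using norming_step_coefficients by blast
  define n :: nat where "n = 2 ^ N"
  have n: "even n" using N by (simp add: n_def)
  obtain \<pi> where \<pi>: "\<pi> permutes {..<n}" "\<And>i j. i \<le> j \<Longrightarrow> j < n \<Longrightarrow> u (\<pi> j) \<le> u (\<pi> i)"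
    using decreasing_rearrangement[of n u] by blast
  obtain \<rho> where \<rho>: "\<rho> permutes {..<n}" "\<And>i j. i \<le> j \<Longrightarrow> j < n \<Longrightarrow> S (\<rho> j) \<le> S (\<rho> i)"
    using decreasing_rearrangement[of n S] by blast
  obtain \<kappa> where \<kappa>: "\<kappa> permutes {..<n}" "\<And>i j. i \<le> j \<Longrightarrow> j < n \<Longrightarrow> \<bar>\<gamma> (\<kappa> j)\<bar> \<le> \<bar>\<gamma> (\<kappa> i)\<bar>"
    using decreasing_rearrangement[of n "\<lambda>i. \<bar>\<gamma> i\<bar>"] by blast
  have \<kappa>': "inv \<kappa> permutes {..<n}" using \<kappa>(1) by (rule permutes_inv)
  define w\<^sub>1 where "w\<^sub>1 i = (if 2 * i + 1 < n then u (\<pi> (2 * i + 1)) else 0)" for i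
  define w where "w i = w\<^sub>1 i + 2 * K * S (\<rho> i)" for i
  have "\<eta> < \<bar>\<Sum>i<n. u i * \<gamma> i\<bar>" using \<gamma>(1) by (simp add: n_def)
  also have "\<dots> \<le> (\<Sum>i<n. \<bar>u i * \<gamma> i\<bar>)" by (rule sum_abs)
  also have "\<dots> = (\<Sum>i<n. u i * \<bar>\<gamma> i\<bar>)" using u by (simp add: abs_mult)
  also have "\<dots> = (\<Sum>i<n. u (\<kappa> i) * \<bar>\<gamma> (\<kappa> i)\<bar>)"
    using sum.permute[OF \<kappa>(1), of "\<lambda>i. u i * \<bar>\<gamma> i\<bar>"] by (simp add: comp_def)
  also have "\<dots> \<le> (\<Sum>i<n. w i * \<bar>\<gamma> (\<kappa> i)\<bar>)"
  proof (rule sum_mult_decreasing_mono)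
    fix k assume "k \<le> n"
    have inj: "inj_on \<kappa> {..<k}" using permutes_inj_on[OF \<kappa>(1)] .
    have "sum u (\<kappa> ` {..<k}) \<le> (\<Sum>i<k. (if 2 * i + 1 < n then u (\<pi> (2 * i + 1)) else 0) + 2 * K * S (\<rho> i))"
    proof (rule garsia_submajorization[where u = u and S = S and \<pi> = \<pi> and \<rho> = \<rho>, OF n K u S _ \<pi> \<rho>])
      show "(\<Sum>i<n. max 0 (u i - \<theta>)) \<le> K * sum S {i \<in> {..<n}. \<theta> < u i}" if "0 \<le> \<theta>" for \<theta>
        using garsia[OF that] by (simp add: n_def)
      show "\<kappa> ` {..<k} \<subseteq> {..<n}" using permutes_image[OF \<kappa>(1)] \<open>k \<le> n\<close> by auto
      show "card (\<kappa> ` {..<k}) = k" using card_image[OF inj] by simp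
    qed
    then show "(\<Sum>i<k. u (\<kappa> i)) \<le> sum w {..<k}"
      using sum.reindex[OF inj, of u] by (simp add: comp_def w_def w\<^sub>1_def)
  qed (use \<kappa>(2) in auto)
  also have "\<dots> = (\<Sum>i<n. w (inv \<kappa> i) * \<bar>\<gamma> i\<bar>)"
    using sum.permute[OF \<kappa>(1), of "\<lambda>i. w (inv \<kappa> i) * \<bar>\<gamma> i\<bar>"]
    by (simp add: comp_def permutes_inverses[OF \<kappa>(1)])
  also have "\<dots> = (\<Sum>i<n. (w (inv \<kappa> i) * sgn (\<gamma> i)) * \<gamma> i)"
    by (simp add: mult.assoc sgn_mult_self_eq abs_sgn mult.commute[of "sgn _"])
  also have "\<dots> \<le> norm (stepv N (\<lambda>i. w (inv \<kappa> i) * sgn (\<gamma> i)))"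
    using \<gamma>(2)[of "\<lambda>i. w (inv \<kappa> i) * sgn (\<gamma> i)"] by (simp add: n_def)
  also have "\<dots> \<le> norm (stepv N (\<lambda>i. w (inv \<kappa> i)))"
    by (rule norm_stepv_mono) (auto simp: abs_mult abs_sgn_eq)
  also have "\<dots> = norm (stepv N w)"
    using \<kappa>' by (intro norm_stepv_permute) (simp add: n_def)
  also have "\<dots> \<le> norm (stepv N w\<^sub>1) + norm ((2 * K) *\<^sub>R stepv N (\<lambda>i. S (\<rho> i)))"
    unfolding w_def stepv_add stepv_scaleR by (rule norm_triangle_ineq)
  also have "norm ((2 * K) *\<^sub>R stepv N (\<lambda>i. S (\<rho> i))) = 2 * K * norm (stepv N S)"
    using norm_stepv_permute[of \<rho> N S] \<rho>(1) K by (simp add: n_def)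
  also have "norm (stepv N w\<^sub>1) \<le> r * norm (stepv N u)"
  proof -
    have "norm (stepv N w\<^sub>1) = norm (stepv (Suc N) (\<lambda>i. w\<^sub>1 (i div 2)))"
      by (rule arg_cong[OF stepv_refine])
    also have "\<dots> \<le> norm (stepv (Suc N) (\<lambda>i. if i < 2 ^ N then u (\<pi> i) else 0))"
    proof (rule norm_stepv_mono)
      fix i :: nat
      show "\<bar>w\<^sub>1 (i div 2)\<bar> \<le> \<bar>if i < 2 ^ N then u (\<pi> i) else 0\<bar>"
      proof (cases "2 * (i div 2) + 1 < n")
        case True
        then have "i < n" by linarith
        then show ?thesis using True \<pi>(2)[of i "2 * (i div 2) + 1"] u by (simp add: w\<^sub>1_def n_def)
      qed (simp add: w\<^sub>1_def)
    qed
    also have "\<dots> \<le> r * norm (stepv N (\<lambda>i. u (\<pi> i)))" by (rule dil)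
    also have "norm (stepv N (\<lambda>i. u (\<pi> i))) = norm (stepv N u)"
      using \<pi>(1) by (intro norm_stepv_permute) (simp add: n_def)
    finally show ?thesis .
  qed
  finally show "\<eta> \<le> r * norm (stepv N u) + 2 * K * norm (stepv N S)" by simp
qed

end

context separable_ri_space
begin

lemma bounded_approximation:
  assumes "0 < e"
  obtains b and K :: nat where "norm (x - b) < e" "AE t in I01. \<bar>rep b t\<bar> \<le> K"
proof -
  define B where "B k = {t \<in> space I01. \<bar>rep x t\<bar> \<le> real k}" for k
  have B: "B k \<in> sets I01" for k unfolding B_def by measurable
  define z where "z k = x - restr (B k) x" for k
  have z: "represents rep (z k) (\<lambda>t. rep x t - indicat_real (B k) t * rep x t)" for k
    unfolding z_def by (intro represents_diff represents_rep represents_restr B)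
  have "z \<longlonglongrightarrow> 0"
  proof (rule order_continuous)
    show "AE t in I01. \<bar>rep (z k) t\<bar> \<le> \<bar>rep x t\<bar>" for k
      using z[of k] unfolding represents_def by eventually_elim (auto simp: indicator_def)
    have "AE t in I01. \<forall>k. rep (z k) t = rep x t - indicat_real (B k) t * rep x t"
      unfolding AE_all_countable using z by (auto simp: represents_def)
    then show "AE t in I01. (\<lambda>k. rep (z k) t) \<longlonglongrightarrow> 0"
      using AE_space
    proof eventually_elim
      case (elim t)
      obtain k0 :: nat where k0: "\<bar>rep x t\<bar> \<le> real k0" using real_arch_simple by blast
      have "rep (z k) t = 0" if "k \<ge> k0" for k
        using elim that k0 by (auto simp: B_def)
      then have "eventually (\<lambda>k. rep (z k) t = 0) sequentially" unfolding eventually_sequentially by blast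
      then show ?case by (rule tendsto_eventually)
    qed
  qed
  then obtain K where K: "norm (z K) < e" using LIMSEQ_D[of z 0 e] \<open>0 < e\<close> by auto
  have "AE t in I01. \<bar>rep (restr (B K) x) t\<bar> \<le> K"
    using represents_restr[OF B, of K x] unfolding represents_def by eventually_elim (auto simp: B_def indicator_def)
  then show ?thesis using that K unfolding z_def by blast
qed

text \<open>
  Truncation reduces to a bounded element, which is an almost everywhere limit of uniformly bounded step
  functions. Both reductions are instances of order continuity.
\<close>
lemma stepv_dense:
  assumes "0 < e"
  shows "\<exists>N v. norm (x - stepv N v) < e"
proof -
  obtain b and K :: nat where b: "norm (x - b) < e / 2" and K: "AE t in I01. \<bar>rep b t\<bar> \<le> K"
    using bounded_approximation[of "e/2" x] \<open>0 < e\<close> by auto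
  obtain N v where lim: "AE t in I01. (\<lambda>n. step_fun (N n) (v n) t) \<longlonglongrightarrow> rep b t"
    using measurable_AE_limit_step_funs[OF rep_measurable] by blast
  define v' where "v' n i = max (- real K) (min (real K) (v n i))" for n i
  have v': "\<bar>step_fun (N n) (v' n) t\<bar> \<le> K" for n t by (auto simp: step_fun_def v'_def)
  define z where "z n = b - stepv (N n) (v' n)" for n
  have z: "represents rep (z n) (\<lambda>t. rep b t - step_fun (N n) (v' n) t)" for n
    unfolding z_def by (intro represents_diff represents_rep represents_stepv)
  obtain c where c: "represents rep c (\<lambda>t. 2 * real K)"
    using Linfinity_norm_le[of "\<lambda>t. 2 * real K" "2 * real K"] by auto
  have "z \<longlonglongrightarrow> 0"
  proof (rule order_continuous)
    show "AE t in I01. \<bar>rep (z n) t\<bar> \<le> \<bar>rep c t\<bar>" for n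
      using z[of n] c K unfolding represents_def
    proof eventually_elim
      case (elim t)
      then show ?case using v'[of n t] by simp
    qed
    have "AE t in I01. \<forall>n. rep (z n) t = rep b t - step_fun (N n) (v' n) t"
      unfolding AE_all_countable using z by (auto simp: represents_def)
    then show "AE t in I01. (\<lambda>n. rep (z n) t) \<longlonglongrightarrow> 0"
      using lim K
    proof eventually_elim
      case (elim t)
      have "(\<lambda>n. max (- real K) (min (real K) (step_fun (N n) (v n) t))) 
         \<longlonglongrightarrow> max (- real K) (min (real K) (rep b t))"
        by (intro tendsto_intros elim)
      then have "(\<lambda>n. step_fun (N n) (v' n) t) \<longlonglongrightarrow> rep b t"
        using elim(3) by (simp add: step_fun_def v'_def max_def min_def split: if_splits)
      then have "(\<lambda>n. rep b t - step_fun (N n) (v' n) t) \<longlonglongrightarrow> rep b t - rep b t"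
        by (intro tendsto_intros)
      then show ?case using elim(1) by simp
    qed
  qed
  then obtain n where "norm (z n) < e / 2" using LIMSEQ_D[of z 0 "e/2"] \<open>0 < e\<close> by auto
  then have "norm (x - stepv (N n) (v' n)) < e"
    using b norm_triangle_ineq[of "x - b" "z n"] by (simp add: z_def)
  then show ?thesis by blast
qed

text \<open>
  The operator \<open>dilation\<close> is given by a description operator, so it is not clear beforehand that the dilated function
  belongs to the space. The dilation is a contraction on step functions, hence extends by density, and
  convergence in \<open>L\<^sub>1\<close> identifies the extension.
\<close>
lemma dilation_represents:
  "represents rep (dilation rep (1/2) x) (dilate (1/2) (rep x))"
  "norm (dilation rep (1/2) x) \<le> norm x"
proof -
  have "\<forall>m::nat. \<exists>N v. norm (x - stepv N v) < (1/2) ^ m" using stepv_dense by simp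
  then obtain N v where Nv: "\<And>m. norm (x - stepv (N m) (v m)) < (1/2) ^ m" by metis
  define X where "X m = stepv (N m) (v m)" for m
  define Y where "Y m = stepv (Suc (N m)) (\<lambda>i. if i < 2 ^ N m then v m i else 0)" for m
  have Y: "represents rep (Y m) (dilate (1/2) (rep (X m)))" for m
    unfolding Y_def X_def by (rule dilation_stepv)
  have X: "X \<longlonglongrightarrow> x"
  proof (rule Lim_transform_bound[of _ "\<lambda>m. (1/2::real) ^ m", THEN LIM_zero_cancel])
    show "eventually (\<lambda>m. norm (X m - x) \<le> norm ((1/2::real) ^ m)) sequentially"
      using Nv by (intro always_eventually) (auto simp: X_def norm_minus_commute less_imp_le)
    show "(\<lambda>m. (1/2::real) ^ m) \<longlonglongrightarrow> 0" by (rule LIMSEQ_power_zero) simp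
  qed
  have YX: "norm (Y m - Y k) \<le> norm (X m - X k)" for m k
  proof -
    define M where "M = max (N m) (N k)"
    obtain a where a: "X m = stepv M a" using stepv_refine_exists[of "N m" M "v m"] by (auto simp: M_def X_def)
    obtain b where b: "X k = stepv M b" using stepv_refine_exists[of "N k" M "v k"] by (auto simp: M_def X_def)
    have "Y m = stepv (Suc M) (\<lambda>i. if i < 2 ^ M then a i else 0)" 
      using represents_unique[OF Y[of m, unfolded a] dilation_stepv] .
    moreover have "Y k = stepv (Suc M) (\<lambda>i. if i < 2 ^ M then b i else 0)" 
      using represents_unique[OF Y[of k, unfolded b] dilation_stepv] .
    ultimately have "Y m - Y k = stepv (Suc M) (\<lambda>i. if i < 2 ^ M then a i - b i else 0)"
      by (simp add: stepv_diff[symmetric] if_distrib cong: if_cong)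
    then have "norm (Y m - Y k) \<le> norm (stepv M (\<lambda>i. a i - b i))"
      by (simp only: norm_dilation_stepv_le)
    then show ?thesis by (simp add: stepv_diff a b)
  qed
  have "Cauchy Y"
  proof (rule metric_CauchyI)
    fix e :: real assume "0 < e"
    then obtain M where "\<And>m n. m \<ge> M \<Longrightarrow> n \<ge> M \<Longrightarrow> dist (X m) (X n) < e"
      using metric_CauchyD[OF LIMSEQ_imp_Cauchy[OF X]] by blast
    then show "\<exists>M. \<forall>m\<ge>M. \<forall>n\<ge>M. dist (Y m) (Y n) < e"
      using YX unfolding dist_norm by (meson le_less_trans)
  qed
  then obtain y where y: "Y \<longlonglongrightarrow> y" using Cauchy_convergent convergent_def by metis
  have int: "integrable I01 (dilate (1/2) (rep x))" by (rule L1_dist_dilate_half(1)[OF rep_integrable rep_integrable])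
  have "(\<integral>t. \<bar>rep y t - dilate (1/2) (rep x) t\<bar> \<partial>I01) \<le> 0"
  proof (rule LIMSEQ_le_const)
    show "(\<lambda>m. norm (y - Y m) + norm (X m - x) / 2) \<longlonglongrightarrow> 0"
    proof -
      have "(\<lambda>m. norm (y - Y m) + norm (X m - x) / 2) \<longlonglongrightarrow> norm (y - y) + norm (x - x) / 2"
        by (intro tendsto_intros X y) simp
      then show ?thesis by simp
    qed
    have "(\<integral>t. \<bar>rep y t - dilate (1/2) (rep x) t\<bar> \<partial>I01) \<le> norm (y - Y m) + norm (X m - x) / 2" for m
    proof -
      have "(\<integral>t. \<bar>rep y t - dilate (1/2) (rep x) t\<bar> \<partial>I01) 
         \<le> (\<integral>t. \<bar>rep y t - rep (Y m) t\<bar> + \<bar>dilate (1/2) (rep (X m)) t - dilate (1/2) (rep x) t\<bar> \<partial>I01)"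
      proof (rule integral_mono_AE)
        show "AE t in I01. \<bar>rep y t - dilate (1/2) (rep x) t\<bar> 
           \<le> \<bar>rep y t - rep (Y m) t\<bar> + \<bar>dilate (1/2) (rep (X m)) t - dilate (1/2) (rep x) t\<bar>"
          using Y[of m] unfolding represents_def by eventually_elim simp
      qed (intro integrable_abs Bochner_Integration.integrable_diff Bochner_Integration.integrable_add rep_integrable int
          L1_dist_dilate_half(1)[OF rep_integrable rep_integrable])+
      also have "\<dots> = (\<integral>t. \<bar>rep y t - rep (Y m) t\<bar> \<partial>I01) + 
          (\<integral>t. \<bar>dilate (1/2) (rep (X m)) t - dilate (1/2) (rep x) t\<bar> \<partial>I01)"
        by (intro Bochner_Integration.integral_add integrable_abs Bochner_Integration.integrable_diff rep_integrable int
          L1_dist_dilate_half(1)[OF rep_integrable rep_integrable])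
      also have "\<dots> \<le> norm (y - Y m) + norm (X m - x) / 2"
        unfolding L1_dist_dilate_half(2)[OF rep_integrable rep_integrable]
        by (intro add_mono divide_right_mono L1_dist_le) simp
      finally show ?thesis .
    qed
    then show "\<exists>M. \<forall>m\<ge>M. (\<integral>t. \<bar>rep y t - dilate (1/2) (rep x) t\<bar> \<partial>I01) \<le> norm (y - Y m) + norm (X m - x) / 2"
      by blast
  qed
  then have rep: "represents rep y (dilate (1/2) (rep x))"
    unfolding represents_def by (rule AE_eq_if_L1_dist_0[OF rep_integrable int])
  then have eq: "dilation rep (1/2) x = y" unfolding dilation_def by (rule class_of_eq)
  show "represents rep (dilation rep (1/2) x) (dilate (1/2) (rep x))" using rep eq by simp
  have "norm y \<le> norm x"
  proof (rule LIMSEQ_le)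
    show "(\<lambda>m. norm (Y m)) \<longlonglongrightarrow> norm y" by (intro tendsto_intros y)
    show "(\<lambda>m. norm (X m)) \<longlonglongrightarrow> norm x" by (intro tendsto_intros X)
    show "\<exists>M. \<forall>m\<ge>M. norm (Y m) \<le> norm (X m)"
      unfolding X_def Y_def using norm_dilation_stepv_le by blast
  qed
  then show "norm (dilation rep (1/2) x) \<le> norm x" using eq by simp
qed

lemma bounded_linear_dilation: "bounded_linear (dilation rep (1/2))"
proof (rule bounded_linear_intro[where K = 1])
  fix x y :: 'a and c :: real
  let ?D = "dilate (1/2)"
  have AE_dilate: "AE t in I01. ?D (rep z) t = ?D f t" if "represents rep z f" "integrable I01 f" for z f
  proof (rule AE_eq_if_L1_dist_0)
    have "(\<integral>t. \<bar>rep z t - f t\<bar> \<partial>I01) = (\<integral>t. 0 \<partial>I01)"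
      using that unfolding represents_def by (intro integral_cong_AE) (auto elim: eventually_mono)
    then show "(\<integral>t. \<bar>?D (rep z) t - ?D f t\<bar> \<partial>I01) \<le> 0"
      unfolding L1_dist_dilate_half(2)[OF rep_integrable that(2)] by simp
  qed (intro L1_dist_dilate_half(1)[OF rep_integrable rep_integrable] L1_dist_dilate_half(1)[OF that(2) that(2)])+
  show "dilation rep (1/2) (x + y) = dilation rep (1/2) x + dilation rep (1/2) y"
  proof (rule represents_unique)
    show "represents rep (dilation rep (1/2) x + dilation rep (1/2) y) (\<lambda>t. ?D (rep x) t + ?D (rep y) t)"
      by (intro represents_add dilation_represents)
    have "AE t in I01. ?D (rep (x + y)) t = ?D (\<lambda>t. rep x t + rep y t) t"
      by (rule AE_dilate[OF rep_add]) (intro Bochner_Integration.integrable_add rep_integrable)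
    then show "represents rep (dilation rep (1/2) (x + y)) (\<lambda>t. ?D (rep x) t + ?D (rep y) t)"
      by (intro represents_cong[OF dilation_represents(1)]) (auto simp: dilate_def)
  qed
  show "dilation rep (1/2) (c *\<^sub>R x) = c *\<^sub>R dilation rep (1/2) x"
  proof (rule represents_unique)
    show "represents rep (c *\<^sub>R dilation rep (1/2) x) (\<lambda>t. c * ?D (rep x) t)"
      by (intro represents_scaleR dilation_represents)
    have "AE t in I01. ?D (rep (c *\<^sub>R x)) t = ?D (\<lambda>t. c * rep x t) t"
      by (rule AE_dilate[OF rep_scaleR]) (intro integrable_mult_right rep_integrable)
    then show "represents rep (dilation rep (1/2) (c *\<^sub>R x)) (\<lambda>t. c * ?D (rep x) t)"
      by (intro represents_cong[OF dilation_represents(1)]) (auto simp: dilate_def if_distrib)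
  qed
  show "norm (dilation rep (1/2) x) \<le> norm x * 1" using dilation_represents(2) by simp
qed

text \<open>
  The upper Boyd index is \<open>\<infinity>\<close> if some dilation with \<open>0 < s < 1\<close> has norm \<open>1\<close>. So a
  finite index excludes the value \<open>1\<close> for \<open>s = 1/2\<close>.
\<close>
lemma dilation_contraction:
  assumes "upper_boyd_index rep < \<infinity>"
  obtains r where "r < 1" "\<And>N v. norm (stepv (Suc N) (\<lambda>i. if i < 2 ^ N then v i else 0)) \<le> r * norm (stepv N v)"
proof -
  let ?r = "onorm (dilation rep (1/2))"
  have "?r \<noteq> 1"
  proof
    assume "?r = 1"
    then have "\<exists>s\<in>{0<..<1}. onorm (dilation rep s) = 1" by (intro bexI[of _ "1/2"]) auto
    then show False using assms by (simp add: upper_boyd_index_def)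
  qed
  moreover have "?r \<le> 1" by (rule onorm_bound) (simp_all add: dilation_represents(2))
  ultimately have "?r < 1" by simp
  moreover have "norm (stepv (Suc N) (\<lambda>i. if i < 2 ^ N then v i else 0)) \<le> ?r * norm (stepv N v)" for N v
    using onorm[OF bounded_linear_dilation, of "stepv N v"] 
      represents_unique[OF dilation_represents(1) dilation_stepv, of N v] by simp
  ultimately show ?thesis using that by blast
qed

end

section \<open>The Haar functions\<close>

text \<open>The value of \<open>haar j\<close> on the cell with index \<open>i\<close> of level \<open>N\<close>, for \<open>1 \<le> j \<le> 2 ^ N\<close>.\<close>
definition haar_cell :: "nat \<Rightarrow> nat \<Rightarrow> nat \<Rightarrow> real" where
  "haar_cell N j i =
     (if j \<le> 1 then 1
      else let k = floor_log (j - 1); r = j - 1 - 2 ^ k; m = i div 2 ^ (N - Suc k) in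
        if m = 2 * r then 1 else if m = 2 * r + 1 then -1 else 0)"

lemma haar_cell_dyadic:
  assumes "2 \<le> j"
  defines "k \<equiv> floor_log (j - 1)"
  defines "r \<equiv> j - 1 - 2 ^ k"
  shows "haar_cell N j i = (if i div 2 ^ (N - Suc k) = 2 * r then 1 
     else if i div 2 ^ (N - Suc k) = 2 * r + 1 then -1 else 0)"
proof -
  have "\<not> j \<le> 1" using assms(1) by simp
  then show ?thesis unfolding haar_cell_def Let_def k_def r_def by (rule if_not_P)
qed

lemma cell_index_div:
  assumes "0 \<le> t" "M \<le> N"
  shows "cell_index N t div 2 ^ (N - M) = cell_index M t"
  using assms(2)
proof (induction N rule: dec_induct)
  case (step N)
  then have "cell_index (Suc N) t div 2 ^ (Suc N - M) = cell_index (Suc N) t div 2 div 2 ^ (N - M)"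
    by (simp add: Suc_diff_le div_mult2_eq)
  then show ?case using step cell_index_Suc_div[OF assms(1)] by simp
qed simp

lemma haar_index_bounds:
  assumes "2 \<le> j" "j \<le> 2 ^ N"
  shows "2 ^ floor_log (j - 1) \<le> j - 1" "j - 1 < 2 * 2 ^ floor_log (j - 1)" "Suc (floor_log (j - 1)) \<le> N"
proof -
  show 1: "2 ^ floor_log (j - 1) \<le> j - 1" using assms by (intro floor_log_exp2_le) auto
  show "j - 1 < 2 * 2 ^ floor_log (j - 1)" by (rule floor_log_exp2_gt)
  have "2 ^ floor_log (j - 1) < (2::nat) ^ N" using 1 assms by linarith
  then show "Suc (floor_log (j - 1)) \<le> N" by (simp add: Suc_le_eq)
qed

lemma haar_eq_haar_cell:
  assumes j: "1 \<le> j" "j \<le> 2 ^ N" and t: "0 \<le> t" "t < 1"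
  shows "haar j t = haar_cell N j (cell_index N t)"
proof (cases "j = 1")
  case True
  then show ?thesis using t by (simp add: haar_def haar_cell_def)
next
  case False
  then have j2: "2 \<le> j" using j by simp
  define k where "k = floor_log (j - 1)"
  define r where "r = j - 1 - 2 ^ k"
  note b = haar_index_bounds[OF j2 j(2), folded k_def]
  have l: "real (j - 2 ^ k) = real r + 1" using b(1) j2 unfolding r_def by (simp add: of_nat_diff)
  have m: "cell_index N t div 2 ^ (N - Suc k) = cell_index (Suc k) t" by (rule cell_index_div[OF t(1) b(3)])
  have ind: "indicat_real {real c / 2 ^ (k + 1)..<(real c + 1) / 2 ^ (k + 1)} t
      = (if cell_index (Suc k) t = c then 1 else 0)" for c
  proof -
    have "t \<in> {real c / 2 ^ (k + 1)..<(real c + 1) / 2 ^ (k + 1)} 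
      \<longleftrightarrow> real c \<le> 2 ^ Suc k * t \<and> 2 ^ Suc k * t < real c + 1"
      by (simp add: pos_divide_le_eq pos_less_divide_eq mult.commute)
    also have "\<dots> \<longleftrightarrow> cell_index (Suc k) t = c"
      using cell_index_eqI[OF t(1), of c "Suc k"] cell_index_bounds[OF t(1), of "Suc k"] by auto
    finally show ?thesis by (simp add: indicator_def)
  qed
  have "haar j t = indicat_real {real (2 * r) / 2 ^ (k + 1)..<(real (2 * r) + 1) / 2 ^ (k + 1)} t
      - indicat_real {real (2 * r + 1) / 2 ^ (k + 1)..<(real (2 * r + 1) + 1) / 2 ^ (k + 1)} t"
    using False j unfolding haar_def Let_def k_def[symmetric] l by (simp add: algebra_simps)
  also have "\<dots> = haar_cell N j (cell_index N t)"
    unfolding ind haar_cell_dyadic[OF j2, folded k_def, folded r_def] m by simp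
  finally show ?thesis .
qed

text \<open>
  The permutation exchanges the two halves of the support of \<open>haar j\<close>. Earlier Haar functions either
  vanish on that support (same dyadic generation) or are constant on it (earlier generations).
\<close>
lemma haar_cell_flip:
  assumes j: "2 \<le> j" "j \<le> 2 ^ N"
  obtains \<pi> where "\<pi> permutes {..<2 ^ N}" "\<And>i. haar_cell N j (\<pi> i) = - haar_cell N j i"
    "\<And>j' i. 1 \<le> j' \<Longrightarrow> j' < j \<Longrightarrow> haar_cell N j' (\<pi> i) = haar_cell N j' i"
proof -
  define k where "k = floor_log (j - 1)"
  define r where "r = j - 1 - 2 ^ k"
  define b :: nat where "b = 2 ^ (N - Suc k)"
  note jb = haar_index_bounds[OF j, folded k_def]
  have r: "r < 2 ^ k" using jb by (simp add: r_def)
  have b0: "0 < b" by (simp add: b_def)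
  have N: "2 ^ k * (2 * b) = 2 ^ N" 
    using jb(3) unfolding b_def by (simp flip: power_add power_Suc)
  define \<pi> where "\<pi> i = (if i div b div 2 = r then if even (i div b) then i + b else i - b else i)" for i
  have \<pi>_other: "\<pi> i = i" if "i div b div 2 \<noteq> r" for i using that by (simp add: \<pi>_def)
  have \<pi>_div: "\<pi> i div b = (if even (i div b) then i div b + 1 else i div b - 1)" if "i div b div 2 = r" for i
  proof (cases "even (i div b)")
    case True
    then show ?thesis using that b0 by (simp add: \<pi>_def)
  next
    case False
    then have "i div b \<noteq> 0" by (intro notI) simp
    then have "b \<le> i" using b0 by (simp add: div_eq_0_iff)
    then show ?thesis using False that b0 by (simp add: \<pi>_def le_div_geq[of b i])
  qed
  have \<pi>_div2: "\<pi> i div b div 2 = i div b div 2" for i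
    using \<pi>_div[of i] \<pi>_other[of i] by (cases "i div b div 2 = r") (auto elim!: oddE)
  have inv: "\<pi> (\<pi> i) = i" for i
  proof (cases "i div b div 2 = r")
    case True
    have le: "b \<le> i" if "odd (i div b)"
    proof -
      have "i div b \<noteq> 0" using that by (intro notI) simp
      then show ?thesis using b0 by (simp add: div_eq_0_iff)
    qed
    have "odd (\<pi> i div b) \<longleftrightarrow> even (i div b)" unfolding \<pi>_div[OF True] by (auto elim!: oddE)
    then show ?thesis using True le \<pi>_div2[of i] unfolding \<pi>_def[of "\<pi> i"] by (auto simp: \<pi>_def[of i])
  qed (simp add: \<pi>_other)
  have lt_iff: "i < 2 ^ N \<longleftrightarrow> i div b div 2 < 2 ^ k" for i
    using b0 by (simp add: N[symmetric] div_mult2_eq[symmetric] div_less_iff_less_mult mult.commute)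
  have "\<pi> permutes {..<2 ^ N}"
  proof (rule bij_imp_permutes)
    show "bij_betw \<pi> {..<2 ^ N} {..<2 ^ N}"
      by (rule bij_betw_byWitness[where f' = \<pi>]) (auto simp: inv lt_iff \<pi>_div2)
    show "\<pi> i = i" if "i \<notin> {..<2 ^ N}" for i
      using that r by (intro \<pi>_other) (auto simp: lt_iff)
  qed
  moreover have "haar_cell N j (\<pi> i) = - haar_cell N j i" for i
  proof -
    have val: "haar_cell N j i = (if i div b = 2 * r then 1 else if i div b = 2 * r + 1 then -1 else 0)" for i
      by (rule haar_cell_dyadic[OF j(1), where N = N, folded k_def, folded r_def, folded b_def])
    show ?thesis
    proof (cases "i div b div 2 = r")
      case True
      then have "i div b = 2 * r \<and> even (i div b) \<or> i div b = 2 * r + 1 \<and> odd (i div b)"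
        by (cases "even (i div b)") (auto elim!: evenE oddE)
      then show ?thesis unfolding val \<pi>_div[OF True] by auto
    next
      case False
      then have "i div b \<noteq> 2 * r" "i div b \<noteq> 2 * r + 1" by auto
      then show ?thesis by (simp add: val \<pi>_other[OF False])
    qed
  qed
  moreover have "haar_cell N j' (\<pi> i) = haar_cell N j' i" if j': "1 \<le> j'" "j' < j" for j' i
  proof (cases "i div b div 2 = r \<and> j' \<noteq> 1")
    case False
    then show ?thesis using \<pi>_other[of i] by (auto simp: haar_cell_def)
  next
    case True
    then have j'2: "2 \<le> j'" "j' \<le> 2 ^ N" using j' j by auto
    define k' where "k' = floor_log (j' - 1)"
    define r' where "r' = j' - 1 - 2 ^ k'"
    note jb' = haar_index_bounds[OF j'2, folded k'_def]
    have val: "haar_cell N j' i = (if i div 2 ^ (N - Suc k') = 2 * r' then 1 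
       else if i div 2 ^ (N - Suc k') = 2 * r' + 1 then -1 else 0)" for i
      by (rule haar_cell_dyadic[OF j'2(1), folded k'_def, folded r'_def])
    have "k' \<le> k" unfolding k_def k'_def using j' by (intro floor_log_le_iff) auto
    then consider "k' = k" | "k' < k" by linarith
    then show ?thesis
    proof cases
      case 1
      then have "r' < r" using jb'(1) jb(1) j' unfolding r_def r'_def 1 by linarith
      moreover have "\<pi> i div b div 2 = r" "i div b div 2 = r" using True by (auto simp: \<pi>_div2)
      ultimately show ?thesis unfolding val 1 b_def[symmetric] by auto
    next
      case 2
      have "N - Suc k' = (N - Suc k) + 1 + (k - Suc k')" using 2 jb(3) by simp
      then have "2 ^ (N - Suc k') = b * 2 * 2 ^ (k - Suc k')" by (simp only: power_add b_def power_one_right)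
      then have "i div 2 ^ (N - Suc k') = i div b div 2 div 2 ^ (k - Suc k')" for i
        by (simp only: div_mult2_eq)
      then show ?thesis by (simp only: val \<pi>_div2)
    qed
  qed
  ultimately show ?thesis by (rule that)
qed

text \<open>
  A function of the earlier Haar functions is invariant under the flip, whereas \<open>haar j\<close> changes sign.
\<close>
lemma sum_haar_cell_zero:
  assumes j: "2 \<le> j" "j \<le> 2 ^ N"
    and \<phi>: "\<And>i i'. i < 2 ^ N \<Longrightarrow> i' < 2 ^ N \<Longrightarrow> 
      (\<And>j'. 1 \<le> j' \<Longrightarrow> j' < j \<Longrightarrow> haar_cell N j' i = haar_cell N j' i') \<Longrightarrow> \<phi> i = \<phi> i'"
  shows "(\<Sum>i<2^N. \<phi> i * haar_cell N j i) = 0"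
proof -
  obtain \<pi> where \<pi>: "\<pi> permutes {..<2 ^ N}" "\<And>i. haar_cell N j (\<pi> i) = - haar_cell N j i"
    "\<And>j' i. 1 \<le> j' \<Longrightarrow> j' < j \<Longrightarrow> haar_cell N j' (\<pi> i) = haar_cell N j' i"
    using haar_cell_flip[OF j] by blast
  have "(\<Sum>i<2^N. \<phi> i * haar_cell N j i) = (\<Sum>i<2^N. \<phi> (\<pi> i) * haar_cell N j (\<pi> i))"
    using sum.permute[OF \<pi>(1), of "\<lambda>i. \<phi> i * haar_cell N j i"] by (simp add: comp_def)
  also have "\<dots> = (\<Sum>i<2^N. - (\<phi> i * haar_cell N j i))"
  proof (rule sum.cong[OF refl])
    fix i :: nat assume i: "i \<in> {..<2 ^ N}"
    then have "\<pi> i < 2 ^ N" using permutes_in_image[OF \<pi>(1), of i] by simp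
    then have "\<phi> (\<pi> i) = \<phi> i" using i \<pi>(3) by (intro \<phi>) auto
    then show "\<phi> (\<pi> i) * haar_cell N j (\<pi> i) = - (\<phi> i * haar_cell N j i)" by (simp add: \<pi>(2))
  qed
  also have "\<dots> = - (\<Sum>i<2^N. \<phi> i * haar_cell N j i)" by (rule sum_negf)
  finally show ?thesis by simp
qed

lemma haar_cell_eq_one:
  assumes j: "1 \<le> j" "j \<le> 2 ^ N"
  shows "\<exists>i<2 ^ N. haar_cell N j i = 1"
proof (cases "j = 1")
  case False
  then have j2: "2 \<le> j" using j by simp
  define k where "k = floor_log (j - 1)"
  define r where "r = j - 1 - 2 ^ k"
  note jb = haar_index_bounds[OF j2 j(2), folded k_def]
  have r: "r < 2 ^ k" using jb by (simp add: r_def)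
  have "2 * r * 2 ^ (N - Suc k) < 2 * 2 ^ k * 2 ^ (N - Suc k)" using r by simp
  also have "\<dots> = 2 ^ N" using jb(3) by (simp flip: power_add power_Suc)
  finally have "2 * r * 2 ^ (N - Suc k) < 2 ^ N" .
  moreover have "haar_cell N j (2 * r * 2 ^ (N - Suc k)) = 1"
    unfolding haar_cell_dyadic[OF j2, folded k_def, folded r_def] by simp
  ultimately show ?thesis by blast
qed (auto simp: haar_cell_def intro!: exI[of _ 0])

context ri_space
begin

text \<open>The Haar functions are numbered from \<open>0\<close> here, as is usual for a basis.\<close>
definition haar_vec :: "nat \<Rightarrow> 'a" where
  "haar_vec n = class_of rep (haar (Suc n))"

lemma haar_vec_step: 
  assumes "n < 2 ^ N"
  shows "represents rep (stepv N (haar_cell N (Suc n))) (haar (Suc n))"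
    and "haar_vec n = stepv N (haar_cell N (Suc n))"
proof -
  show 1: "represents rep (stepv N (haar_cell N (Suc n))) (haar (Suc n))"
    by (rule represents_cong[OF represents_stepv])
      (use AE_I01_half_open in eventually_elim, 
        use assms in \<open>simp add: step_fun_def haar_eq_haar_cell[of "Suc n" N, symmetric]\<close>)
  show "haar_vec n = stepv N (haar_cell N (Suc n))" unfolding haar_vec_def by (rule class_of_eq[OF 1])
qed

lemma represents_haar_vec: "represents rep (haar_vec n) (haar (Suc n))"
  using haar_vec_step[of n n] by (simp add: less_exp)

lemma haar_expansion_step:
  assumes "\<And>j. j \<in> J \<Longrightarrow> j < 2 ^ N"
  shows "(\<Sum>j\<in>J. a j *\<^sub>R haar_vec j) = stepv N (\<lambda>i. \<Sum>j\<in>J. a j * haar_cell N (Suc j) i)"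
  unfolding stepv_sum stepv_scaleR by (intro sum.cong) (simp_all add: haar_vec_step(2) assms)

text \<open>
  Changing the sign of the last term of a Haar polynomial is a rearrangement. The truncated polynomial is
  the mean of the original one and the one with changed sign, so its norm is not larger.
\<close>
lemma projection_bound_haar: "projection_bound 1 haar_vec"
proof -
  have step: "norm (\<Sum>i<n. a i *\<^sub>R haar_vec i) \<le> norm (\<Sum>i<Suc n. a i *\<^sub>R haar_vec i)" for a n
  proof (cases "n = 0")
    case False
    define N where "N = Suc n"
    have less: "j < 2 ^ N" if "j < Suc n" for j
      using that less_exp[of N] by (simp add: N_def)
    have "Suc n < 2 ^ N" unfolding N_def by (rule less_exp)
    then have j: "2 \<le> Suc n" "Suc n \<le> 2 ^ N" using False by auto
    obtain \<pi> where \<pi>: "\<pi> permutes {..<2 ^ N}" "\<And>i. haar_cell N (Suc n) (\<pi> i) = - haar_cell N (Suc n) i"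
      "\<And>j' i. 1 \<le> j' \<Longrightarrow> j' < Suc n \<Longrightarrow> haar_cell N j' (\<pi> i) = haar_cell N j' i"
      using haar_cell_flip[OF j] by blast
    define f where "f i = (\<Sum>j<n. a j * haar_cell N (Suc j) i)" for i
    define g where "g i = a n * haar_cell N (Suc n) i" for i
    have fg: "(\<Sum>i<n. a i *\<^sub>R haar_vec i) = stepv N f" "(\<Sum>i<Suc n. a i *\<^sub>R haar_vec i) = stepv N (\<lambda>i. f i + g i)"
      using haar_expansion_step[of "{..<n}" N a] haar_expansion_step[of "{..<Suc n}" N a] less
      by (auto simp: f_def[abs_def] g_def[abs_def])
    have "f (\<pi> i) + g (\<pi> i) = f i - g i" for i
      using \<pi>(2,3) by (simp add: f_def g_def)
    then have "norm (stepv N (\<lambda>i. f i - g i)) = norm (stepv N (\<lambda>i. f i + g i))"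
      using norm_stepv_permute[OF \<pi>(1), of "\<lambda>i. f i + g i"] by simp
    moreover have "2 *\<^sub>R stepv N f = stepv N (\<lambda>i. f i + g i) + stepv N (\<lambda>i. f i - g i)"
      by (simp add: stepv_add stepv_diff scaleR_2)
    then have "norm (2 *\<^sub>R stepv N f) \<le> norm (stepv N (\<lambda>i. f i + g i)) + norm (stepv N (\<lambda>i. f i - g i))"
      by (simp only: norm_triangle_ineq)
    ultimately show ?thesis unfolding fg by simp
  qed simp
  show ?thesis unfolding projection_bound_def
  proof (intro allI impI)
    fix a :: "nat \<Rightarrow> real" and m n :: nat assume "m \<le> n"
    with lift_Suc_mono_le[of "\<lambda>n. norm (\<Sum>i<n. a i *\<^sub>R haar_vec i)", OF step]
    show "norm (\<Sum>i<m. a i *\<^sub>R haar_vec i) \<le> 1 * norm (\<Sum>i<n. a i *\<^sub>R haar_vec i)" by simp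
  qed
qed

text \<open>
  If a cell of level \<open>N\<close> had an indicator function of norm \<open>0\<close>, then by rearrangement so would all other
  cells, and hence also the constant function \<open>1\<close>.
\<close>
lemma stepv_nonzero:
  assumes "i < 2 ^ N" "v i \<noteq> 0"
  shows "stepv N v \<noteq> 0"
proof
  assume v0: "stepv N v = 0"
  define U where "U k = stepv N (\<lambda>i. if i = k then 1 else 0)" for k
  have "norm (v i *\<^sub>R U i) \<le> norm (stepv N v)"
    unfolding U_def stepv_scaleR[symmetric] by (rule norm_stepv_mono) auto
  then have "norm (v i *\<^sub>R U i) \<le> 0" by (simp only: v0 norm_zero)
  then have "v i *\<^sub>R U i = 0" by (simp only: norm_le_zero_iff)
  then have Ui: "U i = 0" using assms(2) by simp
  have U: "U k = 0" if "k < 2 ^ N" for k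
  proof -
    have "Transposition.transpose i k permutes {..<2 ^ N}" using assms(1) that by (intro permutes_swap_id) auto
    from norm_stepv_permute[OF this, of "\<lambda>l. if l = i then 1 else 0"]
    have "norm (stepv N (\<lambda>l. if Transposition.transpose i k l = i then 1 else 0)) = norm (U i)" by (simp add: U_def)
    moreover have "(\<lambda>l. if Transposition.transpose i k l = i then 1 else 0) = (\<lambda>l. if l = k then 1 else 0 :: real)"
      by (auto simp: fun_eq_iff Transposition.transpose_def)
    ultimately have "norm (U k) = norm (U i)" by (simp add: U_def)
    then show ?thesis using Ui by simp
  qed
  have "stepv N (\<lambda>_. 1) = stepv N (\<lambda>i. \<Sum>k<2^N. if i = k then 1 else 0)"
    by (rule stepv_cong) simp
  also have "\<dots> = (\<Sum>k<2^N. U k)" by (simp only: stepv_sum U_def)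
  also have "\<dots> = 0" using U by simp
  finally have "norm (stepv N (\<lambda>_. 1)) = 0" by simp
  moreover have "(\<integral>t. \<bar>rep (stepv N (\<lambda>_. 1)) t\<bar> \<partial>I01) = (\<integral>t. 1 \<partial>I01)"
    using represents_stepv[of N "\<lambda>_. 1"] unfolding represents_def
    by (intro integral_cong_AE) (auto elim!: eventually_mono simp: step_fun_def)
  moreover have "(\<integral>t. 1 \<partial>I01) = (1::real)"
    by (simp add: measure_restrict_space)
  ultimately show False using L1_norm_le[of "stepv N (\<lambda>_. 1)"] by simp
qed

lemma haar_vec_nonzero: "haar_vec n \<noteq> 0"
proof -
  have n: "n < 2 ^ n" by (rule less_exp)
  then obtain i where "i < 2 ^ n" "haar_cell n (Suc n) i = 1"
    using haar_cell_eq_one[of "Suc n", OF _ Suc_leI[OF n]] by auto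
  then show ?thesis unfolding haar_vec_step(2)[OF n] by (intro stepv_nonzero) auto
qed

text \<open>
  Induction on the level: the indicators of the two halves of a cell are half the sum and half the
  difference of the indicator of the cell and the Haar function supported on it.
\<close>
lemma stepv_in_haar_span: "stepv N v \<in> span (range haar_vec)"
proof -
  define U where "U N k = stepv N (\<lambda>i. if i = k then 1 else 0)" for N k
  have U: "k < 2 ^ N \<Longrightarrow> U N k \<in> span (range haar_vec)" for N k
  proof (induction N arbitrary: k)
    case 0
    then have "haar_vec 0 = U 0 k"
      unfolding U_def haar_vec_step(2)[of 0 0, simplified] by (intro stepv_cong) (simp add: haar_cell_def)
    then show ?case by (metis rangeI span_base)
  next
    case (Suc N)
    define q where "q = k div 2"
    have q: "q < 2 ^ N" using Suc.prems by (simp add: q_def)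
    have sum: "U N q = U (Suc N) (2 * q) + U (Suc N) (2 * q + 1)"
      unfolding U_def stepv_refine[of N] stepv_add[symmetric] by (intro stepv_cong) auto
    define j where "j = 2 ^ N + q"
    have "floor_log j = N" unfolding j_def using q by (intro floor_log_eqI) auto
    then have cells: "haar_cell (Suc N) (Suc j) i = (if i = 2 * q then 1 else 0) - (if i = 2 * q + 1 then 1 else 0)" for i
      by (simp add: haar_cell_def Let_def j_def)
    have "j < 2 ^ Suc N" using q by (simp add: j_def)
    from haar_vec_step(2)[OF this] have diff: "haar_vec j = U (Suc N) (2 * q) - U (Suc N) (2 * q + 1)"
      unfolding U_def stepv_diff[symmetric] ext[OF cells] .
    have mem: "U N q \<in> span (range haar_vec)" "haar_vec j \<in> span (range haar_vec)"
      using Suc.IH[OF q] by (auto intro: span_base)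
    have "U (Suc N) (2 * q) = (1/2) *\<^sub>R (U N q + haar_vec j)" 
      "U (Suc N) (2 * q + 1) = (1/2) *\<^sub>R (U N q - haar_vec j)"
      unfolding sum diff by (simp_all add: algebra_simps flip: scaleR_add_left)
    then have "U (Suc N) (2 * q) \<in> span (range haar_vec)" "U (Suc N) (2 * q + 1) \<in> span (range haar_vec)"
      using mem by (metis span_scale span_add span_diff)+
    moreover have "k = 2 * q \<or> k = 2 * q + 1" unfolding q_def by presburger
    ultimately show ?case by blast
  qed
  have "stepv N v = stepv N (\<lambda>i. \<Sum>k<2^N. v k * (if i = k then 1 else 0))"
    by (rule stepv_cong) (simp add: if_distrib cong: if_cong)
  also have "\<dots> = (\<Sum>k<2^N. v k *\<^sub>R U N k)"
    by (simp only: stepv_sum stepv_scaleR U_def)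
  also have "\<dots> \<in> span (range haar_vec)" using U by (intro span_sum span_scale) auto
  finally show ?thesis .
qed

lemma norm_square_function_le_sign_average:
  "norm (stepv N (\<lambda>i. square_function n (\<lambda>k. d k i))) \<le> 2 * sign_average n (\<lambda>k. stepv N (d k))"
proof -
  let ?E = "{..<n} \<rightarrow>\<^sub>E {-1, 1::real}"
  have "norm (stepv N (\<lambda>i. square_function n (\<lambda>k. d k i))) 
     \<le> norm (stepv N (\<lambda>i. (2 / 2 ^ n) * (\<Sum>\<epsilon>\<in>?E. \<bar>\<Sum>k<n. \<epsilon> k * d k i\<bar>)))"
  proof (rule norm_stepv_mono)
    fix i
    have "0 \<le> (2 / 2 ^ n) * (\<Sum>\<epsilon>\<in>?E. \<bar>\<Sum>k<n. \<epsilon> k * d k i\<bar>)" 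
      by (intro mult_nonneg_nonneg sum_nonneg) auto
    then show "\<bar>square_function n (\<lambda>k. d k i)\<bar> \<le> \<bar>(2 / 2 ^ n) * (\<Sum>\<epsilon>\<in>?E. \<bar>\<Sum>k<n. \<epsilon> k * d k i\<bar>)\<bar>"
      using khintchine[of n "\<lambda>k. d k i"] square_function_nonneg[of n "\<lambda>k. d k i"] by simp
  qed
  also have "\<dots> = (2 / 2 ^ n) * norm (\<Sum>\<epsilon>\<in>?E. stepv N (\<lambda>i. \<bar>\<Sum>k<n. \<epsilon> k * d k i\<bar>))"
    unfolding stepv_scaleR stepv_sum norm_scaleR by simp
  also have "\<dots> \<le> (2 / 2 ^ n) * (\<Sum>\<epsilon>\<in>?E. norm (\<Sum>k<n. \<epsilon> k *\<^sub>R stepv N (d k)))"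
  proof (intro mult_left_mono sum_norm_le)
    fix \<epsilon>
    have "norm (stepv N (\<lambda>i. \<bar>\<Sum>k<n. \<epsilon> k * d k i\<bar>)) \<le> norm (stepv N (\<lambda>i. \<Sum>k<n. \<epsilon> k * d k i))"
      by (rule norm_stepv_mono) simp
    then show "norm (stepv N (\<lambda>i. \<bar>\<Sum>k<n. \<epsilon> k * d k i\<bar>)) \<le> norm (\<Sum>k<n. \<epsilon> k *\<^sub>R stepv N (d k))"
      by (simp only: stepv_sum stepv_scaleR)
  qed simp
  also have "\<dots> = 2 * sign_average n (\<lambda>k. stepv N (d k))" by (simp add: sign_average_def)
  finally show ?thesis .
qed

lemma norm_martingale_le_sign_average:
  assumes d: "martingale_differences {..<2 ^ N} n d" and N: "0 < N" and r: "r < 1"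
    and dil: "\<And>v. norm (stepv (Suc N) (\<lambda>i. if i < 2 ^ N then v i else 0)) \<le> r * norm (stepv N v)"
  shows "norm (\<Sum>k<n. stepv N (d k)) \<le> 72 / (1 - r) * sign_average n (\<lambda>k. stepv N (d k))"
proof -
  define u where "u i = max_partial_sum n (\<lambda>k. d k i)" for i
  define S where "S i = square_function n (\<lambda>k. d k i)" for i
  have "norm (\<Sum>k<n. stepv N (d k)) \<le> norm (stepv N u)"
    unfolding stepv_sum[symmetric] u_def
    by (rule norm_stepv_mono) (rule order_trans[OF max_partial_sum_ge abs_ge_self])
  moreover have "norm (stepv N u) \<le> r * norm (stepv N u) + 2 * 18 * norm (stepv N S)"
  proof (rule norm_le_of_garsia[OF N _ _ _ _ dil])
    show "0 \<le> u i" for i unfolding u_def by (rule max_partial_sum_nonneg)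
    show "0 \<le> S i" for i unfolding S_def by (rule square_function_nonneg)
    show "(\<Sum>i<2 ^ N. max 0 (u i - \<theta>)) \<le> 18 * sum S {i \<in> {..<2 ^ N}. \<theta> < u i}" if "0 \<le> \<theta>" for \<theta>
      unfolding u_def S_def by (rule davis_inequality_above_level[OF _ d that]) simp
  qed simp
  then have "(1 - r) * norm (stepv N u) \<le> 36 * norm (stepv N S)" by (simp add: algebra_simps)
  then have "norm (stepv N u) \<le> 36 / (1 - r) * norm (stepv N S)" using r by (simp add: field_simps)
  moreover have "36 / (1 - r) * norm (stepv N S) \<le> 36 / (1 - r) * (2 * sign_average n (\<lambda>k. stepv N (d k)))"
    unfolding S_def using r by (intro mult_left_mono norm_square_function_le_sign_average) simp
  ultimately show ?thesis by simp
qed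

text \<open>
  A block depends on Haar functions later than those of all previous blocks. The index \<open>0\<close>, the constant
  Haar function, can occur in the initial block only.
\<close>
lemma haar_blocks_martingale:
  assumes p: "strict_mono p" and q: "\<And>k. q k \<le> p (Suc k)" and N: "p n \<le> 2 ^ N"
  shows "martingale_differences {..<2 ^ N} n (\<lambda>k i. a k * (\<Sum>j=p k..<q k. c k j * haar_cell N (Suc j) i))"
  unfolding martingale_differences_def
proof (intro allI impI, elim conjE)
  fix k and \<phi> :: "nat \<Rightarrow> real"
  define d where "d k i = a k * (\<Sum>j=p k..<q k. c k j * haar_cell N (Suc j) i)" for k i
  assume k: "0 < k" "k < n" and "\<forall>i\<in>{..<2 ^ N}. \<forall>i'\<in>{..<2 ^ N}. 
      (\<forall>l<k. a l * (\<Sum>j=p l..<q l. c l j * haar_cell N (Suc j) i) 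
           = a l * (\<Sum>j=p l..<q l. c l j * haar_cell N (Suc j) i')) \<longrightarrow> \<phi> i = \<phi> i'"
  then have \<phi>: "\<And>i i'. i < 2 ^ N \<Longrightarrow> i' < 2 ^ N \<Longrightarrow> (\<And>l. l < k \<Longrightarrow> d l i = d l i') \<Longrightarrow> \<phi> i = \<phi> i'"
    unfolding d_def by blast
  have zero: "(\<Sum>i<2^N. \<phi> i * haar_cell N (Suc j) i) = 0" if j: "j \<in> {p k..<q k}" for j
  proof (rule sum_haar_cell_zero)
    have "p 0 < p k" using p k by (simp add: strict_mono_less)
    then show "2 \<le> Suc j" using j by simp
    have "p (Suc k) \<le> p n" using p k by (simp add: strict_mono_less_eq)
    then show "Suc j \<le> 2 ^ N" using j q[of k] N by auto
    fix i i' :: nat assume "i < 2 ^ N" "i' < 2 ^ N"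
      and eq: "\<And>j'. 1 \<le> j' \<Longrightarrow> j' < Suc j \<Longrightarrow> haar_cell N j' i = haar_cell N j' i'"
    then show "\<phi> i = \<phi> i'"
    proof (intro \<phi>)
      fix l assume "l < k"
      then have "p (Suc l) \<le> p k" using p by (simp add: strict_mono_less_eq)
      then have "Suc j' < Suc j" if "j' < q l" for j' using that q[of l] j by auto
      then show "d l i = d l i'" unfolding d_def by (intro arg_cong2[where f="(*)"] refl sum.cong eq) auto
    qed
  qed
  have "(\<Sum>i<2^N. \<phi> i * d k i) = (\<Sum>i<2^N. \<Sum>j=p k..<q k. a k * c k j * (\<phi> i * haar_cell N (Suc j) i))"
    by (simp add: d_def sum_distrib_left mult_ac)
  also have "\<dots> = (\<Sum>j=p k..<q k. a k * c k j * (\<Sum>i<2^N. \<phi> i * haar_cell N (Suc j) i))"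
    by (subst sum.swap) (simp add: sum_distrib_left)
  also have "\<dots> = 0" using zero by simp
  finally show "(\<Sum>i<2^N. \<phi> i * (a k * (\<Sum>j=p k..<q k. c k j * haar_cell N (Suc j) i))) = 0"
    by (simp add: d_def)
qed

end

context separable_ri_space
begin

lemma haar_dense: "closure (span (range haar_vec)) = UNIV"
proof -
  have "x \<in> closure (span (range haar_vec))" for x :: 'a
    unfolding closure_approachable
  proof (intro allI impI)
    fix e :: real assume "0 < e"
    then obtain N v where "norm (x - stepv N v) < e" using stepv_dense by blast
    then show "\<exists>y\<in>span (range haar_vec). dist y x < e"
      using stepv_in_haar_span by (intro bexI[of _ "stepv N v"]) (auto simp: dist_norm norm_minus_commute)
  qed
  then show ?thesis by blast
qed

lemma haar_blocks_RUD:
  assumes boyd: "upper_boyd_index rep < \<infinity>"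
    and p: "strict_mono p" and pq: "\<And>k. p k \<le> q k" "\<And>k. q k \<le> p (Suc k)"
    and y: "\<And>k. y k = (\<Sum>j=p k..<q k. c k j *\<^sub>R haar_vec j)" and nz: "\<And>k. y k \<noteq> 0"
  shows "RUD y"
proof -
  obtain r where r: "r < 1" 
    "\<And>N v. norm (stepv (Suc N) (\<lambda>i. if i < 2 ^ N then v i else 0)) \<le> r * norm (stepv N v)"
    using dilation_contraction[OF boyd] by blast
  have "projection_bound 1 y"
    by (rule projection_bound_blocks[where p = p and q = q and c = c, OF projection_bound_haar pq y])
  then have "basic_sequence y" using nz by (intro projection_bound_imp_basic_sequence[of 1]) auto
  moreover have "norm (\<Sum>k<n. a k *\<^sub>R y k) \<le> 72 / (1 - r) * sign_average n (\<lambda>k. a k *\<^sub>R y k)" for n a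
  proof -
    define N where "N = Suc (p n)"
    have N: "p n \<le> 2 ^ N" unfolding N_def using less_exp[of "Suc (p n)"] by linarith
    define d where "d k i = a k * (\<Sum>j=p k..<q k. c k j * haar_cell N (Suc j) i)" for k i
    have d: "stepv N (d k) = a k *\<^sub>R y k" if "k < n" for k
    proof -
      have "p (Suc k) \<le> p n" using p that by (simp add: strict_mono_less_eq)
      then have "j < 2 ^ N" if "j \<in> {p k..<q k}" for j using that pq(2)[of k] N by auto
      from haar_expansion_step[of "{p k..<q k}" N "c k", OF this]
      show ?thesis unfolding d_def y stepv_scaleR by simp
    qed
    have "norm (\<Sum>k<n. stepv N (d k)) \<le> 72 / (1 - r) * sign_average n (\<lambda>k. stepv N (d k))"
      by (rule norm_martingale_le_sign_average[OF _ _ r])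
        (use haar_blocks_martingale[OF p pq(2) N] in \<open>simp_all add: d_def[abs_def] N_def\<close>)
    moreover have "sign_average n (\<lambda>k. stepv N (d k)) = sign_average n (\<lambda>k. a k *\<^sub>R y k)"
      unfolding sign_average_def using d by simp
    ultimately show ?thesis using d by simp
  qed
  ultimately show ?thesis unfolding RUD_def by blast
qed

end

section \<open>RUD block sequences and subsequences\<close>

theorem theorem5p1:
  fixes rep :: "'a::banach \<Rightarrow> real \<Rightarrow> real"
  assumes "ri_space rep"
    and "separable_space (euclidean :: 'a topology)"
    and "upper_boyd_index rep < \<infinity>"
  shows "(\<forall>y::nat \<Rightarrow> 'a. haar_block_sequence rep y \<longrightarrow> RUD y) \<and>
         (\<forall>x::nat \<Rightarrow> 'a. weakly_null x \<and> \<not> x \<longlonglongrightarrow> 0 \<longrightarrow>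
              (\<exists>r::nat \<Rightarrow> nat. strict_mono r \<and> basic_sequence (x \<circ> r) \<and> RUD (x \<circ> r)))"
proof -
  interpret separable_ri_space rep
    by (intro separable_ri_space.intro assms(1) separable_ri_space_axioms.intro assms(2))
  have blocks: "RUD y" if block: "haar_block_sequence rep y" for y
  proof -
    obtain p q :: "nat \<Rightarrow> nat" and b :: "nat \<Rightarrow> real" where p0: "1 \<le> p 0"
      and pq: "\<And>k. p k \<le> q k" "\<And>k. q k < p (Suc k)" and nz: "\<And>k. y k \<noteq> 0"
      and y: "\<And>k. represents rep (y k) (\<lambda>t. \<Sum>j = p k..q k. b j * haar j t)"
      using block unfolding haar_block_sequence_def by blast
    have p_Suc: "p k < p (Suc k)" for k using pq[of k] by linarith
    then have "strict_mono p" by (rule strict_monoI_Suc)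
    then have p1: "1 \<le> p k" for k
      using p0 strict_mono_less_eq[of p 0 k] by simp
    have y_eq: "y k = (\<Sum>j = p k - 1..<q k. b (Suc j) *\<^sub>R haar_vec j)" for k
    proof (rule represents_unique[OF y])
      have "represents rep (\<Sum>j = p k - 1..<q k. b (Suc j) *\<^sub>R haar_vec j) 
          (\<lambda>t. \<Sum>j = p k - 1..<q k. b (Suc j) * haar (Suc j) t)"
        by (intro represents_sum represents_scaleR represents_haar_vec)
      moreover have set_eq: "{p k..q k} = Suc ` {p k - 1..<q k}"
        using p1[of k] by (simp add: image_Suc_atLeastLessThan atLeastLessThanSuc_atLeastAtMost)
      have "(\<Sum>j = p k..q k. b j * haar j t) = (\<Sum>j = p k - 1..<q k. b (Suc j) * haar (Suc j) t)" for t
        unfolding set_eq by (simp only: sum.reindex[OF inj_Suc] comp_def)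
      ultimately show "represents rep (\<Sum>j = p k - 1..<q k. b (Suc j) *\<^sub>R haar_vec j) 
          (\<lambda>t. \<Sum>j = p k..q k. b j * haar j t)"
        by (simp only:)
    qed
    have mono: "strict_mono (\<lambda>k. p k - 1)"
    proof (rule strict_monoI_Suc)
      show "p k - 1 < p (Suc k) - 1" for k using p1[of k] p_Suc[of k] by linarith
    qed
    have le: "p k - 1 \<le> q k" "q k \<le> p (Suc k) - 1" for k using pq[of k] by auto
    show ?thesis
      by (rule haar_blocks_RUD[where c = "\<lambda>_ j. b (Suc j)", OF assms(3) mono le y_eq nz])
  qed
  have "\<exists>r. strict_mono r \<and> RUD (x \<circ> r)" if x: "weakly_null x" "\<not> x \<longlonglongrightarrow> 0" for x :: "nat \<Rightarrow> 'a"
  proof (rule weakly_null_RUD_subsequence[OF projection_bound_haar _ haar_vec_nonzero haar_dense _ x])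
    fix p :: "nat \<Rightarrow> nat" and c :: "nat \<Rightarrow> nat \<Rightarrow> real" and y
    assume p: "strict_mono p" and y: "\<And>k. y k = (\<Sum>j=p k..<p (Suc k). c k j *\<^sub>R haar_vec j)" 
      and nz: "\<And>k. y k \<noteq> 0"
    have le: "p k \<le> p (Suc k)" for k using p by (simp add: strict_mono_less_eq)
    show "RUD y"
      by (rule haar_blocks_RUD[where q = "\<lambda>k. p (Suc k)" and c = c, OF assms(3) p le order_refl y nz])
  qed simp
  then have "\<exists>r. strict_mono r \<and> basic_sequence (x \<circ> r) \<and> RUD (x \<circ> r)" 
    if "weakly_null x \<and> \<not> x \<longlonglongrightarrow> 0" for x :: "nat \<Rightarrow> 'a"
    using that unfolding RUD_def by blast
  then show ?thesis using blocks by (intro conjI allI impI)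
qed

end
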